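(* Let $T$ be a finitely generated abelian group and let $A$ be a finitely generated $\mathbb ZT$-module. Form the semidirect product $G=A\rtimes T$. Then the relative Dehn function of $G$ (relative to the variety of metabelian groups) satisfies $\tilde\delta_G(n)\preccurlyeq\max\{n^3,\delta_A^3(n^2)\}$, where $\delta_A$ is the Dehn function of the module $A$ and $\delta_A^3(n^2)$ denotes $(\delta_A(n^2))^3$.
   Context: Relative Dehn function: $M_X=F(X)/F(X)''$ is the free metabelian group on $X$; a finite relative presentation $\mathcal Q=\langle X\mid R\rangle_{\mathcal S_2}$ of a metabelian group $G$ consists of finite $X$, $R\subset M_X$ with $G\cong M_X/\langle\langle R\rangle\rangle$; for $w\in M_X$ with $w=_G1$, $\widetilde{\mathrm{Area}}_{\mathcal Q}(w)$ is the least $l$ with $w=\prod_{i=1}^l f_i^{-1}r_if_i$ in $M_X$, $r_i\in R\cup R^{-1}$, $f_i\in M_X$; $\tilde\delta_{\mathcal Q}(n)=\sup\{\widetilde{\mathrm{Area}}_{\mathcal Q}(w):w=_G1,|w|_{M_X}\le n\}$. For $f,g:\mathbb N\to\mathbb N$ (with $0\notin\mathbb N$), $f\preccurlyeq g$ means there is $C>0$ with $f(n)\le Cg(Cn)+Cn+C$ for all $n$; up to the induced equivalence $\tilde\delta_{\mathcal Q}$ depends only on $G$ and is denoted $\tilde\delta_G$. Dehn function of a module: let $t_1,\dots,t_s$ be a basis of the abelian group $T$ (a direct decomposition into cyclic groups), and represent each element of $T$ by its unique ordered word $t_1^{m_1}\cdots t_s^{m_s}$ (with $0\le m_i<\mathrm{ord}(t_i)$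 when $t_i$ has finite order); elements of $T$ are ordered by degree $\sum|m_i|$ first and, for equal degree, lexicographically as monomials in the variables $t_1,t_1^{-1},\dots,t_s,t_s^{-1}$ (earlier variables larger). Let $a_1,\dots,a_m$ generate $A$ as a $\mathbb ZT$-module, let $M$ be the free $\mathbb ZT$-module with basis $a_1,\dots,a_m$, let $S$ be the kernel of $M\to A$, and let $f_1,\dots,f_l$ be a finite generating set of $S$. For $\mu=\sum_u c_uu\in\mathbb ZT$ let $a_i^{\mu}$ be the word $\prod_u u^{-1}a_i^{c_u}u$, the $u$ being taken in decreasing order. For $f=\sum_i\mu_ia_i\in M$, let $\|f\|$ be the length of the reduced word representing $a_1^{\mu_1}\cdots a_m^{\mu_m}$ in the free group on $a_1,\dots,a_m,t_1,\dots,t_s$. For $\alpha=\sum_u c_uu\in\mathbb ZT$ put $|\alpha|=\sum_u|c_u|$. For $f\in S$, $\mathrm{Area}_A(f)$ is the minimum of $\sum_{i=1}^l|\alpha_i|$ over all expressions $f=\sum_{i=1}^l\alpha_if_i$ with $\alpha_i\in\mathbb ZT$, and $\delta_A(n)=\max\{\mathrm{Area}_A(f): f\in S,\ \|f\|\le n\}$. *)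

theory Defs
  imports "HOL-Algebra.Generated_Groups" "HOL-Algebra.Product_Groups"
    "HOL-Algebra.Multiplicative_Group" "HOL-Algebra.Module" "HOL-Library.Extended_Nat"
begin

section \<open>Free groups\<close>

text \<open>A letter \<open>(x, True)\<close> stands for the generator \<open>x\<close>, and \<open>(x, False)\<close> for its inverse.
  Elements of the free group are reduced words.\<close>

type_synonym 'x letter = "'x \<times> bool"

definition inv_letter :: "'x letter \<Rightarrow> 'x letter" where
  "inv_letter p = (fst p, \<not> snd p)"

definition inv_word :: "'x letter list \<Rightarrow> 'x letter list" where
  "inv_word w = rev (map inv_letter w)"

definition pow_word :: "'x \<Rightarrow> int \<Rightarrow> 'x letter list" where
  "pow_word x k = replicate (nat \<bar>k\<bar>) (x, 0 \<le> k)"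

definition reduced :: "'x letter list \<Rightarrow> bool" where
  "reduced w \<longleftrightarrow> successively (\<lambda>p q. q \<noteq> inv_letter p) w"

definition reduce_Cons :: "'x letter \<Rightarrow> 'x letter list \<Rightarrow> 'x letter list" where
  "reduce_Cons p w =
     (case w of [] \<Rightarrow> [p] | q # v \<Rightarrow> if q = inv_letter p then v else p # w)"

definition reduce :: "'x letter list \<Rightarrow> 'x letter list" where
  "reduce w = foldr reduce_Cons w []"

definition free_group :: "'x set \<Rightarrow> 'x letter list monoid" where
  "free_group X = \<lparr>carrier = {w. reduced w \<and> fst ` set w \<subseteq> X},
                   monoid.mult = (\<lambda>u v. reduce (u @ v)),
                   one = []\<rparr>"


section \<open>Relative presentations and relative Dehn functions\<close>

definition free_metabelian :: "'x set \<Rightarrow> 'x letter list set monoid" where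
  "free_metabelian X = (let F = free_group X in F Mod derived F (derived F (carrier F)))"

text \<open>An element of the free metabelian group is a coset, that is, the set of all reduced words
  representing it.\<close>

definition word_length :: "'x letter list set \<Rightarrow> nat" where
  "word_length w = (LEAST k. \<exists>v\<in>w. length v = k)"

definition normal_closure :: "('g, 'b) monoid_scheme \<Rightarrow> 'g set \<Rightarrow> 'g set" where
  "normal_closure G R =
     generate G {inv\<^bsub>G\<^esub> g \<otimes>\<^bsub>G\<^esub> r \<otimes>\<^bsub>G\<^esub> g | g r. g \<in> carrier G \<and> r \<in> R}"

definition rel_presentation ::
  "'x set \<Rightarrow> 'x letter list set set \<Rightarrow> ('g, 'b) monoid_scheme \<Rightarrow> bool" where
  "rel_presentation X R G \<longleftrightarrow>
     finite X \<and> finite R \<and> R \<subseteq> carrier (free_metabelian X) \<and>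
     G \<cong> free_metabelian X Mod normal_closure (free_metabelian X) R"

definition conj_prod :: "('g, 'b) monoid_scheme \<Rightarrow> ('g \<times> 'g) list \<Rightarrow> 'g" where
  "conj_prod G ps = foldr (\<lambda>(f, r) w. (inv\<^bsub>G\<^esub> f \<otimes>\<^bsub>G\<^esub> r \<otimes>\<^bsub>G\<^esub> f) \<otimes>\<^bsub>G\<^esub> w) ps \<one>\<^bsub>G\<^esub>"

definition rel_area ::
  "'x set \<Rightarrow> 'x letter list set set \<Rightarrow> 'x letter list set \<Rightarrow> enat" where
  "rel_area X R w =
     (let M = free_metabelian X in
      INF ps \<in> {ps. set ps \<subseteq> carrier M \<times> (R \<union> (\<lambda>r. inv\<^bsub>M\<^esub> r) ` R) \<and> w = conj_prod M ps}.
        enat (length ps))"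

text \<open>Dehn functions take values in \<^typ>\<open>enat\<close>, so that the suprema need no side condition.\<close>

definition rel_dehn :: "'x set \<Rightarrow> 'x letter list set set \<Rightarrow> nat \<Rightarrow> enat" where
  "rel_dehn X R n =
     (SUP w \<in> {w \<in> normal_closure (free_metabelian X) R. word_length w \<le> n}. rel_area X R w)"

text \<open>The comparison is between functions on the positive integers.\<close>

definition preceq :: "(nat \<Rightarrow> enat) \<Rightarrow> (nat \<Rightarrow> enat) \<Rightarrow> bool" (infix \<open>\<preceq>\<close> 50) where
  "f \<preceq> g \<longleftrightarrow>
     (\<exists>C>0. \<forall>n\<ge>1. f n \<le> enat C * g (C * n) + enat (C * n) + enat C)"


section \<open>Modules over integral group rings\<close>

definition supp :: "('t \<Rightarrow> int) \<Rightarrow> 't set" where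
  "supp \<alpha> = {u. \<alpha> u \<noteq> 0}"

definition of_elem :: "'t \<Rightarrow> 't \<Rightarrow> int" where
  "of_elem t = (\<lambda>u. if u = t then 1 else 0)"

definition group_ring :: "('t, 'b) monoid_scheme \<Rightarrow> ('t \<Rightarrow> int) ring" where
  "group_ring T =
     \<lparr>carrier = {\<alpha>. finite (supp \<alpha>) \<and> supp \<alpha> \<subseteq> carrier T},
      monoid.mult = (\<lambda>\<alpha> \<beta> u.
        \<Sum>(v, w) \<in> {(v, w) \<in> supp \<alpha> \<times> supp \<beta>. v \<otimes>\<^bsub>T\<^esub> w = u}. \<alpha> v * \<beta> w),
      one = of_elem \<one>\<^bsub>T\<^esub>,
      zero = (\<lambda>_. 0),
      add = (\<lambda>\<alpha> \<beta> u. \<alpha> u + \<beta> u)\<rparr>"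

definition gr_norm :: "('t \<Rightarrow> int) \<Rightarrow> nat" where
  "gr_norm \<alpha> = (\<Sum>u\<in>supp \<alpha>. nat \<bar>\<alpha> u\<bar>)"

text \<open>The pair \<open>(x, s)\<close> stands for the product \<open>s x\<close>, so that conjugation gives
  \<open>t\<inverse> x t = t \<cdot> x\<close> for \<open>t\<close> in \<open>T\<close> and \<open>x\<close> in \<open>A\<close>. This matches the words
  \<open>u\<inverse> a u\<close> in \<open>elem_word\<close> below.\<close>

definition semidirect ::
  "('t, 'b) monoid_scheme \<Rightarrow> ('t \<Rightarrow> int, 'a, 'c) module_scheme \<Rightarrow> ('a \<times> 't) monoid" where
  "semidirect T A =
     \<lparr>carrier = carrier A \<times> carrier T,
      monoid.mult = (\<lambda>(x, s) (y, t). ((of_elem t \<odot>\<^bsub>A\<^esub> x) \<oplus>\<^bsub>A\<^esub> y, s \<otimes>\<^bsub>T\<^esub> t)),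
      one = (\<zero>\<^bsub>A\<^esub>, \<one>\<^bsub>T\<^esub>)\<rparr>"

definition lincomb ::
  "('r, 'a, 'c) module_scheme \<Rightarrow> nat \<Rightarrow> (nat \<Rightarrow> 'r) \<Rightarrow> (nat \<Rightarrow> 'a) \<Rightarrow> 'a" where
  "lincomb V n \<alpha> v = (\<Oplus>\<^bsub>V\<^esub>i\<in>{..<n}. \<alpha> i \<odot>\<^bsub>V\<^esub> v i)"

definition generates ::
  "('r, 'b) ring_scheme \<Rightarrow> ('r, 'a, 'c) module_scheme \<Rightarrow> 'a set \<Rightarrow> nat \<Rightarrow> (nat \<Rightarrow> 'a) \<Rightarrow> bool"
  where
  "generates R V U n v \<longleftrightarrow>
     v \<in> {..<n} \<rightarrow> carrier V \<and> U = {lincomb V n \<alpha> v | \<alpha>. \<alpha> \<in> {..<n} \<rightarrow> carrier R}"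

text \<open>The free module with basis indexed by \<open>0, \<dots>, m - 1\<close>; the ring-multiplication fields of the
  record play no role for a module.\<close>

definition free_module :: "('r, 'b) ring_scheme \<Rightarrow> nat \<Rightarrow> ('r, nat \<Rightarrow> 'r) module" where
  "free_module R m =
     \<lparr>carrier = {..<m} \<rightarrow>\<^sub>E carrier R,
      monoid.mult = undefined,
      one = undefined,
      zero = (\<lambda>i\<in>{..<m}. \<zero>\<^bsub>R\<^esub>),
      add = (\<lambda>f g. \<lambda>i\<in>{..<m}. f i \<oplus>\<^bsub>R\<^esub> g i),
      smult = (\<lambda>\<alpha> f. \<lambda>i\<in>{..<m}. \<alpha> \<otimes>\<^bsub>R\<^esub> f i)\<rparr>"

definition rel_module ::
  "('r, 'b) ring_scheme \<Rightarrow> ('r, 'a, 'c) module_scheme \<Rightarrow> nat \<Rightarrow> (nat \<Rightarrow> 'a) \<Rightarrow> (nat \<Rightarrow> 'r) set"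
  where
  "rel_module R A m a = {f \<in> carrier (free_module R m). lincomb A m f a = \<zero>\<^bsub>A\<^esub>}"


section \<open>Ordered words and the Dehn function of a module\<close>

definition cyclic_basis :: "('t, 'b) monoid_scheme \<Rightarrow> nat \<Rightarrow> (nat \<Rightarrow> 't) \<Rightarrow> bool" where
  "cyclic_basis T s t \<longleftrightarrow>
     t \<in> {..<s} \<rightarrow> carrier T \<and>
     (\<lambda>x. \<Otimes>\<^bsub>T\<^esub>i\<in>{..<s}. x i) \<in>
       iso (product_group {..<s} (\<lambda>i. subgroup_generated T {t i})) T"

text \<open>Note that \<^const>\<open>group.ord\<close> is \<open>0\<close> on elements of infinite order.\<close>

definition exps :: "('t, 'b) monoid_scheme \<Rightarrow> nat \<Rightarrow> (nat \<Rightarrow> 't) \<Rightarrow> 't \<Rightarrow> nat \<Rightarrow> int" where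
  "exps T s t u =
     (THE e. e \<in> {..<s} \<rightarrow>\<^sub>E UNIV \<and>
        (\<forall>i<s. group.ord T (t i) \<noteq> 0 \<longrightarrow> 0 \<le> e i \<and> e i < int (group.ord T (t i))) \<and>
        u = (\<Otimes>\<^bsub>T\<^esub>i\<in>{..<s}. t i [^]\<^bsub>T\<^esub> e i))"

text \<open>Exponents with respect to the \<open>2 s\<close> variables \<open>t\<^sub>1, t\<^sub>1\<inverse>, \<dots>, t\<^sub>s, t\<^sub>s\<inverse>\<close> (the
  code numbers the \<open>t\<^sub>i\<close> from \<open>0\<close>). Since \<^term>\<open>lex less_than\<close> decides at the first differing
  exponent, earlier variables are larger.\<close>

definition var_exps :: "('t, 'b) monoid_scheme \<Rightarrow> nat \<Rightarrow> (nat \<Rightarrow> 't) \<Rightarrow> 't \<Rightarrow> nat list" where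
  "var_exps T s t u = concat (map (\<lambda>i. [nat (exps T s t u i), nat (- exps T s t u i)]) [0..<s])"

definition elem_less :: "('t, 'b) monoid_scheme \<Rightarrow> nat \<Rightarrow> (nat \<Rightarrow> 't) \<Rightarrow> 't \<Rightarrow> 't \<Rightarrow> bool" where
  "elem_less T s t u v \<longleftrightarrow>
     (let x = var_exps T s t u; y = var_exps T s t v in
      sum_list x < sum_list y \<or> sum_list x = sum_list y \<and> (x, y) \<in> lex less_than)"

definition decreasing_list ::
  "('t, 'b) monoid_scheme \<Rightarrow> nat \<Rightarrow> (nat \<Rightarrow> 't) \<Rightarrow> 't set \<Rightarrow> 't list" where
  "decreasing_list T s t U =
     (THE us. set us = U \<and> sorted_wrt (\<lambda>u v. elem_less T s t v u) us)"

text \<open>Words over the generators \<open>Inl i\<close> (for \<open>a\<^sub>i\<close>) and \<open>Inr j\<close> (for \<open>t\<^sub>j\<close>).\<close>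

definition ordered_word ::
  "('t, 'b) monoid_scheme \<Rightarrow> nat \<Rightarrow> (nat \<Rightarrow> 't) \<Rightarrow> 't \<Rightarrow> (nat + nat) letter list" where
  "ordered_word T s t u = concat (map (\<lambda>j. pow_word (Inr j) (exps T s t u j)) [0..<s])"

definition elem_word ::
  "('t, 'b) monoid_scheme \<Rightarrow> nat \<Rightarrow> (nat \<Rightarrow> 't) \<Rightarrow> nat \<Rightarrow> ('t \<Rightarrow> int) \<Rightarrow> (nat + nat) letter list"
  where
  "elem_word T s t i \<mu> =
     concat (map (\<lambda>u. inv_word (ordered_word T s t u) @ pow_word (Inl i) (\<mu> u)
                        @ ordered_word T s t u)
                 (decreasing_list T s t (supp \<mu>)))"

definition module_norm ::
  "('t, 'b) monoid_scheme \<Rightarrow> nat \<Rightarrow> (nat \<Rightarrow> 't) \<Rightarrow> nat \<Rightarrow> (nat \<Rightarrow> 't \<Rightarrow> int) \<Rightarrow> nat" where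
  "module_norm T s t m f =
     length (reduce (concat (map (\<lambda>i. elem_word T s t i (f i)) [0..<m])))"

definition module_area ::
  "('t, 'b) monoid_scheme \<Rightarrow> nat \<Rightarrow> nat \<Rightarrow> (nat \<Rightarrow> nat \<Rightarrow> 't \<Rightarrow> int) \<Rightarrow> (nat \<Rightarrow> 't \<Rightarrow> int) \<Rightarrow> enat"
  where
  "module_area T m l fs f =
     (INF \<alpha> \<in> {\<alpha> \<in> {..<l} \<rightarrow> carrier (group_ring T).
                f = lincomb (free_module (group_ring T) m) l \<alpha> fs}.
        enat (\<Sum>j<l. gr_norm (\<alpha> j)))"

definition module_dehn ::
  "('t, 'b) monoid_scheme \<Rightarrow> ('t \<Rightarrow> int, 'a, 'c) module_scheme \<Rightarrow> nat \<Rightarrow> (nat \<Rightarrow> 't) \<Rightarrow>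
   nat \<Rightarrow> (nat \<Rightarrow> 'a) \<Rightarrow> nat \<Rightarrow> (nat \<Rightarrow> nat \<Rightarrow> 't \<Rightarrow> int) \<Rightarrow> nat \<Rightarrow> enat" where
  "module_dehn T A s t m a l fs n =
     (SUP f \<in> {f \<in> rel_module (group_ring T) A m a. module_norm T s t m f \<le> n}.
        module_area T m l fs f)"

end

theory Submission
  imports Defs
begin

text \<open>Work directly in \<open>M = F/F''\<close> and call two elements near if they differ by a product of few
  conjugates of relators. Lift the generators \<open>a\<^sub>i\<close>, \<open>t\<^sub>j\<close> of \<open>A \<rtimes> T\<close> to \<open>M\<close>. A word of length \<open>n\<close>
  representing \<open>1\<close> is, at cost \<open>O(n\<^sup>3)\<close>, near a product of at most \<open>O(n)\<close> conjugates
  \<open>u\<inverse> a\<^sub>i\<^sup>\<plusminus> u\<close>, with \<open>u\<close> an ordered word of length \<open>O(n)\<close>. Since \<open>M'\<close> is abelian, two such conjugates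
  commute at a cost that is only linear in the lengths of their exponents \<open>u\<close>, so the product may be
  replaced by any other one with the same image \<open>f\<close> in the free module. Now \<open>f\<close> is a relation of norm
  \<open>O(n\<^sup>2)\<close>, hence a sum of \<open>D \<le> \<delta>\<^sub>A(O(n\<^sup>2))\<close> translates of the relations \<open>f\<^sub>j\<close>, and these may be chosen
  with translations of length \<open>O(n + D)\<close>. Rearranging \<open>O(n + D)\<close> terms of height \<open>O(n + D)\<close>, and killing
  \<open>D\<close> translated relations of that height at quadratic cost each, costs \<open>O(max(n, D)\<^sup>3)\<close>.\<close>

section \<open>Free metabelian groups\<close>

text \<open>No presentation of the semidirect product G is ever written down. The relators
  \<open>R\<close> enter through the fact that their normal closure is the kernel of the map from M
  to G: an equality that holds in G holds in M at some finite cost, and the constants come from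
  maximising such costs over finite sets of equalities. This is why an arbitrary pair
  \<open>X\<close>, \<open>R\<close> can be treated directly. The obstacle is that the Dehn function
  of the module limits only the number of translated relations, while the translating elements may
  be arbitrarily long, and length makes both rearranging and killing expensive. What helps is
  cancellation: translates that lie far beyond the support of the target sum have to cancel among
  themselves. The preliminary cost is cubic because each of about n conjugators is brought to normal
  form at the quadratic cost typical of abelian groups.\<close>

lemma (in group) inv_mult_cancel [simp]:
  "x \<in> carrier G \<Longrightarrow> y \<in> carrier G \<Longrightarrow> inv x \<otimes> (x \<otimes> y) = y"
  "x \<in> carrier G \<Longrightarrow> y \<in> carrier G \<Longrightarrow> x \<otimes> (inv x \<otimes> y) = y"
  by (simp_all flip: m_assoc)

section \<open>Reduction of words and the free group\<close>

lemma inv_letter_inv_letter [simp]: "inv_letter (inv_letter p) = p"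
  by (simp add: inv_letter_def)

lemma fst_inv_letter [simp]: "fst (inv_letter p) = fst p"
  by (simp add: inv_letter_def)

lemma reduced_Nil [simp]: "reduced []"
  by (simp add: reduced_def)

lemma reduced_Cons: "reduced (p # w) \<longleftrightarrow> reduced w \<and> (w = [] \<or> hd w \<noteq> inv_letter p)"
  by (auto simp: reduced_def successively_Cons)

lemma reduced_reduce_Cons: "reduced w \<Longrightarrow> reduced (reduce_Cons p w)"
  by (auto simp: reduce_Cons_def reduced_Cons split: list.split)

lemma reduce_Nil [simp]: "reduce [] = []"
  by (simp add: reduce_def)

lemma reduce_Cons_eq: "reduce (p # w) = reduce_Cons p (reduce w)"
  by (simp add: reduce_def)

lemma reduced_reduce [simp]: "reduced (reduce w)"
  by (induction w) (auto simp: reduce_Cons_eq reduced_reduce_Cons)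

lemma reduced_foldr_reduce_Cons: "reduced w \<Longrightarrow> reduced (foldr reduce_Cons u w)"
  by (induction u) (auto simp: reduced_reduce_Cons)

lemma reduce_reduced: "reduced w \<Longrightarrow> reduce w = w"
  by (induction w) (auto simp: reduce_Cons_eq reduced_Cons reduce_Cons_def split: list.split)

text \<open>Van der Waerden's trick: a letter acts on reduced words as a permutation, with the
  inverse letter acting as its inverse. Products become compositions of actions, so associativity
  needs no confluence argument.\<close>

lemma reduce_Cons_inv: "reduced w \<Longrightarrow> reduce_Cons p (reduce_Cons (inv_letter p) w) = w"
  by (cases w) (auto simp: reduce_Cons_def reduced_Cons split: list.split)

lemma reduce_append: "reduce (u @ v) = foldr reduce_Cons u (reduce v)"
  by (simp add: reduce_def)

text \<open>If the new letter cancels, the right-hand side applies a letter and then its inverse to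
  a reduced word, which changes nothing.\<close>

lemma foldr_reduce_Cons_reduce_Cons:
  assumes "reduced w"
  shows "foldr reduce_Cons (reduce_Cons p v) w = reduce_Cons p (foldr reduce_Cons v w)"
proof (cases v)
  case (Cons q v')
  then show ?thesis
    using reduce_Cons_inv[OF reduced_foldr_reduce_Cons[OF assms, of v'], of p]
    by (auto simp: reduce_Cons_def[of p "q # v'"])
qed (simp add: reduce_Cons_def)

lemma foldr_reduce_Cons_reduce:
  "reduced w \<Longrightarrow> foldr reduce_Cons (reduce u) w = foldr reduce_Cons u w"
  by (induction u) (auto simp: reduce_Cons_eq foldr_reduce_Cons_reduce_Cons)

lemma reduce_append_left: "reduce (reduce u @ v) = reduce (u @ v)"
  by (simp add: reduce_append foldr_reduce_Cons_reduce)

lemma reduce_append_right: "reduce (u @ reduce v) = reduce (u @ v)"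
  by (simp add: reduce_append reduce_reduced)

lemma length_reduce_le: "length (reduce w) \<le> length w"
proof (induction w)
  case (Cons p w)
  have "length (reduce_Cons p v) \<le> Suc (length v)" for v
    by (auto simp: reduce_Cons_def split: list.split)
  from this[of "reduce w"] Cons show ?case
    by (simp add: reduce_Cons_eq)
qed simp

lemma set_reduce_subset: "set (reduce w) \<subseteq> set w"
proof (induction w)
  case (Cons p w)
  have "set (reduce_Cons p v) \<subseteq> insert p (set v)" for v
    by (auto simp: reduce_Cons_def split: list.split if_splits)
  from this[of "reduce w"] Cons show ?case
    by (auto simp: reduce_Cons_eq)
qed simp

lemma inv_word_Cons: "inv_word (p # w) = inv_word w @ [inv_letter p]"
  by (simp add: inv_word_def)

lemma fst_set_inv_word [simp]: "fst ` set (inv_word w) = fst ` set w"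
  by (force simp: inv_word_def)

lemma length_inv_word [simp]: "length (inv_word w) = length w"
  by (simp add: inv_word_def)

lemma reduce_inv_word_append: "reduce (inv_word w @ w) = []"
proof (induction w)
  case (Cons p w)
  have "reduce (inv_word (p # w) @ p # w) =
      foldr reduce_Cons (inv_word w) (reduce_Cons (inv_letter p) (reduce_Cons p (reduce w)))"
    by (simp add: inv_word_Cons reduce_append reduce_Cons_eq)
  also have "\<dots> = reduce (inv_word w @ w)"
    using reduce_Cons_inv[of "reduce w" "inv_letter p"] by (simp add: reduce_append)
  finally show ?case
    using Cons by simp
qed (simp add: inv_word_def)

lemma group_free_group: "group (free_group X)"
proof (rule groupI)
  fix u v assume uv: "u \<in> carrier (free_group X)" "v \<in> carrier (free_group X)"
  then have "fst ` set (reduce (u @ v)) \<subseteq> X"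
    by (intro order_trans[OF image_mono[OF set_reduce_subset]])
      (simp add: free_group_def image_Un)
  with uv show "u \<otimes>\<^bsub>free_group X\<^esub> v \<in> carrier (free_group X)"
    by (auto simp: free_group_def)
next
  fix u v w
  show "u \<otimes>\<^bsub>free_group X\<^esub> v \<otimes>\<^bsub>free_group X\<^esub> w = u \<otimes>\<^bsub>free_group X\<^esub> (v \<otimes>\<^bsub>free_group X\<^esub> w)"
    by (simp add: free_group_def reduce_append_left reduce_append_right)
next
  fix w assume w: "w \<in> carrier (free_group X)"
  have "fst ` set (reduce (inv_word w)) \<subseteq> fst ` set w"
    using image_mono[OF set_reduce_subset[of "inv_word w"], of fst] by simp
  with w have "reduce (inv_word w) \<in> carrier (free_group X)"
    by (auto simp: free_group_def)
  then show "\<exists>v\<in>carrier (free_group X). v \<otimes>\<^bsub>free_group X\<^esub> w = \<one>\<^bsub>free_group X\<^esub>"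
    by (intro bexI[of _ "reduce (inv_word w)"])
      (auto simp: free_group_def reduce_append_left reduce_inv_word_append)
qed (auto simp: free_group_def reduce_reduced)

lemma second_derived_normal_free_group:
  "derived (free_group X) (derived (free_group X) (carrier (free_group X))) \<lhd> free_group X"
proof -
  interpret group "free_group X"
    by (rule group_free_group)
  show ?thesis
    by (intro derived_is_normal derived_self_is_normal)
qed

lemma group_free_metabelian: "group (free_metabelian X)"
  unfolding free_metabelian_def Let_def
  by (rule normal.factorgroup_is_group[OF second_derived_normal_free_group])

definition metabelian :: "('g, 'b) monoid_scheme \<Rightarrow> bool" where
  "metabelian G \<longleftrightarrow> (\<forall>x\<in>derived G (carrier G). \<forall>y\<in>derived G (carrier G). x \<otimes>\<^bsub>G\<^esub> y = y \<otimes>\<^bsub>G\<^esub> x)"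

section \<open>Balls of words\<close>

text \<open>The index is an upper bound for the length, hence the case \<open>one\<close> for every
  \<open>n\<close>. The predicate serves twice: over generators it bounds word length, over
  conjugates of relators it bounds area.\<close>

inductive word_ball :: "('g, 'b) monoid_scheme \<Rightarrow> 'g set \<Rightarrow> nat \<Rightarrow> 'g \<Rightarrow> bool"
  for G (structure) and S where
  one: "word_ball G S n \<one>"
| mult: "word_ball G S n x \<Longrightarrow> g \<in> S \<Longrightarrow> word_ball G S (Suc n) (g \<otimes> x)"
| mult_inv: "word_ball G S n x \<Longrightarrow> g \<in> S \<Longrightarrow> word_ball G S (Suc n) (inv g \<otimes> x)"

lemma word_ball_mono: "word_ball G S m x \<Longrightarrow> m \<le> n \<Longrightarrow> word_ball G S n x"
proof (induction arbitrary: n rule: word_ball.induct)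
  case (mult k x g)
  then show ?case by (cases n) (auto intro: word_ball.mult)
next
  case (mult_inv k x g)
  then show ?case by (cases n) (auto intro: word_ball.mult_inv)
qed (rule word_ball.one)

lemma word_ball_subset: "word_ball G S n x \<Longrightarrow> S \<subseteq> S' \<Longrightarrow> word_ball G S' n x"
  by (induction rule: word_ball.induct) (auto intro: word_ball.intros)

context group
begin

lemma word_ball_closed:
  "word_ball G S n x \<Longrightarrow> S \<subseteq> carrier G \<Longrightarrow> x \<in> carrier G"
  by (induction rule: word_ball.induct) auto

lemma word_ball_gen: "g \<in> S \<Longrightarrow> S \<subseteq> carrier G \<Longrightarrow> word_ball G S 1 g"
  using word_ball.mult[OF word_ball.one[of G S 0], of g] by auto

lemma word_ball_gen_inv: "g \<in> S \<Longrightarrow> S \<subseteq> carrier G \<Longrightarrow> word_ball G S 1 (inv g)"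
  using word_ball.mult_inv[OF word_ball.one[of G S 0], of g] by auto

lemma word_ball_mult:
  assumes "word_ball G S m x" "word_ball G S n y" "S \<subseteq> carrier G"
  shows "word_ball G S (m + n) (x \<otimes> y)"
  using assms(1)
proof (induction rule: word_ball.induct)
  case (one k)
  then show ?case
    using word_ball_mono[OF assms(2), of "k + n"] word_ball_closed[OF assms(2,3)] by simp
next
  case (mult k x g)
  then have "x \<in> carrier G" "g \<in> carrier G" using assms(3) word_ball_closed by auto
  with mult word_ball.mult[OF mult.IH mult.hyps(2)] show ?case
    using word_ball_closed[OF assms(2,3)] by (simp add: m_assoc)
next
  case (mult_inv k x g)
  then have "x \<in> carrier G" "g \<in> carrier G" using assms(3) word_ball_closed by auto
  with mult_inv word_ball.mult_inv[OF mult_inv.IH mult_inv.hyps(2)] show ?case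
    using word_ball_closed[OF assms(2,3)] by (simp add: m_assoc)
qed

lemma word_ball_inv:
  assumes "word_ball G S n x" "S \<subseteq> carrier G"
  shows "word_ball G S n (inv x)"
  using assms(1)
proof (induction rule: word_ball.induct)
  case (one k)
  then show ?case by (simp add: word_ball.one)
next
  case (mult k x g)
  then have "x \<in> carrier G" "g \<in> carrier G" using assms(2) word_ball_closed by auto
  then show ?case
    using word_ball_mult[OF mult.IH word_ball_gen_inv[OF mult.hyps(2) assms(2)] assms(2)]
    by (simp add: inv_mult_group)
next
  case (mult_inv k x g)
  then have "x \<in> carrier G" "g \<in> carrier G" using assms(2) word_ball_closed by auto
  then show ?case
    using word_ball_mult[OF mult_inv.IH word_ball_gen[OF mult_inv.hyps(2) assms(2)] assms(2)]
    by (simp add: inv_mult_group)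
qed

lemma word_ball_generate:
  assumes "x \<in> generate G S" "S \<subseteq> carrier G"
  shows "\<exists>n. word_ball G S n x"
  using assms(1)
proof (induction rule: generate.induct)
  case one
  then show ?case by (blast intro: word_ball.one)
next
  case (incl h)
  then show ?case using word_ball_gen assms(2) by blast
next
  case (inv h)
  then show ?case using word_ball_gen_inv assms(2) by blast
next
  case (eng h1 h2)
  then show ?case using word_ball_mult assms(2) by blast
qed

lemma generate_word_ball:
  assumes "word_ball G S n x"
  shows "x \<in> generate G S"
  using assms
  by (induction rule: word_ball.induct) (auto intro: generate.intros)

end

section \<open>Derived subgroup and generators of F/F''\<close>

lemma carrier_free_metabelian:
  "carrier (free_metabelian X) =
    (\<lambda>w. derived (free_group X) (derived (free_group X) (carrier (free_group X))) #>\<^bsub>free_group X\<^esub> w)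
      ` carrier (free_group X)"
  by (auto simp: free_metabelian_def Let_def FactGroup_def RCOSETS_def)

text \<open>The derived subgroup of F/F'' is the image of F', and commutators of elements of F'
  become trivial modulo F''.\<close>

lemma metabelian_free_metabelian: "metabelian (free_metabelian X)"
proof -
  define F where "F = free_group X"
  define D where "D = derived F (carrier F)"
  define E where "E = derived F D"
  define M where "M = free_metabelian X"
  interpret F: group F unfolding F_def by (rule group_free_group)
  have nD: "D \<lhd> F" unfolding D_def by (rule F.derived_self_is_normal)
  have nE: "E \<lhd> F" unfolding E_def by (rule F.derived_is_normal[OF nD])
  interpret E: normal E F by (rule nE)
  have M: "M = F Mod E"
    by (simp add: M_def free_metabelian_def Let_def F_def D_def E_def)
  have h: "group_hom F M (\<lambda>x. E #>\<^bsub>F\<^esub> x)"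
    unfolding M by (intro group_hom.intro group_hom_axioms.intro F.is_group E.factorgroup_is_group
        E.r_coset_hom_Mod)
  interpret h: group_hom F M "\<lambda>x. E #>\<^bsub>F\<^esub> x" by (rule h)
  have img: "(\<lambda>x. E #>\<^bsub>F\<^esub> x) ` carrier F = carrier M"
    by (auto simp: M FactGroup_def RCOSETS_def)
  have der: "derived M (carrier M) = (\<lambda>x. E #>\<^bsub>F\<^esub> x) ` D"
    unfolding D_def using h.derived_img[of "carrier F"] img by simp
  have DF: "D \<subseteq> carrier F" using nD normal_imp_subgroup subgroup.subset by blast
  have ker: "E #>\<^bsub>F\<^esub> x = \<one>\<^bsub>M\<^esub>" if "x \<in> E" for x
    using F.coset_join2[OF _ E.is_subgroup that] E.subset that by (auto simp: M FactGroup_def)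
  show ?thesis
    unfolding metabelian_def M_def[symmetric] der
  proof (intro ballI, elim imageE, hypsubst)
    fix x y assume "x \<in> D" "y \<in> D"
    then have xy: "x \<in> carrier F" "y \<in> carrier F" using DF by auto
    have "x \<otimes>\<^bsub>F\<^esub> y \<otimes>\<^bsub>F\<^esub> inv\<^bsub>F\<^esub> x \<otimes>\<^bsub>F\<^esub> inv\<^bsub>F\<^esub> y \<in> E"
      unfolding E_def derived_def using \<open>x \<in> D\<close> \<open>y \<in> D\<close> by (intro generate.incl) blast
    moreover have "x \<otimes>\<^bsub>F\<^esub> y = x \<otimes>\<^bsub>F\<^esub> y \<otimes>\<^bsub>F\<^esub> inv\<^bsub>F\<^esub> x \<otimes>\<^bsub>F\<^esub> inv\<^bsub>F\<^esub> y \<otimes>\<^bsub>F\<^esub> (y \<otimes>\<^bsub>F\<^esub> x)"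
      using xy by (simp add: F.m_assoc)
    ultimately have "E #>\<^bsub>F\<^esub> (x \<otimes>\<^bsub>F\<^esub> y) = \<one>\<^bsub>M\<^esub> \<otimes>\<^bsub>M\<^esub> (E #>\<^bsub>F\<^esub> (y \<otimes>\<^bsub>F\<^esub> x))"
      using xy ker h.hom_mult by (metis F.inv_closed F.m_closed)
    then show "(E #>\<^bsub>F\<^esub> x) \<otimes>\<^bsub>M\<^esub> (E #>\<^bsub>F\<^esub> y) = (E #>\<^bsub>F\<^esub> y) \<otimes>\<^bsub>M\<^esub> (E #>\<^bsub>F\<^esub> x)"
      using xy h.hom_mult[of x y] h.hom_mult[of y x] h.H.l_one by (metis h.hom_closed h.H.m_closed)
  qed
qed

text \<open>A shortest reduced word in the coset, read letter by letter, is the required expression.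
  The set \<open>S\<close> contains the images of letters of both signs, so no inverse has to be
  formed.\<close>

lemma free_metabelian_word_ball:
  fixes X :: "'x set"
  assumes "finite X"
  obtains S where "finite S" "S \<subseteq> carrier (free_metabelian X)"
    "\<And>w. w \<in> carrier (free_metabelian X) \<Longrightarrow> word_ball (free_metabelian X) S (word_length w) w"
proof -
  define F where "F = free_group X"
  define E where "E = derived F (derived F (carrier F))"
  define M where "M = free_metabelian X"
  interpret F: group F unfolding F_def by (rule group_free_group)
  interpret E: normal E F
    unfolding E_def F_def by (rule second_derived_normal_free_group)
  have M: "M = F Mod E"
    by (simp add: M_def free_metabelian_def Let_def F_def E_def)
  have h: "group_hom F M (\<lambda>x. E #>\<^bsub>F\<^esub> x)"
    unfolding M by (intro group_hom.intro group_hom_axioms.intro F.is_group E.factorgroup_is_group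
        E.r_coset_hom_Mod)
  interpret h: group_hom F M "\<lambda>x. E #>\<^bsub>F\<^esub> x" by (rule h)
  define S where "S = (\<lambda>p. E #>\<^bsub>F\<^esub> [p]) ` (X \<times> UNIV)"
  have ball: "word_ball M S (length v) (E #>\<^bsub>F\<^esub> v)" if "v \<in> carrier F" for v
    using that
  proof (induction v)
    case Nil
    have "E #>\<^bsub>F\<^esub> [] = \<one>\<^bsub>M\<^esub>"
      using h.hom_one by (simp add: F_def free_group_def)
    then show ?case by (simp add: word_ball.one)
  next
    case (Cons p v)
    then have v: "v \<in> carrier F" "[p] \<in> carrier F" "reduced (p # v)"
      by (auto simp: F_def free_group_def reduced_Cons)
    have "[p] \<otimes>\<^bsub>F\<^esub> v = p # v"
      using v(3) by (simp add: F_def free_group_def reduce_reduced)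
    then have "E #>\<^bsub>F\<^esub> (p # v) = (E #>\<^bsub>F\<^esub> [p]) \<otimes>\<^bsub>M\<^esub> (E #>\<^bsub>F\<^esub> v)"
      using v h.hom_mult by metis
    moreover have "E #>\<^bsub>F\<^esub> [p] \<in> S"
      using v(2) unfolding S_def by (intro imageI) (cases p, auto simp: F_def free_group_def)
    ultimately show ?case
      using word_ball.mult[OF Cons.IH[OF v(1)]] by simp
  qed
  show ?thesis
  proof (rule that)
    show "finite S" unfolding S_def using assms by simp
    show "S \<subseteq> carrier (free_metabelian X)"
      unfolding S_def M_def[symmetric]
      by (rule image_subsetI, rule h.hom_closed) (auto simp: F_def free_group_def reduced_Cons)
    fix w assume w: "w \<in> carrier (free_metabelian X)"
    then obtain v0 where v0: "v0 \<in> carrier F" "w = E #>\<^bsub>F\<^esub> v0"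
      by (auto simp: carrier_free_metabelian F_def E_def)
    have "v0 \<in> w" using v0 F.rcos_self[OF _ E.is_subgroup] by auto
    then have "\<exists>v\<in>w. length v = word_length w"
      unfolding word_length_def by (intro LeastI) auto
    then obtain v where v: "v \<in> w" "length v = word_length w" by auto
    have "v \<in> carrier F" using v(1) v0 E.subset by (auto simp: r_coset_def)
    moreover have "w = E #>\<^bsub>F\<^esub> v"
      using F.repr_independence[OF _ v0(1) E.is_subgroup, of v] v v0 by auto
    ultimately show "word_ball (free_metabelian X) S (word_length w) w"
      using ball[of v] v M_def by simp
  qed
qed

section \<open>The conjugation-invariant metric of a presentation\<close>

text \<open>Source of the constants: each of finitely many facts holds at some cost, and
  monotonicity in the cost lets the maximum serve for all of them.\<close>

lemma uniform_bound:
  assumes "finite S" "\<And>p. p \<in> S \<Longrightarrow> \<exists>k. Q k p" "\<And>j k p. Q j p \<Longrightarrow> j \<le> k \<Longrightarrow> Q k p"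
  obtains c :: nat where "\<And>p. p \<in> S \<Longrightarrow> Q c p"
proof -
  obtain k where k: "\<And>p. p \<in> S \<Longrightarrow> Q (k p) p"
    using assms(2) by metis
  show ?thesis
  proof (rule that)
    fix p assume "p \<in> S"
    then show "Q (Max (k ` S)) p"
      using assms(1,3) k by (metis Max_ge finite_imageI imageI)
  qed
qed

locale conj_metric = group M for M (structure) +
  fixes R
  assumes R_subset: "R \<subseteq> carrier M"
begin

definition conjs where "conjs = {inv g \<otimes> r \<otimes> g | g r. g \<in> carrier M \<and> r \<in> R}"

abbreviation cball where "cball \<equiv> word_ball M conjs"

definition cj where "cj y x = inv y \<otimes> x \<otimes> y"

text \<open>Distance at most \<open>k\<close> in the word metric of \<open>conjs\<close>. Since
  \<open>conjs\<close> is closed under conjugation, this metric is invariant under both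
  translations, and errors in the factors of a product simply add up.\<close>

definition near where "near k x y \<longleftrightarrow> cball k (inv x \<otimes> y)"

text \<open>Equivalently, a commutator of \<open>x\<close> and \<open>y\<close> is a product of at
  most \<open>k\<close> conjugates of relators and their inverses.\<close>

definition com where "com k x y \<longleftrightarrow> near k (x \<otimes> y) (y \<otimes> x)"

lemma conjs_subset: "conjs \<subseteq> carrier M"
  using R_subset by (auto simp: conjs_def)

lemma normal_closure_eq: "normal_closure M R = generate M conjs"
  by (simp add: normal_closure_def conjs_def)

text \<open>Passes to the products that define \<open>rel_area\<close>: the inverse of a conjugate
  of \<open>r\<close> is a conjugate of \<open>inv r\<close>.\<close>

lemma cball_conj_prod:
  assumes "cball k w"
  shows "\<exists>ps. set ps \<subseteq> carrier M \<times> (R \<union> (\<lambda>r. inv r) ` R) \<and> w = conj_prod M ps \<and> length ps \<le> k"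
  using assms
proof (induction rule: word_ball.induct)
  case (one k)
  then show ?case by (intro exI[of _ "[]"]) (simp add: conj_prod_def)
next
  case (mult k x g)
  then obtain ps f r where ps: "set ps \<subseteq> carrier M \<times> (R \<union> (\<lambda>r. inv r) ` R)" "x = conj_prod M ps"
    "length ps \<le> k" "g = inv f \<otimes> r \<otimes> f" "f \<in> carrier M" "r \<in> R"
    by (auto simp: conjs_def)
  then show ?case
    by (intro exI[of _ "(f, r) # ps"]) (auto simp: conj_prod_def)
next
  case (mult_inv k x g)
  then obtain ps f r where ps: "set ps \<subseteq> carrier M \<times> (R \<union> (\<lambda>r. inv r) ` R)" "x = conj_prod M ps"
    "length ps \<le> k" "g = inv f \<otimes> r \<otimes> f" "f \<in> carrier M" "r \<in> R"
    by (auto simp: conjs_def)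
  then have "inv g = inv f \<otimes> inv r \<otimes> f"
    using subsetD[OF R_subset ps(6)] by (simp add: inv_mult_group m_assoc)
  then show ?case
    using ps by (intro exI[of _ "(f, inv r) # ps"]) (auto simp: conj_prod_def)
qed

lemma cj_closed [simp]: "x \<in> carrier M \<Longrightarrow> y \<in> carrier M \<Longrightarrow> cj y x \<in> carrier M"
  by (simp add: cj_def)

lemma cj_mult:
  "x \<in> carrier M \<Longrightarrow> x' \<in> carrier M \<Longrightarrow> y \<in> carrier M \<Longrightarrow> cj y (x \<otimes> x') = cj y x \<otimes> cj y x'"
  by (simp add: cj_def m_assoc)

lemma cj_inv: "x \<in> carrier M \<Longrightarrow> y \<in> carrier M \<Longrightarrow> cj y (inv x) = inv (cj y x)"
  by (simp add: cj_def m_assoc inv_mult_group)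

lemma cj_cj: "x \<in> carrier M \<Longrightarrow> y \<in> carrier M \<Longrightarrow> z \<in> carrier M \<Longrightarrow> cj z (cj y x) = cj (y \<otimes> z) x"
  by (simp add: cj_def m_assoc inv_mult_group)

lemma cj_one [simp]: "y \<in> carrier M \<Longrightarrow> cj y \<one> = \<one>" "x \<in> carrier M \<Longrightarrow> cj \<one> x = x"
  by (simp_all add: cj_def)

lemma cj_conjs:
  assumes "g \<in> conjs" "y \<in> carrier M"
  shows "cj y g \<in> conjs"
proof -
  obtain f r where f: "g = cj f r" "f \<in> carrier M" "r \<in> R"
    using assms by (auto simp: conjs_def cj_def)
  then have "cj y g = inv (f \<otimes> y) \<otimes> r \<otimes> (f \<otimes> y)"
    using assms R_subset by (metis cj_cj cj_def subsetD)
  then show ?thesis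
    unfolding conjs_def using f assms by blast
qed

lemma cball_cj:
  assumes "cball k x" "y \<in> carrier M"
  shows "cball k (cj y x)"
  using assms(1)
proof (induction rule: word_ball.induct)
  case (one k)
  then show ?case using assms by (simp add: word_ball.one)
next
  case (mult k x g)
  then have x: "x \<in> carrier M" "g \<in> carrier M" using conjs_subset word_ball_closed by auto
  show ?case
    using word_ball.mult[OF mult.IH cj_conjs[OF mult.hyps(2)]] x assms by (simp add: cj_mult)
next
  case (mult_inv k x g)
  then have x: "x \<in> carrier M" "g \<in> carrier M" using conjs_subset word_ball_closed by auto
  show ?case
    using word_ball.mult_inv[OF mult_inv.IH cj_conjs[OF mult_inv.hyps(2)]] x assms by (simp add: cj_mult cj_inv)
qed

section \<open>A bi-invariant metric\<close>

lemma near_refl: "x \<in> carrier M \<Longrightarrow> near k x x"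
  by (simp add: near_def word_ball.one)

lemma near_mono: "near j x y \<Longrightarrow> j \<le> k \<Longrightarrow> near k x y"
  unfolding near_def by (rule word_ball_mono)

lemma near_sym: "near k x y \<Longrightarrow> x \<in> carrier M \<Longrightarrow> y \<in> carrier M \<Longrightarrow> near k y x"
  unfolding near_def using word_ball_inv[OF _ conjs_subset, of k "inv x \<otimes> y"]
  by (simp add: inv_mult_group)

lemma near_trans:
  assumes "near j x y" "near k y z" "x \<in> carrier M" "y \<in> carrier M" "z \<in> carrier M"
  shows "near (j + k) x z"
  using word_ball_mult[OF assms(1,2)[unfolded near_def] conjs_subset] assms(3-5)
  by (simp add: near_def m_assoc)

text \<open>\<open>inv (x \<otimes> x') \<otimes> (y \<otimes> y')\<close> is the conjugate of
  \<open>inv x \<otimes> y\<close> by \<open>x'\<close>, followed by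
  \<open>inv x' \<otimes> y'\<close>.\<close>

lemma near_mult:
  assumes "near j x y" "near k x' y'"
    and "x \<in> carrier M" "y \<in> carrier M" "x' \<in> carrier M" "y' \<in> carrier M"
  shows "near (j + k) (x \<otimes> x') (y \<otimes> y')"
  using word_ball_mult[OF cball_cj[OF assms(1)[unfolded near_def] assms(5)]
      assms(2)[unfolded near_def] conjs_subset] assms(3-6)
  by (simp add: near_def m_assoc cj_def inv_mult_group)

lemma near_mult_left:
  assumes "near k x y" "x \<in> carrier M" "y \<in> carrier M" "z \<in> carrier M"
  shows "near k (z \<otimes> x) (z \<otimes> y)"
  using near_mult[OF near_refl[of z 0] assms(1)] assms by simp

lemma near_mult_right:
  assumes "near k x y" "x \<in> carrier M" "y \<in> carrier M" "z \<in> carrier M"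
  shows "near k (x \<otimes> z) (y \<otimes> z)"
  using near_mult[OF assms(1) near_refl[of z 0]] assms by simp

lemma near_inv:
  assumes "near k x y" "x \<in> carrier M" "y \<in> carrier M"
  shows "near k (inv x) (inv y)"
  using near_mult_left[OF near_mult_right[OF near_sym[OF assms], of "inv x"], of "inv y"] assms
  by simp

lemma near_cj:
  assumes "near k x y" "x \<in> carrier M" "y \<in> carrier M" "z \<in> carrier M"
  shows "near k (cj z x) (cj z y)"
  unfolding cj_def using assms by (intro near_mult_right near_mult_left) auto

text \<open>The conjugator occurs twice, hence the factor 2.\<close>

lemma near_cj_left:
  assumes "near k y y'" "x \<in> carrier M" "y \<in> carrier M" "y' \<in> carrier M"
  shows "near (2 * k) (cj y x) (cj y' x)"
  using near_mult[OF near_mult_right[OF near_inv[OF assms(1)], of x] assms(1)] assms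
  by (simp add: cj_def mult_2)

lemma near_pow_one:
  assumes "near k x \<one>" "x \<in> carrier M"
  shows "near (n * k) (x [^] (n :: nat)) \<one>"
proof (induction n)
  case (Suc n)
  then show ?case using near_mult[OF Suc assms(1)] assms(2) by (simp add: add.commute)
qed (simp add: near_refl)

lemma near_int_pow_one:
  assumes "near k x \<one>" "x \<in> carrier M"
  shows "near (nat \<bar>z\<bar> * k) (x [^] (z :: int)) \<one>"
proof (cases z rule: int_cases2)
  case (nonneg n)
  then show ?thesis
    using near_pow_one[OF assms, of n] by (simp add: int_pow_int)
next
  case (nonpos n)
  then have "x [^] z = inv (x [^] n)"
    using int_pow_neg_int[OF assms(2)] by simp
  then show ?thesis
    using near_inv[OF near_pow_one[OF assms, of n]] assms(2) nonpos by simp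
qed

section \<open>Commutation up to a bounded error\<close>

lemma com_sym: "com k x y \<Longrightarrow> x \<in> carrier M \<Longrightarrow> y \<in> carrier M \<Longrightarrow> com k y x"
  unfolding com_def by (rule near_sym) auto

lemma com_mono: "com j x y \<Longrightarrow> j \<le> k \<Longrightarrow> com k x y"
  unfolding com_def by (rule near_mono)

lemma com_eq: "x \<otimes> y = y \<otimes> x \<Longrightarrow> x \<in> carrier M \<Longrightarrow> y \<in> carrier M \<Longrightarrow> com k x y"
  unfolding com_def by (simp add: near_refl)

lemma com_one: "x \<in> carrier M \<Longrightarrow> com k x \<one>"
  by (rule com_eq) auto

lemma com_mult:
  assumes "com j x y" "com k x z" "x \<in> carrier M" "y \<in> carrier M" "z \<in> carrier M"
  shows "com (j + k) x (y \<otimes> z)"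
proof -
  have "near j (x \<otimes> (y \<otimes> z)) (y \<otimes> (x \<otimes> z))"
    using near_mult_right[OF assms(1)[unfolded com_def], of z] assms(3-5) by (simp add: m_assoc)
  moreover have "near k (y \<otimes> (x \<otimes> z)) (y \<otimes> z \<otimes> x)"
    using near_mult_left[OF assms(2)[unfolded com_def], of y] assms(3-5) by (simp add: m_assoc)
  ultimately show ?thesis
    unfolding com_def using assms(3-5) by (intro near_trans[where y = "y \<otimes> (x \<otimes> z)"]) auto
qed

lemma com_inv:
  assumes "com k x y" "x \<in> carrier M" "y \<in> carrier M"
  shows "com k x (inv y)"
  using near_sym[OF near_mult_left[OF near_mult_right[OF assms(1)[unfolded com_def], of "inv y"], of "inv y"]] assms
  by (simp add: com_def m_assoc)

lemma com_cj:
  assumes "com k x y" "x \<in> carrier M" "y \<in> carrier M" "z \<in> carrier M"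
  shows "com k (cj z x) (cj z y)"
  using near_cj[OF assms(1)[unfolded com_def], of z] assms by (simp add: com_def cj_mult)

lemma com_word_ball:
  assumes "word_ball M S n y" "S \<subseteq> carrier M" "x \<in> carrier M" "\<And>g. g \<in> S \<Longrightarrow> com c x g"
  shows "com (c * n) x y"
  using assms(1)
proof (induction rule: word_ball.induct)
  case (one n)
  then show ?case using com_one assms by blast
next
  case (mult n y g)
  then have "y \<in> carrier M" "g \<in> carrier M" using assms(2) word_ball_closed by auto
  then show ?case using com_mult[OF assms(4)[OF mult.hyps(2)] mult.IH] assms by simp
next
  case (mult_inv n y g)
  then have "y \<in> carrier M" "g \<in> carrier M" using assms(2) word_ball_closed by auto
  then show ?case
    using com_mult[OF com_inv[OF assms(4)[OF mult_inv.hyps(2)]] mult_inv.IH] assms by simp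
qed

end

section \<open>Normal forms in a finitely generated abelian group\<close>

locale basis_group = T: comm_group T for T :: "('t, 'd) monoid_scheme" +
  fixes s :: nat and t :: "nat \<Rightarrow> 't"
  assumes basis: "cyclic_basis T s t"
begin

definition mod_ord :: "(nat \<Rightarrow> int) \<Rightarrow> nat \<Rightarrow> int" where
  "mod_ord e = (\<lambda>i\<in>{..<s}. if T.ord (t i) = 0 then e i else e i mod int (T.ord (t i)))"

definition exp_norm :: "(nat \<Rightarrow> int) \<Rightarrow> nat" where
  "exp_norm e = (\<Sum>i<s. nat \<bar>e i\<bar>)"

definition height :: "'t \<Rightarrow> nat" where
  "height u = exp_norm (exps T s t u)"

lemma t_closed: "i < s \<Longrightarrow> t i \<in> carrier T"
  using basis by (auto simp: cyclic_basis_def)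

lemma t_pow_mod_ord: "i < s \<Longrightarrow> t i [^]\<^bsub>T\<^esub> mod_ord e i = t i [^]\<^bsub>T\<^esub> e i"
  by (auto simp: mod_ord_def T.int_pow_eq t_closed minus_mod_eq_mult_div)

text \<open>Uniqueness is claimed for the factors \<open>t i [^] e i\<close>, since the exponents
  themselves are determined only modulo the orders.\<close>

lemma basis_unique:
  assumes "(\<Otimes>\<^bsub>T\<^esub>i\<in>{..<s}. t i [^]\<^bsub>T\<^esub> (e i :: int)) = (\<Otimes>\<^bsub>T\<^esub>i\<in>{..<s}. t i [^]\<^bsub>T\<^esub> (e' i :: int))" "i < s"
  shows "t i [^]\<^bsub>T\<^esub> e i = t i [^]\<^bsub>T\<^esub> e' i"
proof -
  have inj: "inj_on (\<lambda>x. \<Otimes>\<^bsub>T\<^esub>i\<in>{..<s}. x i) (\<Pi>\<^sub>E i\<in>{..<s}. carrier (subgroup_generated T {t i}))"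
    using basis by (auto simp: cyclic_basis_def iso_def bij_betw_def)
  \<comment> \<open>The product group consists of extensional families, so the powers are restricted
    to the index set before injectivity is applied.\<close>
  define x where "x f = (\<lambda>i\<in>{..<s}. t i [^]\<^bsub>T\<^esub> (f i :: int))" for f
  have mem: "x f \<in> (\<Pi>\<^sub>E i\<in>{..<s}. carrier (subgroup_generated T {t i}))" for f
    using t_closed T.generate_pow by (auto simp: x_def carrier_subgroup_generated)
  have prod: "(\<Otimes>\<^bsub>T\<^esub>i\<in>{..<s}. x f i) = (\<Otimes>\<^bsub>T\<^esub>i\<in>{..<s}. t i [^]\<^bsub>T\<^esub> (f i :: int))" for f
    using t_closed by (intro T.finprod_cong') (auto simp: x_def)
  have "x e = x e'"
    using inj_onD[OF inj _ mem mem, of e e'] assms(1) by (simp add: prod)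
  then have "x e i = x e' i" by simp
  with assms(2) show ?thesis by (simp add: x_def)
qed

text \<open>Evaluates the definite description in \<open>exps\<close> from any exponent vector,
  normalised or not. This is how the normal form of a collected product is read off.\<close>

lemma exps_finprod: "exps T s t (\<Otimes>\<^bsub>T\<^esub>i\<in>{..<s}. t i [^]\<^bsub>T\<^esub> (e i :: int)) = mod_ord e"
  unfolding exps_def
proof (rule the_equality)
  have "(\<Otimes>\<^bsub>T\<^esub>i\<in>{..<s}. t i [^]\<^bsub>T\<^esub> e i) = (\<Otimes>\<^bsub>T\<^esub>i\<in>{..<s}. t i [^]\<^bsub>T\<^esub> mod_ord e i)"
    using t_closed by (intro T.finprod_cong') (auto simp: t_pow_mod_ord)
  then show "mod_ord e \<in> {..<s} \<rightarrow>\<^sub>E UNIV \<and>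
      (\<forall>i<s. T.ord (t i) \<noteq> 0 \<longrightarrow> 0 \<le> mod_ord e i \<and> mod_ord e i < int (T.ord (t i))) \<and>
      (\<Otimes>\<^bsub>T\<^esub>i\<in>{..<s}. t i [^]\<^bsub>T\<^esub> e i) = (\<Otimes>\<^bsub>T\<^esub>i\<in>{..<s}. t i [^]\<^bsub>T\<^esub> mod_ord e i)"
    by (auto simp: mod_ord_def)
next
  fix e'
  assume e': "e' \<in> {..<s} \<rightarrow>\<^sub>E UNIV \<and>
      (\<forall>i<s. T.ord (t i) \<noteq> 0 \<longrightarrow> 0 \<le> e' i \<and> e' i < int (T.ord (t i))) \<and>
      (\<Otimes>\<^bsub>T\<^esub>i\<in>{..<s}. t i [^]\<^bsub>T\<^esub> e i) = (\<Otimes>\<^bsub>T\<^esub>i\<in>{..<s}. t i [^]\<^bsub>T\<^esub> e' i)"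
  show "e' = mod_ord e"
  proof
    fix i
    show "e' i = mod_ord e i"
    proof (cases "i < s")
      case True
      have "t i [^]\<^bsub>T\<^esub> e i = t i [^]\<^bsub>T\<^esub> e' i"
        using e' True by (intro basis_unique) auto
      then have dvd: "int (T.ord (t i)) dvd e' i - e i"
        using T.int_pow_eq t_closed True by blast
      show ?thesis
      proof (cases "T.ord (t i) = 0")
        case False
        then have "e' i = e' i mod int (T.ord (t i))"
          using e' True by auto
        also have "\<dots> = e i mod int (T.ord (t i))"
          using dvd by (simp add: mod_eq_dvd_iff)
        finally show ?thesis using False True by (simp add: mod_ord_def)
      qed (use dvd True in \<open>simp add: mod_ord_def\<close>)
    qed (use e' in \<open>auto simp: mod_ord_def\<close>)
  qed
qed

lemma basis_generates:
  assumes "u \<in> carrier T"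
  obtains e :: "nat \<Rightarrow> int" where "u = (\<Otimes>\<^bsub>T\<^esub>i\<in>{..<s}. t i [^]\<^bsub>T\<^esub> e i)"
proof -
  have "u \<in> (\<lambda>x. \<Otimes>\<^bsub>T\<^esub>i\<in>{..<s}. x i) ` (\<Pi>\<^sub>E i\<in>{..<s}. carrier (subgroup_generated T {t i}))"
    using basis assms by (auto simp: cyclic_basis_def iso_def bij_betw_def)
  then obtain x where x: "x \<in> (\<Pi>\<^sub>E i\<in>{..<s}. carrier (subgroup_generated T {t i}))"
    "u = (\<Otimes>\<^bsub>T\<^esub>i\<in>{..<s}. x i)" by auto
  have "\<exists>k. x i = t i [^]\<^bsub>T\<^esub> (k :: int)" if "i < s" for i
    using x(1) that t_closed T.generate_pow[of "t i"]
    by (auto simp: carrier_subgroup_generated PiE_def Pi_def)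
  then obtain e where e: "\<And>i. i < s \<Longrightarrow> x i = t i [^]\<^bsub>T\<^esub> (e i :: int)" by metis
  have "u = (\<Otimes>\<^bsub>T\<^esub>i\<in>{..<s}. t i [^]\<^bsub>T\<^esub> e i)"
    unfolding x(2) using t_closed e by (intro T.finprod_cong') auto
  then show ?thesis using that by blast
qed

lemma finprod_exps:
  assumes "u \<in> carrier T"
  shows "(\<Otimes>\<^bsub>T\<^esub>i\<in>{..<s}. t i [^]\<^bsub>T\<^esub> exps T s t u i) = u"
proof -
  obtain e where e: "u = (\<Otimes>\<^bsub>T\<^esub>i\<in>{..<s}. t i [^]\<^bsub>T\<^esub> (e i :: int))"
    using basis_generates assms .
  show ?thesis
    unfolding e exps_finprod using t_closed
    by (intro T.finprod_cong') (auto simp: t_pow_mod_ord)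
qed

text \<open>A residue is smaller than the order of its generator. Generators of infinite order
  contribute 0 to the additive constant because \<open>ord\<close> is 0 there.\<close>

lemma exp_norm_mod_ord: "exp_norm (mod_ord e) \<le> exp_norm e + (\<Sum>i<s. T.ord (t i))"
proof -
  have "nat \<bar>mod_ord e i\<bar> \<le> nat \<bar>e i\<bar> + T.ord (t i)" if "i < s" for i
  proof (cases "T.ord (t i) = 0")
    case False
    then have "0 \<le> e i mod int (T.ord (t i))" "e i mod int (T.ord (t i)) < int (T.ord (t i))"
      by auto
    then show ?thesis using that by (auto simp: mod_ord_def)
  qed (use that in \<open>simp add: mod_ord_def\<close>)
  then show ?thesis
    unfolding exp_norm_def sum.distrib[symmetric] by (intro sum_mono) auto
qed

lemma length_ordered_word: "length (ordered_word T s t u) = height u"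
proof -
  have "length (concat (map (\<lambda>j. pow_word (Inr j :: nat + nat) (e j)) [0..<k])) = (\<Sum>i<k. nat \<bar>e i\<bar>)"
    for e k by (induction k) (auto simp: pow_word_def)
  then show ?thesis by (simp add: ordered_word_def height_def exp_norm_def)
qed

end

section \<open>Lifting a semidirect product to a metabelian group\<close>

locale group_ring_module = T: comm_group T + A: module "group_ring T" A
  for T :: "('t, 'd) monoid_scheme" and A :: "('t \<Rightarrow> int, 'a, 'e) module_scheme"
begin

abbreviation ZT where "ZT \<equiv> group_ring T"

lemma supp_of_elem: "supp (of_elem u) = {u}"
  by (auto simp: supp_def of_elem_def)

lemma of_elem_closed: "u \<in> carrier T \<Longrightarrow> of_elem u \<in> carrier ZT"
  by (simp add: group_ring_def supp_of_elem)

lemma of_elem_one: "of_elem \<one>\<^bsub>T\<^esub> = \<one>\<^bsub>ZT\<^esub>"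
  by (simp add: group_ring_def)

lemma act_closed: "u \<in> carrier T \<Longrightarrow> x \<in> carrier A \<Longrightarrow> of_elem u \<odot>\<^bsub>A\<^esub> x \<in> carrier A"
  by (simp add: of_elem_closed)

end

text \<open>\<open>\<rho>\<close> and \<open>\<alpha>\<close> are the two coordinates of a
  homomorphism from \<open>M\<close> to the semidirect product. The second is a crossed
  homomorphism, and \<open>kernel\<close> identifies the normal closure of \<open>R\<close> with the
  elements that have both coordinates trivial.\<close>

locale semidirect_map = conj_metric M R + group_ring_module T A
  for M (structure) and R and T :: "('t, 'd) monoid_scheme"
    and A :: "('t \<Rightarrow> int, 'a, 'e) module_scheme" +
  fixes \<rho> \<alpha>
  assumes \<rho>_hom: "\<rho> \<in> hom M T"
    and \<alpha>_closed: "x \<in> carrier M \<Longrightarrow> \<alpha> x \<in> carrier A"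
    and \<alpha>_mult: "x \<in> carrier M \<Longrightarrow> y \<in> carrier M \<Longrightarrow>
      \<alpha> (x \<otimes> y) = (of_elem (\<rho> y) \<odot>\<^bsub>A\<^esub> \<alpha> x) \<oplus>\<^bsub>A\<^esub> \<alpha> y"
    and kernel: "x \<in> carrier M \<Longrightarrow> x \<in> normal_closure M R \<longleftrightarrow> \<rho> x = \<one>\<^bsub>T\<^esub> \<and> \<alpha> x = \<zero>\<^bsub>A\<^esub>"
begin

sublocale \<rho>: group_hom M T \<rho>
  by unfold_locales (rule \<rho>_hom)

lemma \<alpha>_one: "\<alpha> \<one> = \<zero>\<^bsub>A\<^esub>"
  using kernel[of \<one>] by (simp add: normal_closure_def generate.one)

lemma \<alpha>_mult_one:
  "x \<in> carrier M \<Longrightarrow> y \<in> carrier M \<Longrightarrow> \<rho> y = \<one>\<^bsub>T\<^esub> \<Longrightarrow> \<alpha> (x \<otimes> y) = \<alpha> x \<oplus>\<^bsub>A\<^esub> \<alpha> y"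
  by (simp add: \<alpha>_mult of_elem_one \<alpha>_closed)


text \<open>In \<open>y = x \<otimes> (inv x \<otimes> y)\<close> the last factor lies over the unit
  of \<open>T\<close>, so \<open>\<alpha>\<close> is additive on this product.\<close>

lemma \<alpha>_eq_iff:
  assumes "x \<in> carrier M" "y \<in> carrier M" "\<rho> x = \<rho> y"
  shows "\<alpha> (inv x \<otimes> y) = \<zero>\<^bsub>A\<^esub> \<longleftrightarrow> \<alpha> x = \<alpha> y"
proof -
  have "\<alpha> (x \<otimes> (inv x \<otimes> y)) = \<alpha> x \<oplus>\<^bsub>A\<^esub> \<alpha> (inv x \<otimes> y)"
    using assms by (intro \<alpha>_mult_one) auto
  then have "\<alpha> y = \<alpha> x \<oplus>\<^bsub>A\<^esub> \<alpha> (inv x \<otimes> y)"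
    using assms by simp
  moreover have "\<alpha> x \<in> carrier A" "\<alpha> (inv x \<otimes> y) \<in> carrier A"
    using assms by (auto intro: \<alpha>_closed)
  ultimately show ?thesis
    by (metis A.add.l_cancel_one)
qed

text \<open>Every equality in the semidirect product holds in \<open>M\<close> at a finite cost.
  Together with \<open>uniform_bound\<close> this replaces explicit relators.\<close>

lemma near_ex:
  assumes "x \<in> carrier M" "y \<in> carrier M" "\<rho> x = \<rho> y" "\<alpha> x = \<alpha> y"
  shows "\<exists>k. near k x y"
proof -
  have "inv x \<otimes> y \<in> generate M conjs"
    using kernel[of "inv x \<otimes> y"] assms by (simp add: \<alpha>_eq_iff normal_closure_eq)
  then show ?thesis
    unfolding near_def using word_ball_generate conjs_subset by blast
qed

lemma near_imp_eq:
  assumes "near k x y" "x \<in> carrier M" "y \<in> carrier M"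
  shows "\<rho> x = \<rho> y" "\<alpha> x = \<alpha> y"
proof -
  have "inv x \<otimes> y \<in> normal_closure M R"
    using generate_word_ball[OF assms(1)[unfolded near_def]] by (simp add: normal_closure_eq)
  then have *: "\<rho> (inv x \<otimes> y) = \<one>\<^bsub>T\<^esub>" "\<alpha> (inv x \<otimes> y) = \<zero>\<^bsub>A\<^esub>"
    using kernel[of "inv x \<otimes> y"] assms by auto
  have "\<rho> (x \<otimes> (inv x \<otimes> y)) = \<rho> x \<otimes>\<^bsub>T\<^esub> \<rho> (inv x \<otimes> y)"
    using assms by (intro \<rho>.hom_mult) auto
  then show "\<rho> x = \<rho> y"
    using assms * by simp
  then show "\<alpha> x = \<alpha> y"
    using \<alpha>_eq_iff assms * by blast
qed

lemma \<rho>_cj: "x \<in> carrier M \<Longrightarrow> y \<in> carrier M \<Longrightarrow> \<rho> (cj y x) = \<rho> x"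
  using T.m_comm[of "\<rho> x" "\<rho> y"] by (simp add: cj_def T.m_assoc)

text \<open>\<open>\<alpha>\<close> is computed in two ways on
  \<open>y \<otimes> cj y x = x \<otimes> y\<close>, and \<open>\<alpha> y\<close> is
  cancelled.\<close>

lemma \<alpha>_cj:
  assumes "x \<in> carrier M" "y \<in> carrier M" "\<rho> x = \<one>\<^bsub>T\<^esub>"
  shows "\<alpha> (cj y x) = of_elem (\<rho> y) \<odot>\<^bsub>A\<^esub> \<alpha> x"
proof -
  have "\<alpha> (y \<otimes> cj y x) = \<alpha> y \<oplus>\<^bsub>A\<^esub> \<alpha> (cj y x)"
    using assms by (intro \<alpha>_mult_one) (auto simp: \<rho>_cj)
  moreover have "y \<otimes> cj y x = x \<otimes> y"
    using assms by (simp add: cj_def m_assoc)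
  moreover have "\<alpha> (x \<otimes> y) = (of_elem (\<rho> y) \<odot>\<^bsub>A\<^esub> \<alpha> x) \<oplus>\<^bsub>A\<^esub> \<alpha> y"
    using assms by (intro \<alpha>_mult) auto
  ultimately show ?thesis
    using assms \<alpha>_closed act_closed by (metis A.add.m_comm A.add.right_cancel \<rho>.hom_closed cj_closed)
qed

lemma \<alpha>_inv:
  assumes "x \<in> carrier M" "\<rho> x = \<one>\<^bsub>T\<^esub>"
  shows "\<alpha> (inv x) = \<ominus>\<^bsub>A\<^esub> \<alpha> x"
proof -
  have "\<zero>\<^bsub>A\<^esub> = \<alpha> x \<oplus>\<^bsub>A\<^esub> \<alpha> (inv x)"
    using \<alpha>_mult_one[of x "inv x"] assms \<alpha>_one by simp
  then show ?thesis
    using assms \<alpha>_closed by (metis A.add.inv_equality A.add.m_comm inv_closed)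
qed

end

lemma (in group) word_ball_int_pow:
  assumes "g \<in> S" "S \<subseteq> carrier G"
  shows "word_ball G S (nat \<bar>z\<bar>) (g [^] (z :: int))"
proof -
  have g: "g \<in> carrier G" using assms by auto
  have pow: "word_ball G S n (g [^] n)" for n :: nat
  proof (induction n)
    case (Suc n)
    then show ?case using word_ball_mult[OF Suc word_ball_gen[OF assms] assms(2)] by simp
  qed (simp add: word_ball.one)
  show ?thesis
  proof (cases z rule: int_cases2)
    case (nonneg n)
    then show ?thesis using pow by (simp add: int_pow_int)
  next
    case (nonpos n)
    then show ?thesis
      using word_ball_inv[OF pow assms(2)] int_pow_neg_int[OF g] by simp
  qed
qed

section \<open>Lifts of the basis of \<open>T\<close> and of the module generators\<close>

text \<open>\<open>\<tau> j\<close> lifts the basis element \<open>t j\<close> with zero module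
  coordinate, and \<open>\<beta> i\<close> lifts \<open>a i\<close> with trivial
  \<open>T\<close>-coordinate.\<close>

locale metabelian_lift = semidirect_map M R T A \<rho> \<alpha> + basis_group T s t
  for M (structure) and R and T :: "('t, 'd) monoid_scheme"
    and A :: "('t \<Rightarrow> int, 'a, 'e) module_scheme" and \<rho> \<alpha> s t +
  fixes \<tau> and m :: nat and a and \<beta>
  assumes metabelian: "metabelian M"
    and \<tau>: "j < s \<Longrightarrow> \<tau> j \<in> carrier M" "j < s \<Longrightarrow> \<rho> (\<tau> j) = t j" "j < s \<Longrightarrow> \<alpha> (\<tau> j) = \<zero>\<^bsub>A\<^esub>"
    and \<beta>: "i < m \<Longrightarrow> \<beta> i \<in> carrier M" "i < m \<Longrightarrow> \<rho> (\<beta> i) = \<one>\<^bsub>T\<^esub>" "i < m \<Longrightarrow> \<alpha> (\<beta> i) = a i"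
begin

abbreviation tset where "tset \<equiv> \<tau> ` {..<s}"

abbreviation tball where "tball \<equiv> word_ball M tset"

text \<open>The highest index comes first: a letter multiplied on the left travels past the powers
  of higher index until it meets its own.\<close>

primrec tprod :: "nat \<Rightarrow> (nat \<Rightarrow> int) \<Rightarrow> _" where
  "tprod 0 e = \<one>"
| "tprod (Suc k) e = \<tau> k [^] e k \<otimes> tprod k e"

definition lift where "lift u = tprod s (exps T s t u)"

lemma tset_subset: "tset \<subseteq> carrier M"
  using \<tau> by auto

lemma tball_closed: "tball n x \<Longrightarrow> x \<in> carrier M"
  using word_ball_closed tset_subset by blast

text \<open>Words in the \<open>\<tau> j\<close> represent elements of the complement
  \<open>T\<close>, on which the module coordinate vanishes.\<close>

lemma \<alpha>_tball:
  assumes "tball n x"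
  shows "\<alpha> x = \<zero>\<^bsub>A\<^esub>"
  using assms
proof (induction rule: word_ball.induct)
  case (one n)
  then show ?case by (rule \<alpha>_one)
next
  case (mult n x g)
  then obtain j where "g = \<tau> j" "j < s" by auto
  then show ?case
    using mult tball_closed[OF mult(1)] \<tau> by (simp add: \<alpha>_mult of_elem_closed)
next
  case (mult_inv n x g)
  then obtain j where g: "g = \<tau> j" "j < s" by auto
  \<comment> \<open>\<open>\<alpha>\<close> is evaluated on
    \<open>x = g \<otimes> (inv g \<otimes> x)\<close>, where the action on
    \<open>\<alpha> g\<close>, which is zero, contributes nothing.\<close>
  then have "\<alpha> (g \<otimes> (inv g \<otimes> x)) = (of_elem (\<rho> (inv g \<otimes> x)) \<odot>\<^bsub>A\<^esub> \<zero>\<^bsub>A\<^esub>) \<oplus>\<^bsub>A\<^esub> \<alpha> (inv g \<otimes> x)"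
    using mult_inv tball_closed[OF mult_inv(1)] \<tau> by (subst \<alpha>_mult) auto
  moreover have "\<rho> (inv g \<otimes> x) \<in> carrier T" "\<alpha> (inv g \<otimes> x) \<in> carrier A"
    using g \<tau> t_closed tball_closed[OF mult_inv(1)] by (auto intro: \<alpha>_closed)
  ultimately show ?case
    using mult_inv tball_closed[OF mult_inv(1)] \<tau> g by (simp add: of_elem_closed)
qed

lemma tball_tprod: "k \<le> s \<Longrightarrow> tball (\<Sum>i<k. nat \<bar>e i\<bar>) (tprod k e)"
proof (induction k)
  case (Suc k)
  then show ?case
    using word_ball_mult[OF word_ball_int_pow[of "\<tau> k" tset "e k"] Suc.IH tset_subset] tset_subset
    by (simp add: add.commute)
qed (simp add: word_ball.one)

lemma tprod_closed: "k \<le> s \<Longrightarrow> tprod k e \<in> carrier M"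
  using tball_tprod tball_closed by blast

lemma tprod_cong: "(\<And>i. i < k \<Longrightarrow> e i = e' i) \<Longrightarrow> tprod k e = tprod k e'"
  by (induction k) auto

lemma \<rho>_tprod: "k \<le> s \<Longrightarrow> \<rho> (tprod k e) = (\<Otimes>\<^bsub>T\<^esub>i\<in>{..<k}. t i [^]\<^bsub>T\<^esub> e i)"
proof (induction k)
  case (Suc k)
  then have "(\<Otimes>\<^bsub>T\<^esub>i\<in>{..<Suc k}. t i [^]\<^bsub>T\<^esub> e i) = t k [^]\<^bsub>T\<^esub> e k \<otimes>\<^bsub>T\<^esub> (\<Otimes>\<^bsub>T\<^esub>i\<in>{..<k}. t i [^]\<^bsub>T\<^esub> e i)"
    unfolding lessThan_Suc by (subst T.finprod_insert) (auto simp: t_closed)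
  with Suc show ?case
    using \<tau> tprod_closed by (simp add: \<rho>.hom_int_pow)
qed simp

lemma tball_lift: "tball (height u) (lift u)"
  using tball_tprod[of s] by (simp add: lift_def height_def exp_norm_def)

lemma lift_closed [simp]: "lift u \<in> carrier M"
  using tball_lift tball_closed by blast

lemma \<rho>_lift: "u \<in> carrier T \<Longrightarrow> \<rho> (lift u) = u"
  by (simp add: lift_def \<rho>_tprod finprod_exps)

text \<open>Elements over the unit of \<open>T\<close> are mapped into \<open>A\<close>, which is
  abelian.\<close>

lemma com_ex:
  assumes "x \<in> carrier M" "y \<in> carrier M" "\<rho> x = \<one>\<^bsub>T\<^esub>" "\<rho> y = \<one>\<^bsub>T\<^esub>"
  shows "\<exists>k. com k x y"
  unfolding com_def using assms \<alpha>_closed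
  by (intro near_ex) (auto simp: \<alpha>_mult_one A.add.m_comm)

text \<open>The two products agree under \<open>\<rho>\<close> because \<open>T\<close> is abelian,
  and \<open>\<alpha>\<close> vanishes on both.\<close>

lemma com_tball_ex:
  assumes "tball j x" "tball k y"
  shows "\<exists>k. com k x y"
proof -
  have "tball (j + k) (x \<otimes> y)" "tball (k + j) (y \<otimes> x)"
    using assms word_ball_mult tset_subset by blast+
  then have "\<alpha> (x \<otimes> y) = \<alpha> (y \<otimes> x)"
    using \<alpha>_tball by metis
  then show ?thesis
    unfolding com_def using assms tball_closed
    by (intro near_ex) (auto simp: T.m_comm)
qed

section \<open>Collecting words of the abelian part to normal form\<close>

text \<open>The new letter crosses each letter of the product at most once, at a constant
  price.\<close>

lemma tprod_step:
  obtains c where "\<And>j \<epsilon> e. j < s \<Longrightarrow> \<bar>\<epsilon>\<bar> = 1 \<Longrightarrow>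
    near (c * exp_norm e) (\<tau> j [^] (\<epsilon> :: int) \<otimes> tprod s e) (tprod s (e(j := e j + \<epsilon>)))"
proof -
  have "\<exists>k. com k (fst p) (snd p)" if "p \<in> tset \<times> tset" for p
    using that com_tball_ex word_ball_gen[OF _ tset_subset] by (metis mem_Times_iff)
  then obtain c where c: "\<And>p. p \<in> tset \<times> tset \<Longrightarrow> com c (fst p) (snd p)"
    using uniform_bound[of "tset \<times> tset" "\<lambda>k p. com k (fst p) (snd p)"] com_mono by blast
  \<comment> \<open>\<open>c\<close> is the price for two generators. Crossing a power costs
    \<open>c\<close> per letter, and by \<open>com_inv\<close> inverse letters cost the
    same.\<close>
  have com_pow: "com (c * nat \<bar>z\<bar>) (\<tau> j [^] \<epsilon>) (\<tau> i [^] z)" if "i < s" "j < s" "\<bar>\<epsilon>\<bar> = 1" for i j z and \<epsilon> :: int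
  proof (rule com_word_ball[where S = "{\<tau> i}"])
    show "word_ball M {\<tau> i} (nat \<bar>z\<bar>) (\<tau> i [^] z)"
      using that \<tau> by (intro word_ball_int_pow) auto
    fix g assume g: "g \<in> {\<tau> i}"
    have c1: "com c (\<tau> i) (\<tau> j)"
      using c[of "(\<tau> i, \<tau> j)"] that by auto
    have "\<epsilon> = 1 \<or> \<epsilon> = -1" using that by auto
    then have "com c (\<tau> i) (\<tau> j [^] \<epsilon>)"
      using c1 com_inv[OF c1] \<tau> that by (auto simp: int_pow_neg)
    then show "com c (\<tau> j [^] \<epsilon>) g"
      using g com_sym \<tau> that by simp
  qed (use that \<tau> in auto)
  have "near (c * (\<Sum>i<k. nat \<bar>e i\<bar>)) (\<tau> j [^] \<epsilon> \<otimes> tprod k e) (tprod k (e(j := e j + \<epsilon>)))"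
    if "j < k" "k \<le> s" "\<bar>\<epsilon>\<bar> = 1" for j k e and \<epsilon> :: int
    using that
  proof (induction k)
    case (Suc k)
    then have cl: "\<tau> j \<in> carrier M" "\<tau> k \<in> carrier M" "tprod k e \<in> carrier M"
      "tprod k (e(j := e j + \<epsilon>)) \<in> carrier M"
      using \<tau> tprod_closed by auto
    show ?case
    proof (cases "j = k")
      case True
      have "tprod k (e(k := e k + \<epsilon>)) = tprod k e"
        by (rule tprod_cong) auto
      moreover have "\<tau> k [^] (e k + \<epsilon>) = \<tau> k [^] \<epsilon> \<otimes> \<tau> k [^] e k"
        using cl by (simp add: add.commute flip: int_pow_mult)
      ultimately have "tprod (Suc k) (e(k := e k + \<epsilon>)) = \<tau> k [^] \<epsilon> \<otimes> tprod (Suc k) e"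
        using True cl unfolding tprod.simps fun_upd_same by (simp add: m_assoc)
      then show ?thesis
        using True cl by (simp add: near_refl del: fun_upd_apply)
    next
      case False
      have "near (c * nat \<bar>e k\<bar>) (\<tau> j [^] \<epsilon> \<otimes> (\<tau> k [^] e k \<otimes> tprod k e)) (\<tau> k [^] e k \<otimes> (\<tau> j [^] \<epsilon> \<otimes> tprod k e))"
        using near_mult_right[OF com_pow[of k j \<epsilon> "e k", unfolded com_def], of "tprod k e"] cl Suc.prems
        by (simp add: m_assoc)
      moreover have "near (c * (\<Sum>i<k. nat \<bar>e i\<bar>)) (\<tau> k [^] e k \<otimes> (\<tau> j [^] \<epsilon> \<otimes> tprod k e))
          (\<tau> k [^] e k \<otimes> tprod k (e(j := e j + \<epsilon>)))"
        using Suc.prems False cl by (intro near_mult_left[OF Suc.IH] tprod_closed) auto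
      ultimately have "near (c * nat \<bar>e k\<bar> + c * (\<Sum>i<k. nat \<bar>e i\<bar>)) (\<tau> j [^] \<epsilon> \<otimes> tprod (Suc k) e)
          (\<tau> k [^] e k \<otimes> tprod k (e(j := e j + \<epsilon>)))"
        using near_trans cl by simp
      moreover have "tprod (Suc k) (e(j := e j + \<epsilon>)) = \<tau> k [^] e k \<otimes> tprod k (e(j := e j + \<epsilon>))"
        unfolding tprod.simps using False by (metis fun_upd_other)
      moreover have "c * nat \<bar>e k\<bar> + c * (\<Sum>i<k. nat \<bar>e i\<bar>) = c * (\<Sum>i<Suc k. nat \<bar>e i\<bar>)"
        by (simp add: distrib_left)
      ultimately show ?thesis
        by metis
    qed
  qed simp
  from this[of _ s] show ?thesis
    by (intro that[of c]) (auto simp: exp_norm_def)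
qed

lemma exp_norm_upd:
  assumes "j < s"
  shows "exp_norm (e(j := e j + \<epsilon>)) \<le> exp_norm e + nat \<bar>\<epsilon>\<bar>"
proof -
  have eq: "exp_norm f = nat \<bar>f j\<bar> + (\<Sum>i\<in>{..<s} - {j}. nat \<bar>f i\<bar>)" for f
    unfolding exp_norm_def using assms by (intro sum.remove) auto
  have "(\<Sum>i\<in>{..<s} - {j}. nat \<bar>(e(j := e j + \<epsilon>)) i\<bar>) = (\<Sum>i\<in>{..<s} - {j}. nat \<bar>e i\<bar>)"
    by (intro sum.cong) auto
  then show ?thesis
    by (simp add: eq)
qed

text \<open>Each of the \<open>n\<close> letters is absorbed by \<open>tprod_step\<close> at linear
  cost, since the exponents collected so far have norm below \<open>n\<close>.\<close>

lemma tball_near_tprod: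
  obtains c where "\<And>n x. tball n x \<Longrightarrow> \<exists>e. exp_norm e \<le> n \<and> near (c * n * n) x (tprod s e)"
proof -
  obtain c where c: "\<And>j \<epsilon> e. j < s \<Longrightarrow> \<bar>\<epsilon>\<bar> = 1 \<Longrightarrow>
    near (c * exp_norm e) (\<tau> j [^] (\<epsilon> :: int) \<otimes> tprod s e) (tprod s (e(j := e j + \<epsilon>)))"
    using tprod_step by blast
  have step: "\<exists>e. exp_norm e \<le> Suc n \<and> near (c * Suc n * Suc n) (\<tau> j [^] \<epsilon> \<otimes> x) (tprod s e)"
    if "tball n x" "exp_norm e \<le> n" "near (c * n * n) x (tprod s e)" "j < s" "\<bar>\<epsilon>\<bar> = 1"
    for n x e j and \<epsilon> :: int
  proof (intro exI conjI)
    show "exp_norm (e(j := e j + \<epsilon>)) \<le> Suc n"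
      using exp_norm_upd[of j e \<epsilon>] that by simp
    have cl: "x \<in> carrier M" "\<tau> j \<in> carrier M" "tprod s e' \<in> carrier M" for e'
      using that \<tau> tball_closed tprod_closed by auto
    have "near (c * n * n + c * exp_norm e) (\<tau> j [^] \<epsilon> \<otimes> x) (tprod s (e(j := e j + \<epsilon>)))"
      using near_trans[OF near_mult_left[OF that(3), of "\<tau> j [^] \<epsilon>"] c[OF that(4,5)]] cl by simp
    moreover have "c * n * n + c * exp_norm e \<le> c * n * n + c * n"
      using that by simp
    then have "c * n * n + c * exp_norm e \<le> c * Suc n * Suc n"
      by (rule order_trans) (simp add: algebra_simps)
    ultimately show "near (c * Suc n * Suc n) (\<tau> j [^] \<epsilon> \<otimes> x) (tprod s (e(j := e j + \<epsilon>)))"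
      by (rule near_mono)
  qed
  have "\<exists>e. exp_norm e \<le> n \<and> near (c * n * n) x (tprod s e)" if "tball n x" for n x
    using that
  proof (induction rule: word_ball.induct)
    case (one n)
    have "tprod k (\<lambda>_. 0) = \<one>" if "k \<le> s" for k
      using that by (induction k) (auto simp: \<tau>)
    then show ?case
      by (intro exI[of _ "\<lambda>_. 0"]) (auto simp: exp_norm_def near_refl)
  next
    case (mult n x g)
    then obtain j e where "g = \<tau> j" "j < s" "exp_norm e \<le> n" "near (c * n * n) x (tprod s e)" by auto
    then show ?case using step[OF mult(1), of e j 1] \<tau> by simp
  next
    case (mult_inv n x g)
    then obtain j e where "g = \<tau> j" "j < s" "exp_norm e \<le> n" "near (c * n * n) x (tprod s e)" by auto
    then show ?case using step[OF mult_inv(1), of e j "-1"] \<tau> by (simp add: int_pow_neg)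
  qed
  then show ?thesis using that by blast
qed

text \<open>The power of \<open>\<tau> i\<close> to the order of \<open>t i\<close> is near the unit
  at a constant price, and reducing the exponent uses this \<open>\<bar>e i div d\<bar>\<close>
  times.\<close>

lemma near_mod_ord:
  obtains c where "\<And>e. near (c * exp_norm e) (tprod s e) (tprod s (mod_ord e))"
proof -
  have "\<exists>k. near k (\<tau> i [^] T.ord (t i)) \<one>" if "i \<in> {..<s}" for i
  proof -
    have "tball (nat \<bar>int (T.ord (t i))\<bar>) (\<tau> i [^] int (T.ord (t i)))"
      using that tset_subset by (intro word_ball_int_pow) auto
    then have "\<alpha> (\<tau> i [^] T.ord (t i)) = \<zero>\<^bsub>A\<^esub>"
      using \<alpha>_tball by (metis int_pow_int)
    then show ?thesis
      using that \<tau> t_closed \<alpha>_one by (intro near_ex) (auto simp: \<rho>.hom_nat_pow)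
  qed
  then obtain c where c: "\<And>i. i \<in> {..<s} \<Longrightarrow> near c (\<tau> i [^] T.ord (t i)) \<one>"
    using uniform_bound[of "{..<s}" "\<lambda>k i. near k (\<tau> i [^] T.ord (t i)) \<one>"] near_mono by blast
  have pow: "near (c * nat \<bar>e i\<bar>) (\<tau> i [^] e i) (\<tau> i [^] mod_ord e i)" if "i < s" for e i
  proof (cases "T.ord (t i) = 0")
    case True
    then show ?thesis using that \<tau> by (simp add: mod_ord_def near_refl)
  next
    case False
    define d where "d = int (T.ord (t i))"
    have "near (nat \<bar>e i div d\<bar> * c) ((\<tau> i [^] T.ord (t i)) [^] (e i div d)) \<one>"
      using c that \<tau> by (intro near_int_pow_one) auto
    then have "near (nat \<bar>e i div d\<bar> * c) ((\<tau> i [^] T.ord (t i)) [^] (e i div d) \<otimes> \<tau> i [^] (e i mod d))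
        (\<one> \<otimes> \<tau> i [^] (e i mod d))"
      using that \<tau> by (intro near_mult_right) auto
    moreover have "(\<tau> i [^] T.ord (t i)) [^] (e i div d) \<otimes> \<tau> i [^] (e i mod d) = \<tau> i [^] e i"
      using that \<tau> unfolding d_def int_pow_int[symmetric]
      by (simp add: int_pow_pow flip: int_pow_mult)
    moreover have "nat \<bar>e i div d\<bar> \<le> nat \<bar>e i\<bar>"
    proof -
      have "d \<ge> 1" using False by (simp add: d_def)
      then have "\<bar>e i div d\<bar> \<le> \<bar>e i\<bar>"
        by (smt (verit) div_by_1 div_le_mono2 int_div_less_self minus_div_mult_eq_mod
            pos_imp_zdiv_neg_iff pos_imp_zdiv_nonneg_iff zdiv_mono2 zdiv_mono2_neg)
      then show ?thesis by simp
    qed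
    then have "nat \<bar>e i div d\<bar> * c \<le> c * nat \<bar>e i\<bar>"
      by (simp add: mult.commute)
    moreover have "mod_ord e i = e i mod d"
      using that False by (simp add: mod_ord_def d_def)
    ultimately show ?thesis
      using that \<tau> by (simp add: near_mono)
  qed
  have "near (c * (\<Sum>i<k. nat \<bar>e i\<bar>)) (tprod k e) (tprod k (mod_ord e))" if "k \<le> s" for k e
    using that
  proof (induction k)
    case (Suc k)
    then have "near (c * nat \<bar>e k\<bar> + c * (\<Sum>i<k. nat \<bar>e i\<bar>)) (tprod (Suc k) e) (tprod (Suc k) (mod_ord e))"
      using near_mult[OF pow[of k e] Suc.IH] \<tau> tprod_closed by simp
    then show ?case by (simp add: distrib_left add.commute)
  qed (simp add: near_refl)
  from this[of s] show ?thesis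
    by (intro that[of c]) (auto simp: exp_norm_def)
qed

text \<open>The quadratic Dehn function of a finitely generated abelian group: collection, then
  reduction of exponents. The additive constant in the height bound pays for torsion.\<close>

lemma tball_near_lift:
  obtains c where
    "\<And>n x. tball n x \<Longrightarrow> near (c * Suc n * Suc n) x (lift (\<rho> x))"
    "\<And>n x. tball n x \<Longrightarrow> height (\<rho> x) \<le> n + c"
proof -
  obtain c1 where c1: "\<And>n x. tball n x \<Longrightarrow> \<exists>e. exp_norm e \<le> n \<and> near (c1 * n * n) x (tprod s e)"
    using tball_near_tprod by blast
  obtain c2 where c2: "\<And>e. near (c2 * exp_norm e) (tprod s e) (tprod s (mod_ord e))"
    using near_mod_ord by blast
  define c3 where "c3 = (\<Sum>i<s. T.ord (t i))"
  have "near ((c1 + c2 + c3) * Suc n * Suc n) x (lift (\<rho> x)) \<and> height (\<rho> x) \<le> n + (c1 + c2 + c3)"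
    if x: "tball n x" for n x
  proof
    obtain e where e: "exp_norm e \<le> n" "near (c1 * n * n) x (tprod s e)"
      using c1 x by blast
    \<comment> \<open>Near elements have equal images, so the reduced form of the collected
      exponents must be the normal form of \<open>\<rho> x\<close>.\<close>
    have "\<rho> x = \<rho> (tprod s e)"
      using near_imp_eq(1)[OF e(2)] tball_closed[OF x] tprod_closed by simp
    then have exps: "exps T s t (\<rho> x) = mod_ord e"
      by (simp add: \<rho>_tprod exps_finprod)
    have "near (c1 * n * n + c2 * exp_norm e) x (lift (\<rho> x))"
      unfolding lift_def exps using near_trans[OF e(2) c2] tball_closed[OF x] tprod_closed by simp
    moreover have "c1 * n * n + c2 * exp_norm e \<le> c1 * n * n + c2 * n" using e by simp
    then have "c1 * n * n + c2 * exp_norm e \<le> (c1 + c2 + c3) * Suc n * Suc n"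
      by (rule order_trans) (simp add: algebra_simps)
    ultimately show "near ((c1 + c2 + c3) * Suc n * Suc n) x (lift (\<rho> x))"
      by (rule near_mono)
    show "height (\<rho> x) \<le> n + (c1 + c2 + c3)"
      using exp_norm_mod_ord[of e] e by (simp add: height_def exps c3_def)
  qed
  then show ?thesis using that by blast
qed

end

section \<open>Signed lists of translated generators\<close>

text \<open>A list of triples \<open>(u, i, p)\<close> encodes the formal sum of the terms \<open>\<plusminus> u e\<^sub>i\<close>, with sign
  \<open>+\<close> iff \<open>p\<close>.\<close>

primrec signed_count :: "('t \<times> nat \<times> bool) list \<Rightarrow> nat \<Rightarrow> 't \<Rightarrow> int" where
  "signed_count [] = (\<lambda>i u. 0)"
| "signed_count (x # xs) = (\<lambda>i u. (if fst x = u \<and> fst (snd x) = i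
      then if snd (snd x) then 1 else -1 else 0) + signed_count xs i u)"

text \<open>The order is reversed so that \<open>lword\<close> turns negation into an exact
  inverse.\<close>

definition negate :: "('t \<times> nat \<times> bool) list \<Rightarrow> ('t \<times> nat \<times> bool) list" where
  "negate xs = rev (map (\<lambda>(u, i, p). (u, i, \<not> p)) xs)"

lemma negate_simps [simp]: "negate [] = []" "negate ((u, i, p) # xs) = negate xs @ [(u, i, \<not> p)]"
  by (simp_all add: negate_def)

lemma length_negate [simp]: "length (negate xs) = length xs"
  by (simp add: negate_def)

lemma signed_count_append:
  "signed_count (xs @ ys) = (\<lambda>i u. signed_count xs i u + signed_count ys i u)"
  by (induction xs) (auto simp: fun_eq_iff)

lemma signed_count_negate: "signed_count (negate xs) i u = - signed_count xs i u"
  by (induction xs) (auto simp: signed_count_append)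

text \<open>A nonzero count is witnessed by a term of the same sign. This finds the partner with
  which a term cancels.\<close>

lemma signed_count_mem:
  "(if p then signed_count xs i u > 0 else signed_count xs i u < 0) \<Longrightarrow> (u, i, p) \<in> set xs"
proof (induction xs)
  case (Cons x xs)
  obtain v j q where "x = (v, j, q)" by (cases x)
  with Cons show ?case by (auto split: if_splits)
qed (simp split: if_splits)

lemma signed_count_support:
  "signed_count xs i u \<noteq> 0 \<Longrightarrow> \<exists>p. (u, i, p) \<in> set xs"
  using signed_count_mem[of True xs i u] signed_count_mem[of False xs i u] by (metis linorder_neqE)

lemma (in group) commutator_mem_derived:
  "x \<in> carrier G \<Longrightarrow> y \<in> carrier G \<Longrightarrow> x \<otimes> y \<otimes> inv x \<otimes> inv y \<in> derived G (carrier G)"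
  unfolding derived_def by (intro generate.incl) blast

context metabelian_lift
begin

section \<open>Products of conjugates of lifted generators\<close>

definition letter where "letter i p = (if p then \<beta> i else inv (\<beta> i))"

text \<open>Conjugators are arbitrary elements of \<open>M\<close> here, whereas
  \<open>lword\<close> uses the normal-form lifts of elements of \<open>T\<close>.\<close>

primrec tword :: "(_ \<times> nat \<times> bool) list \<Rightarrow> _" where
  "tword [] = \<one>"
| "tword (x # xs) = cj (fst x) (letter (fst (snd x)) (snd (snd x))) \<otimes> tword xs"

definition lword where "lword xs = tword (map (\<lambda>(u, i, p). (lift u, i, p)) xs)"

definition terms :: "nat \<Rightarrow> ('t \<times> nat \<times> bool) set" where
  "terms N = {(u, i, p). u \<in> carrier T \<and> height u \<le> N \<and> i < m}"

lemma letter_closed [simp]: "i < m \<Longrightarrow> letter i p \<in> carrier M"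
  by (simp add: letter_def \<beta>)

lemma \<rho>_letter [simp]: "i < m \<Longrightarrow> \<rho> (letter i p) = \<one>\<^bsub>T\<^esub>"
  by (simp add: letter_def \<beta>)

lemma letter_not: "i < m \<Longrightarrow> letter i (\<not> p) = inv (letter i p)"
  by (simp add: letter_def \<beta>)

lemma tword_closed: "set xs \<subseteq> carrier M \<times> {..<m} \<times> UNIV \<Longrightarrow> tword xs \<in> carrier M"
  by (induction xs) auto

lemma \<rho>_tword: "set xs \<subseteq> carrier M \<times> {..<m} \<times> UNIV \<Longrightarrow> \<rho> (tword xs) = \<one>\<^bsub>T\<^esub>"
  by (induction xs) (auto simp: \<rho>_cj tword_closed)

lemma lword_Nil [simp]: "lword [] = \<one>"
  by (simp add: lword_def)

lemma lword_Cons [simp]: "lword ((u, i, p) # xs) = cj (lift u) (letter i p) \<otimes> lword xs"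
  by (simp add: lword_def)

lemma lword_closed: "set xs \<subseteq> terms N \<Longrightarrow> lword xs \<in> carrier M"
  by (induction xs) (auto simp: terms_def)

lemma terms_mono: "N \<le> N' \<Longrightarrow> terms N \<subseteq> terms N'"
  by (auto simp: terms_def)

lemma set_negate_terms: "set xs \<subseteq> terms N \<Longrightarrow> set (negate xs) \<subseteq> terms N"
  by (auto simp: negate_def terms_def)

lemma lword_append:
  "set xs \<subseteq> terms N \<Longrightarrow> set ys \<subseteq> terms N \<Longrightarrow> lword (xs @ ys) = lword xs \<otimes> lword ys"
proof (induction xs)
  case (Cons x xs)
  obtain u i p where "x = (u, i, p)" by (cases x)
  moreover from this have "i < m" using Cons by (simp add: terms_def)
  ultimately show ?case
    using Cons lword_closed[of xs N] lword_closed[of ys N] by (simp add: m_assoc)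
qed (simp add: lword_closed)

lemma lword_negate: "set xs \<subseteq> terms N \<Longrightarrow> lword (negate xs) = inv (lword xs)"
proof (induction xs)
  case (Cons x xs)
  obtain u i p where x: "x = (u, i, p)" by (cases x)
  moreover from this have "i < m" using Cons by (simp add: terms_def)
  moreover have "set (negate xs) \<subseteq> terms N" "set [(u, i, \<not> p)] \<subseteq> terms N"
    using Cons x set_negate_terms[of xs N] by (auto simp: terms_def)
  ultimately show ?case
    using Cons lword_closed[of xs N]
    by (simp add: lword_append letter_not cj_inv inv_mult_group)
qed simp

text \<open>The key use of metabelianity: passing from \<open>w\<close> to \<open>w p\<close> changes \<open>x\<close> and the conjugate
  of \<open>y\<close> by elements of the derived subgroup, which commute exactly. So each letter costs only a
  constant.\<close>

lemma com_letter_cj_step: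
  assumes x: "x \<in> carrier M" and y: "y \<in> carrier M" and w: "w \<in> carrier M" and p: "p \<in> carrier M"
    and com: "com n x (cj w y)" and k: "com k (inv (cj p x) \<otimes> x) y"
  shows "com (n + k) x (cj (w \<otimes> p) y)"
proof -
  \<comment> \<open>The two errors are isolated as commutators:
    \<open>cj p x \<otimes> c = x\<close> and
    \<open>y \<otimes> d = cj (w \<otimes> p) y\<close>.\<close>
  define c where "c = inv (cj p x) \<otimes> x"
  define d where "d = inv y \<otimes> cj (w \<otimes> p) y"
  have cd: "c \<in> carrier M" "d \<in> carrier M"
    using assms by (auto simp: c_def d_def)
  have "c \<in> derived M (carrier M)"
    using commutator_mem_derived[of "inv p" "inv x"] x p
    by (simp add: c_def cj_def m_assoc inv_mult_group)
  moreover have "d \<in> derived M (carrier M)"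
    using commutator_mem_derived[of "inv y" "inv (w \<otimes> p)"] y w p
    by (simp add: d_def cj_def m_assoc inv_mult_group)
  ultimately have "c \<otimes> d = d \<otimes> c"
    using metabelian by (simp add: metabelian_def)
  \<comment> \<open>\<open>c\<close> commutes with \<open>y\<close> at cost \<open>k\<close> by
    hypothesis and with \<open>d\<close> exactly, hence with the whole conjugate.\<close>
  then have "com (k + 0) c (y \<otimes> d)"
    unfolding c_def using k cd y by (intro com_mult[OF k] com_eq) (auto simp: c_def)
  moreover have "y \<otimes> d = cj (w \<otimes> p) y"
    using assms by (simp add: d_def)
  moreover have "com n (cj p x) (cj (w \<otimes> p) y)"
    using com_cj[OF com x _ p] assms by (simp add: cj_cj)
  ultimately have "com (n + k) (cj (w \<otimes> p) y) (cj p x \<otimes> c)"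
    using assms cd com_sym by (intro com_mult) auto
  then show ?thesis
    using assms by (intro com_sym[where x = "cj (w \<otimes> p) y"]) (auto simp: c_def)
qed

text \<open>The conjugator grows by one letter at a time with \<open>com_letter_cj_step\<close>. The
  auxiliary commutation required there concerns finitely many triples, so one constant pays for
  every letter.\<close>

lemma com_letter_cj:
  obtains c where "\<And>n v i j p q. tball n v \<Longrightarrow> i < m \<Longrightarrow> j < m \<Longrightarrow>
    com (c * Suc n) (letter i p) (cj v (letter j q))"
proof -
  define B where "B = (\<lambda>(i, p). letter i p) ` ({..<m} \<times> (UNIV :: bool set))"
  \<comment> \<open>Inverses are included because a letter of either sign may be appended to the
    conjugator.\<close>
  define P where "P = tset \<union> (\<lambda>g. inv g) ` tset"
  have fin: "finite (P \<times> B \<times> B)"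
    by (simp add: B_def P_def)
  have B: "x \<in> carrier M" "\<rho> x = \<one>\<^bsub>T\<^esub>" if "x \<in> B" for x
    using that by (auto simp: B_def)
  have P: "g \<in> carrier M" if "g \<in> P" for g
    using that tset_subset by (auto simp: P_def)
  have "\<exists>k. com k (fst (snd z)) (snd (snd z)) \<and>
      com k (inv (cj (fst z) (fst (snd z))) \<otimes> fst (snd z)) (snd (snd z))" if "z \<in> P \<times> B \<times> B" for z
  proof -
    obtain g x y where "z = (g, x, y)" by (rule prod_cases3)
    with that have z: "z = (g, x, y)" "g \<in> P" "x \<in> B" "y \<in> B" by blast+
    obtain k1 where "com k1 x y"
      using com_ex B z by blast
    moreover have "\<exists>k. com k (inv (cj g x) \<otimes> x) y"
      using B z P by (intro com_ex) (auto simp: \<rho>_cj)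
    then obtain k2 where "com k2 (inv (cj g x) \<otimes> x) y" by auto
    ultimately have "com (k1 + k2) x y" "com (k1 + k2) (inv (cj g x) \<otimes> x) y"
      by (auto elim: com_mono)
    then show ?thesis using z by auto
  qed
  then obtain c1 where c1: "\<And>z. z \<in> P \<times> B \<times> B \<Longrightarrow> com c1 (fst (snd z)) (snd (snd z)) \<and>
      com c1 (inv (cj (fst z) (fst (snd z))) \<otimes> fst (snd z)) (snd (snd z))"
    using uniform_bound[OF fin, of "\<lambda>k z. com k (fst (snd z)) (snd (snd z)) \<and>
      com k (inv (cj (fst z) (fst (snd z))) \<otimes> fst (snd z)) (snd (snd z))"] com_mono by blast
  have "\<exists>k. com k (fst z) (snd z)" if "z \<in> B \<times> B" for z
    using that com_ex B by auto
  then obtain c2 where c2: "\<And>z. z \<in> B \<times> B \<Longrightarrow> com c2 (fst z) (snd z)"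
    using uniform_bound[of "B \<times> B" "\<lambda>k z. com k (fst z) (snd z)"] com_mono fin
    by (metis B_def finite_SigmaI finite_imageI finite_lessThan finite)
  define c where "c = c1 + c2"
  have c_step: "com c (inv (cj g x) \<otimes> x) y" if "g \<in> P" "x \<in> B" "y \<in> B" for g x y
    using c1[of "(g, x, y)"] that by (auto simp: c_def elim: com_mono)
  have c_base: "com c x y" if "x \<in> B" "y \<in> B" for x y
    using c2[of "(x, y)"] that by (auto simp: c_def elim: com_mono)
  \<comment> \<open>Balls grow on the left, whereas the conjugator must grow on the right. Hence the
    induction is on the inverse of the conjugator.\<close>
  have main: "com (c * Suc n) x (cj (inv v) y)" if "tball n v" "x \<in> B" "y \<in> B" for n v x y
    using that(1)
  proof (induction rule: word_ball.induct)
    case (one n)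
    have "com c x (cj (inv \<one>) y)" using c_base[OF that(2,3)] B that by simp
    then show ?case by (rule com_mono) simp
  next
    case (mult n v g)
    then have g: "inv g \<in> P" "g \<in> carrier M" "v \<in> carrier M"
      using tset_subset tball_closed by (auto simp: P_def)
    have "com (c * Suc n + c) x (cj (inv v \<otimes> inv g) y)"
      using g that(2,3) B mult.IH c_step by (intro com_letter_cj_step) auto
    then show ?case using g by (simp add: inv_mult_group add.commute)
  next
    case (mult_inv n v g)
    then have g: "g \<in> P" "g \<in> carrier M" "v \<in> carrier M"
      using tset_subset tball_closed by (auto simp: P_def)
    have "com (c * Suc n + c) x (cj (inv v \<otimes> g) y)"
      using g that(2,3) B mult_inv.IH c_step by (intro com_letter_cj_step) auto
    then show ?case using g by (simp add: inv_mult_group add.commute)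
  qed
  show ?thesis
  proof (rule that)
    fix n v i j p q assume "tball n v" "i < m" "j < m"
    then show "com (c * Suc n) (letter i p) (cj v (letter j q))"
      using main[OF word_ball_inv[OF _ tset_subset], of n v "letter i p" "letter j q"] tball_closed
      by (auto simp: B_def)
  qed
qed

text \<open>Undoing the conjugation by \<open>lift u\<close> leaves a bare letter and a conjugate by
  \<open>lift v \<otimes> inv (lift u)\<close>, whose length is at most
  \<open>2 * N\<close>.\<close>

lemma com_terms:
  obtains c where "\<And>N u v i j p q. (u, i, p) \<in> terms N \<Longrightarrow> (v, j, q) \<in> terms N \<Longrightarrow>
    com (c * Suc N) (cj (lift u) (letter i p)) (cj (lift v) (letter j q))"
proof -
  obtain c where c: "\<And>n v i j p q. tball n v \<Longrightarrow> i < m \<Longrightarrow> j < m \<Longrightarrow>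
    com (c * Suc n) (letter i p) (cj v (letter j q))"
    using com_letter_cj by blast
  show ?thesis
  proof (rule that)
    fix N u v i j p q assume *: "(u, i, p) \<in> terms N" "(v, j, q) \<in> terms N"
    then have lt: "i < m" "j < m" "height v + height u \<le> N + N" by (auto simp: terms_def)
    have "tball (height v + height u) (lift v \<otimes> inv (lift u))"
      by (intro word_ball_mult tball_lift word_ball_inv tset_subset)
    then have "com (c * Suc (height v + height u)) (letter i p) (cj (lift v \<otimes> inv (lift u)) (letter j q))"
      using c lt by blast
    then have "com (c * Suc (height v + height u)) (cj (lift u) (letter i p)) (cj (lift v) (letter j q))"
      using com_cj[of _ _ _ "lift u"] lt by (fastforce simp: cj_cj m_assoc)
    moreover have "c * Suc (height v + height u) \<le> c * Suc (N + N)"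
      using lt by (intro mult_le_mono2) simp
    then have "c * Suc (height v + height u) \<le> 2 * c * Suc N"
      by (rule order_trans) (simp add: algebra_simps)
    ultimately show "com (2 * c * Suc N) (cj (lift u) (letter i p)) (cj (lift v) (letter j q))"
      by (rule com_mono)
  qed
qed

section \<open>Rearranging products of conjugates\<close>

lemma com_lword:
  assumes "\<And>v j q. (v, j, q) \<in> set xs \<Longrightarrow> com k x (cj (lift v) (letter j q))"
    and "set xs \<subseteq> terms N" "x \<in> carrier M"
  shows "com (k * length xs) x (lword xs)"
  using assms(1,2)
proof (induction xs)
  case (Cons y xs)
  obtain v j q where y: "y = (v, j, q)" by (cases y)
  then have "j < m" using Cons by (simp add: terms_def)
  then have "com (k + k * length xs) x (lword (y # xs))"
    unfolding y lword_Cons using Cons y lword_closed[of xs N] assms(3)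
    by (intro com_mult) auto
  then show ?case by simp
qed (use assms(3) in \<open>simp add: com_one\<close>)

text \<open>The first term is moved next to an inverse partner and cancelled, which shortens the
  list by two. Each exchange costs \<open>c * Suc N\<close>, and the number of exchanges is at most
  quadratic in the length.\<close>

lemma lword_signed_count_zero:
  obtains c where "\<And>N xs. set xs \<subseteq> terms N \<Longrightarrow> signed_count xs = (\<lambda>i u. 0) \<Longrightarrow>
    near (c * Suc N * (length xs)\<^sup>2) (lword xs) \<one>"
proof -
  obtain c where c: "\<And>N u v i j p q. (u, i, p) \<in> terms N \<Longrightarrow> (v, j, q) \<in> terms N \<Longrightarrow>
    com (c * Suc N) (cj (lift u) (letter i p)) (cj (lift v) (letter j q))"
    using com_terms by blast
  have "near (c * Suc N * (length xs)\<^sup>2) (lword xs) \<one>"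
    if "set xs \<subseteq> terms N" "signed_count xs = (\<lambda>i u. 0)" for N xs
    using that
  proof (induction "length xs" arbitrary: xs rule: less_induct)
    case less
    show ?case
    proof (cases xs)
      case Nil
      then show ?thesis by (simp add: near_refl)
    next
      case (Cons x ys)
      obtain u i p where x: "x = (u, i, p)" by (cases x)
      have "signed_count xs i u = 0" using less by simp
      \<comment> \<open>The total count at \<open>(u, i)\<close> is zero, so the tail has a count of
        the sign opposite to the head.\<close>
      then have "(u, i, \<not> p) \<in> set ys"
        using Cons x by (intro signed_count_mem) (auto split: if_splits)
      then obtain y1 y2 where ys: "ys = y1 @ (u, i, \<not> p) # y2"
        by (meson split_list)
      have mem: "(u, i, p) \<in> terms N" "set y1 \<subseteq> terms N" "set y2 \<subseteq> terms N"
        "set ((u, i, \<not> p) # y2) \<subseteq> terms N" "set (y1 @ y2) \<subseteq> terms N"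
        using less.prems(1) Cons x ys by auto
      then have i: "i < m" by (simp add: terms_def)
      define z where "z = cj (lift u) (letter i p)"
      have cl: "z \<in> carrier M" "lword y1 \<in> carrier M" "lword y2 \<in> carrier M"
        using i mem lword_closed by (auto simp: z_def)
      have eq: "lword xs = z \<otimes> (lword y1 \<otimes> (inv z \<otimes> lword y2))"
        using mem i cl by (simp add: Cons x ys lword_append[of _ N] letter_not cj_inv z_def)
      have "com (c * Suc N * length y1) z (lword y1)"
        unfolding z_def using mem c i by (intro com_lword) auto
      then have "near (c * Suc N * length y1) (z \<otimes> lword y1 \<otimes> (inv z \<otimes> lword y2))
          (lword y1 \<otimes> z \<otimes> (inv z \<otimes> lword y2))"
        unfolding com_def using cl by (intro near_mult_right) auto
      then have 1: "near (c * Suc N * length y1) (lword xs) (lword (y1 @ y2))"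
        using cl mem by (simp add: eq m_assoc lword_append[of _ N])
      have "signed_count (y1 @ y2) j v = signed_count xs j v" for j v
        by (simp add: Cons x ys signed_count_append)
      then have 2: "near (c * Suc N * (length (y1 @ y2))\<^sup>2) (lword (y1 @ y2)) \<one>"
        using less mem by (intro less.hyps) (auto simp: Cons ys fun_eq_iff)
      have "near (c * Suc N * length y1 + c * Suc N * (length (y1 @ y2))\<^sup>2) (lword xs) \<one>"
        using near_trans[OF 1 2] mem less.prems lword_closed by blast
      moreover have "c * Suc N * length y1 + c * Suc N * (length (y1 @ y2))\<^sup>2
          = c * Suc N * (length y1 + (length (y1 @ y2))\<^sup>2)"
        by (simp only: distrib_left)
      \<comment> \<open>\<open>y1\<close> is shorter than \<open>xs\<close> and
        \<open>y1 @ y2\<close> has two terms fewer, so the squares leave room for the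
        exchanges.\<close>
      moreover have "c * Suc N * (length y1 + (length (y1 @ y2))\<^sup>2) \<le> c * Suc N * (length xs)\<^sup>2"
        by (intro mult_le_mono2) (simp add: Cons ys power2_eq_square)
      ultimately show ?thesis
        by (metis near_mono)
    qed
  qed
  then show ?thesis using that by blast
qed

text \<open>Applies the case of zero count to \<open>xs @ negate ys\<close>.\<close>

lemma lword_signed_count_eq:
  obtains c where "\<And>N xs ys. set xs \<subseteq> terms N \<Longrightarrow> set ys \<subseteq> terms N \<Longrightarrow>
    signed_count xs = signed_count ys \<Longrightarrow>
    near (c * Suc N * (length xs + length ys)\<^sup>2) (lword xs) (lword ys)"
proof -
  obtain c where c: "\<And>N xs. set xs \<subseteq> terms N \<Longrightarrow> signed_count xs = (\<lambda>i u. 0) \<Longrightarrow>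
    near (c * Suc N * (length xs)\<^sup>2) (lword xs) \<one>"
    using lword_signed_count_zero by blast
  have "near (c * Suc N * (length xs + length ys)\<^sup>2) (lword xs) (lword ys)"
    if *: "set xs \<subseteq> terms N" "set ys \<subseteq> terms N" "signed_count xs = signed_count ys" for N xs ys
  proof -
    have neg: "set (negate ys) \<subseteq> terms N"
      using * set_negate_terms by blast
    have cl: "lword xs \<in> carrier M" "lword ys \<in> carrier M"
      using * lword_closed by auto
    have "near (c * Suc N * (length (xs @ negate ys))\<^sup>2) (lword (xs @ negate ys)) \<one>"
      using * neg by (intro c) (auto simp: signed_count_append signed_count_negate fun_eq_iff)
    then have "near (c * Suc N * (length xs + length ys)\<^sup>2) (lword xs \<otimes> inv (lword ys)) \<one>"
      using * neg by (simp add: lword_append[of _ N] lword_negate[of _ N])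
    from near_mult_right[OF this, of "lword ys"] show ?thesis
      using cl by (simp add: m_assoc)
  qed
  then show ?thesis using that by blast
qed

end

section \<open>The norm and the area in a free module over a group ring\<close>

text \<open>Uniqueness for the definite description in \<open>decreasing_list\<close>. Strictness of
  the order excludes repetitions, so comparing sets suffices.\<close>

lemma sorted_wrt_unique:
  assumes "\<And>x y z. P x y \<Longrightarrow> P y z \<Longrightarrow> P x z" "\<And>x. \<not> P x x"
    and "sorted_wrt P xs" "sorted_wrt P ys" "set xs = set ys"
  shows "xs = ys"
  using assms(3-5)
proof (induction xs arbitrary: ys)
  case (Cons x xs)
  then obtain y zs where ys: "ys = y # zs" by (cases ys) auto
  have "x = y"
  proof (rule ccontr)
    assume "x \<noteq> y"
    then have "P x y" "P y x" using Cons.prems unfolding ys by auto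
    then show False using assms(1,2) by blast
  qed
  moreover have "x \<notin> set xs" "y \<notin> set zs"
    using Cons.prems assms(2) unfolding ys by auto
  moreover have "insert x (set xs) = insert y (set zs)" "sorted_wrt P xs" "sorted_wrt P zs"
    using Cons.prems unfolding ys by auto
  ultimately have "xs = zs"
    using Cons.IH by (metis insert_ident)
  then show ?case using \<open>x = y\<close> ys by simp
qed simp

lemma irrefl_sorted_wrt_distinct: "(\<And>x. \<not> P x x) \<Longrightarrow> sorted_wrt P xs \<Longrightarrow> distinct xs"
  by (induction xs) auto

text \<open>Existence for \<open>decreasing_list\<close>, by insertion: a sorted list is split into
  the part before and the part after the new element.\<close>

lemma sorted_wrt_exists:
  assumes trans: "\<And>x y z. P x y \<Longrightarrow> P y z \<Longrightarrow> P x z"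
    and "\<And>x y. x \<in> U \<Longrightarrow> y \<in> U \<Longrightarrow> x \<noteq> y \<Longrightarrow> P x y \<or> P y x" "finite U"
  shows "\<exists>xs. set xs = U \<and> sorted_wrt P xs"
  using assms(3,2)
proof (induction U rule: finite_induct)
  case (insert x U)
  then obtain xs where xs: "set xs = U" "sorted_wrt P xs" by auto
  have "sorted_wrt P (filter (\<lambda>y. P y x) xs @ x # filter (\<lambda>y. P x y) xs)"
    using xs(2) trans by (auto simp: sorted_wrt_append sorted_wrt_filter)
  moreover have "set (filter (\<lambda>y. P y x) xs @ x # filter (\<lambda>y. P x y) xs) = insert x U"
    using xs(1) insert by auto
  ultimately show ?case by blast
qed simp

lemma length_concat_map_distinct:
  "distinct xs \<Longrightarrow> length (concat (map f xs)) = (\<Sum>x\<in>set xs. length (f x))"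
  by (induction xs) auto

text \<open>Every term changes one coefficient by one, and cancellation can only decrease the
  norm.\<close>

lemma signed_count_norm:
  assumes "finite U"
  shows "(\<Sum>(i, u)\<in>{..<m} \<times> U. nat \<bar>signed_count xs i u\<bar>) \<le> length xs"
proof (induction xs)
  case (Cons x xs)
  have step: "nat \<bar>signed_count (x # xs) i u\<bar> \<le>
      (if (i, u) = (fst (snd x), fst x) then 1 else 0) + nat \<bar>signed_count xs i u\<bar>" for i u
    by (cases "fst x = u \<and> fst (snd x) = i") auto
  have "(\<Sum>(i, u)\<in>{..<m} \<times> U. nat \<bar>signed_count (x # xs) i u\<bar>) \<le>
      (\<Sum>z\<in>{..<m} \<times> U. (if z = (fst (snd x), fst x) then 1 else 0) + (case z of (i, u) \<Rightarrow> nat \<bar>signed_count xs i u\<bar>))"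
    using step[of "fst z" "snd z" for z] by (intro sum_mono) (simp only: case_prod_unfold prod.collapse)
  also have "\<dots> \<le> 1 + length xs"
    unfolding sum.distrib using Cons assms by (intro add_mono) auto
  finally show ?case by simp
qed simp

lemma gr_norm_eq_sum: "finite U \<Longrightarrow> supp \<mu> \<subseteq> U \<Longrightarrow> gr_norm \<mu> = (\<Sum>u\<in>U. nat \<bar>\<mu> u\<bar>)"
  unfolding gr_norm_def by (intro sum.mono_neutral_left) (auto simp: supp_def)

section \<open>The monomial order and the length of ordered words\<close>

context basis_group
begin

lemma exps_inj:
  assumes "u \<in> carrier T" "v \<in> carrier T" "\<And>i. i < s \<Longrightarrow> exps T s t u i = exps T s t v i"
  shows "u = v"
proof -
  have "u = (\<Otimes>\<^bsub>T\<^esub>i\<in>{..<s}. t i [^]\<^bsub>T\<^esub> exps T s t u i)"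
    using assms finprod_exps by simp
  also have "\<dots> = (\<Otimes>\<^bsub>T\<^esub>i\<in>{..<s}. t i [^]\<^bsub>T\<^esub> exps T s t v i)"
    using assms(3) t_closed by (intro T.finprod_cong') auto
  also have "\<dots> = v"
    using assms finprod_exps by simp
  finally show ?thesis .
qed

text \<open>The concatenated blocks all have length two, so they can be read back, and an integer is
  determined by its positive and negative parts.\<close>

lemma var_exps_inj:
  assumes "u \<in> carrier T" "v \<in> carrier T" "var_exps T s t u = var_exps T s t v"
  shows "u = v"
proof (rule exps_inj[OF assms(1,2)])
  fix i assume i: "i < s"
  have "map (\<lambda>i. [nat (exps T s t u i), nat (- exps T s t u i)]) [0..<s] =
      map (\<lambda>i. [nat (exps T s t v i), nat (- exps T s t v i)]) [0..<s]"
    using assms(3) unfolding var_exps_def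
    by (subst (asm) concat_eq_concat_iff) (auto simp: set_zip)
  then have "nat (exps T s t u i) = nat (exps T s t v i)" "nat (- exps T s t u i) = nat (- exps T s t v i)"
    using i by auto
  then show "exps T s t u i = exps T s t v i"
    by arith
qed

lemma length_var_exps: "length (var_exps T s t u) = 2 * s"
proof -
  have "length (concat (map (\<lambda>i. [f i, g i]) [0..<k])) = 2 * k" for f g :: "nat \<Rightarrow> nat" and k
    by (induction k) auto
  then show ?thesis by (simp add: var_exps_def)
qed

lemma elem_less_trans: "elem_less T s t u v \<Longrightarrow> elem_less T s t v w \<Longrightarrow> elem_less T s t u w"
  using lex_transI[OF trans_less_than] unfolding elem_less_def Let_def by (auto dest: transD)

lemma elem_less_irrefl: "\<not> elem_less T s t u u"
  using wf_lex[OF wf_less_than] unfolding elem_less_def Let_def by auto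

lemma elem_less_total:
  assumes "u \<in> carrier T" "v \<in> carrier T" "u \<noteq> v"
  shows "elem_less T s t u v \<or> elem_less T s t v u"
proof -
  have "var_exps T s t u \<noteq> var_exps T s t v"
    using var_exps_inj assms by blast
  \<comment> \<open>\<open>lenlex\<close> supplies totality. All exponent lists have length
    \<open>2 * s\<close>, so it amounts to \<open>lex\<close> here, which decides when the degrees
    agree.\<close>
  then have "(var_exps T s t u, var_exps T s t v) \<in> lenlex less_than \<or>
      (var_exps T s t v, var_exps T s t u) \<in> lenlex less_than"
    using total_lenlex[OF total_less_than] by (auto simp: total_on_def)
  then show ?thesis
    unfolding elem_less_def Let_def by (auto simp: lenlex_conv length_var_exps)
qed

lemma decreasing_list:
  assumes "finite U" "U \<subseteq> carrier T"
  shows "set (decreasing_list T s t U) = U" "distinct (decreasing_list T s t U)"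
proof -
  let ?P = "\<lambda>u v. elem_less T s t v u"
  have trans: "?P x z" if "?P x y" "?P y z" for x y z
    using that elem_less_trans by blast
  have "\<exists>us. set us = U \<and> sorted_wrt ?P us"
    by (rule sorted_wrt_exists[of ?P U, OF trans _ assms(1)]) (use assms(2) elem_less_total in blast)+
  then obtain us where us: "set us = U \<and> sorted_wrt ?P us"
    by blast
  have "vs = us" if "set vs = U \<and> sorted_wrt ?P vs" for vs
    by (rule sorted_wrt_unique[of ?P, OF trans elem_less_irrefl]) (use that us in auto)
  with us have *: "set (decreasing_list T s t U) = U \<and> sorted_wrt ?P (decreasing_list T s t U)"
    unfolding decreasing_list_def by (rule theI)
  then show "set (decreasing_list T s t U) = U" by simp
  show "distinct (decreasing_list T s t U)"
    using * elem_less_irrefl by (intro irrefl_sorted_wrt_distinct[of ?P]) auto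
qed

text \<open>A nonzero integer coefficient has absolute value at least one, so the conjugating word
  and its inverse, each of length at most \<open>N\<close>, are charged to one unit of the
  coefficient.\<close>

lemma length_elem_word:
  assumes "finite (supp \<mu>)" "supp \<mu> \<subseteq> carrier T" "\<And>u. u \<in> supp \<mu> \<Longrightarrow> height u \<le> N"
  shows "length (elem_word T s t i \<mu>) \<le> (2 * N + 1) * gr_norm \<mu>"
proof -
  have "length (elem_word T s t i \<mu>) = (\<Sum>u\<in>supp \<mu>. 2 * height u + nat \<bar>\<mu> u\<bar>)"
    using assms(1,2)
    by (simp add: elem_word_def length_concat_map_distinct decreasing_list length_ordered_word
        pow_word_def algebra_simps mult_2)
  also have "\<dots> \<le> (\<Sum>u\<in>supp \<mu>. (2 * N + 1) * nat \<bar>\<mu> u\<bar>)"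
  proof (rule sum_mono)
    fix u assume u: "u \<in> supp \<mu>"
    then have "1 \<le> nat \<bar>\<mu> u\<bar>" by (simp add: supp_def)
    then have "2 * N \<le> 2 * N * nat \<bar>\<mu> u\<bar>" by simp
    moreover have "2 * height u \<le> 2 * N"
      using assms(3) u by simp
    ultimately have "2 * height u + nat \<bar>\<mu> u\<bar> \<le> 2 * N * nat \<bar>\<mu> u\<bar> + nat \<bar>\<mu> u\<bar>"
      by linarith
    then show "2 * height u + nat \<bar>\<mu> u\<bar> \<le> (2 * N + 1) * nat \<bar>\<mu> u\<bar>"
      by simp
  qed
  finally show ?thesis
    by (simp add: gr_norm_def sum_distrib_left)
qed

lemma supp_signed_count: "supp (signed_count xs i) \<subseteq> fst ` set xs"
  using signed_count_support by (force simp: supp_def)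

text \<open>Free reduction only shortens the word, and combining equal terms only lowers the
  coefficients. For O(n) terms of height O(n) this yields the quadratic argument of the module Dehn
  function.\<close>

lemma module_norm_signed_count:
  assumes "\<And>u i p. (u, i, p) \<in> set xs \<Longrightarrow> u \<in> carrier T \<and> height u \<le> N"
    and "\<And>i. i < m \<Longrightarrow> f i = signed_count xs i"
  shows "module_norm T s t m f \<le> (2 * N + 1) * length xs"
proof -
  define U where "U = fst ` set xs"
  have U: "finite U" "\<And>u. u \<in> U \<Longrightarrow> u \<in> carrier T \<and> height u \<le> N"
    using assms(1) by (auto simp: U_def)
  have supp: "supp (signed_count xs i) \<subseteq> U" for i
    using supp_signed_count by (simp add: U_def)
  have "module_norm T s t m f \<le> length (concat (map (\<lambda>i. elem_word T s t i (f i)) [0..<m]))"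
    unfolding module_norm_def by (rule length_reduce_le)
  also have "\<dots> = (\<Sum>i<m. length (elem_word T s t i (f i)))"
    by (simp add: length_concat_map_distinct atLeast0LessThan)
  also have "\<dots> \<le> (\<Sum>i<m. (2 * N + 1) * gr_norm (signed_count xs i))"
  proof (rule sum_mono)
    fix i assume "i \<in> {..<m}"
    then show "length (elem_word T s t i (f i)) \<le> (2 * N + 1) * gr_norm (signed_count xs i)"
      using assms(2)[of i] U supp finite_subset[OF supp U(1)] subsetD[OF supp]
      by (simp only: lessThan_iff) (intro length_elem_word, blast+)
  qed
  also have "\<dots> = (2 * N + 1) * (\<Sum>(i, u)\<in>{..<m} \<times> U. nat \<bar>signed_count xs i u\<bar>)"
    using U(1) supp
    by (simp only: gr_norm_eq_sum[of U] sum_distrib_left sum.cartesian_product case_prod_unfold)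
  also have "\<dots> \<le> (2 * N + 1) * length xs"
    by (intro mult_le_mono2 signed_count_norm U)
  finally show ?thesis .
qed

end

section \<open>Writing group ring coefficients as lists of signed terms\<close>

lemma signed_count_replicate:
  "signed_count (replicate n (u, i, p)) j v =
    (if u = v \<and> i = j then if p then int n else - int n else 0)"
  by (induction n) auto

lemma signed_count_exists_single:
  assumes "finite U"
  shows "\<exists>xs. length xs = (\<Sum>u\<in>U. nat \<bar>\<mu> u\<bar>) \<and> set xs \<subseteq> U \<times> {i} \<times> UNIV \<and>
    (\<forall>j v. signed_count xs j v = (if j = i \<and> v \<in> U then \<mu> v else 0))"
  using assms
proof (induction U rule: finite_induct)
  case (insert u U)
  then obtain xs where xs: "length xs = (\<Sum>u\<in>U. nat \<bar>\<mu> u\<bar>)" "set xs \<subseteq> U \<times> {i} \<times> UNIV"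
    "\<And>j v. signed_count xs j v = (if j = i \<and> v \<in> U then \<mu> v else 0)" by blast
  have "signed_count (replicate (nat \<bar>\<mu> u\<bar>) (u, i, 0 \<le> \<mu> u) @ xs) j v =
      (if j = i \<and> v \<in> insert u U then \<mu> v else 0)" for j v
    using insert(2) by (auto simp: signed_count_append signed_count_replicate xs(3))
  then show ?case
    using xs insert by (intro exI[of _ "replicate (nat \<bar>\<mu> u\<bar>) (u, i, 0 \<le> \<mu> u) @ xs"]) auto
qed simp

text \<open>Each coefficient is written in unary. The length is exactly the norm, so the module area
  becomes the number of translated relations.\<close>

lemma signed_count_exists:
  assumes "\<And>i. i < k \<Longrightarrow> finite (supp (f i))"
  obtains xs where "length xs = (\<Sum>i<k. gr_norm (f i))"
    "\<And>u i p. (u, i, p) \<in> set xs \<Longrightarrow> i < k \<and> u \<in> supp (f i)"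
    "\<And>i. i < k \<Longrightarrow> signed_count xs i = f i"
proof -
  have "\<exists>xs. length xs = (\<Sum>i<k. gr_norm (f i)) \<and> set xs \<subseteq> (SIGMA u:UNIV. {i. i < k \<and> u \<in> supp (f i)} \<times> UNIV) \<and>
    (\<forall>i u. signed_count xs i u = (if i < k then f i u else 0))"
    using assms
  proof (induction k)
    case (Suc k)
    have "\<exists>xs. length xs = (\<Sum>i<k. gr_norm (f i)) \<and> set xs \<subseteq> (SIGMA u:UNIV. {i. i < k \<and> u \<in> supp (f i)} \<times> UNIV) \<and>
        (\<forall>i u. signed_count xs i u = (if i < k then f i u else 0))"
      by (rule Suc.IH) (simp add: Suc.prems)
    then obtain xs where xs: "length xs = (\<Sum>i<k. gr_norm (f i))"
      "set xs \<subseteq> (SIGMA u:UNIV. {i. i < k \<and> u \<in> supp (f i)} \<times> UNIV)"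
      "\<And>i u. signed_count xs i u = (if i < k then f i u else 0)"
      by blast
    obtain ys where ys: "length ys = (\<Sum>u\<in>supp (f k). nat \<bar>f k u\<bar>)" "set ys \<subseteq> supp (f k) \<times> {k} \<times> UNIV"
      "\<And>j v. signed_count ys j v = (if j = k \<and> v \<in> supp (f k) then f k v else 0)"
      using signed_count_exists_single[OF Suc.prems[of k], of "f k" k] by blast
    have "length (xs @ ys) = (\<Sum>i<Suc k. gr_norm (f i))"
      using xs(1) ys(1) by (simp add: gr_norm_def)
    moreover have "signed_count (xs @ ys) i u = (if i < Suc k then f i u else 0)" for i u
      by (auto simp: signed_count_append supp_def xs(3) ys(3) less_Suc_eq)
    moreover have "set (xs @ ys) \<subseteq> (SIGMA u:UNIV. {i. i < Suc k \<and> u \<in> supp (f i)} \<times> UNIV)"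
      using xs(2) ys(2) by fastforce
    ultimately show ?case
      by blast
  qed simp
  then obtain xs where xs: "length xs = (\<Sum>i<k. gr_norm (f i))"
    "set xs \<subseteq> (SIGMA u:UNIV. {i. i < k \<and> u \<in> supp (f i)} \<times> UNIV)"
    "\<And>i u. signed_count xs i u = (if i < k then f i u else 0)"
    by blast
  show ?thesis
    by (rule that[OF xs(1)]) (use xs(2,3) in \<open>auto simp: fun_eq_iff\<close>)
qed

section \<open>Linear combinations over the integral group ring\<close>

lemma (in comm_monoid) finprod_delta:
  assumes "finite I" "i \<in> I" "x \<in> carrier G"
  shows "(\<Otimes>j\<in>I. if j = i then x else \<one>) = x"
  using finprod_singleton[OF assms(2,1), of "\<lambda>_. x"] assms(3) by (simp add: eq_commute)

lemma (in module) lincomb_add: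
  assumes "f \<in> {..<k} \<rightarrow> carrier R" "g \<in> {..<k} \<rightarrow> carrier R" "v \<in> {..<k} \<rightarrow> carrier M"
  shows "lincomb M k (\<lambda>i. f i \<oplus>\<^bsub>R\<^esub> g i) v = lincomb M k f v \<oplus>\<^bsub>M\<^esub> lincomb M k g v"
proof -
  have "lincomb M k (\<lambda>i. f i \<oplus>\<^bsub>R\<^esub> g i) v = (\<Oplus>\<^bsub>M\<^esub>i\<in>{..<k}. f i \<odot>\<^bsub>M\<^esub> v i \<oplus>\<^bsub>M\<^esub> g i \<odot>\<^bsub>M\<^esub> v i)"
    unfolding lincomb_def using assms by (intro M.finsum_cong') (auto simp: smult_l_distr Pi_iff)
  also have "\<dots> = lincomb M k f v \<oplus>\<^bsub>M\<^esub> lincomb M k g v"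
    unfolding lincomb_def using assms by (intro M.finsum_addf) (auto simp: Pi_iff)
  finally show ?thesis .
qed

lemma (in module) lincomb_delta:
  assumes "x \<in> carrier R" "i < k" "v \<in> {..<k} \<rightarrow> carrier M"
  shows "lincomb M k (\<lambda>j. if j = i then x else \<zero>\<^bsub>R\<^esub>) v = x \<odot>\<^bsub>M\<^esub> v i"
proof -
  have "v i \<in> carrier M" using assms by auto
  have "lincomb M k (\<lambda>j. if j = i then x else \<zero>\<^bsub>R\<^esub>) v = (\<Oplus>\<^bsub>M\<^esub>j\<in>{..<k}. if j = i then x \<odot>\<^bsub>M\<^esub> v i else \<zero>\<^bsub>M\<^esub>)"
    unfolding lincomb_def using assms by (intro M.finsum_cong') (auto simp: Pi_iff)
  also have "\<dots> = x \<odot>\<^bsub>M\<^esub> v i"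
    using M.add.finprod_delta[of "{..<k}" i "x \<odot>\<^bsub>M\<^esub> v i"] assms \<open>v i \<in> carrier M\<close>
    by (simp add: finsum_def)
  finally show ?thesis .
qed

context group_ring_module
begin

text \<open>No height bound is imposed. The bound on the index is a parameter: \<open>m\<close> for
  sums of module generators, \<open>l\<close> for sums of relations.\<close>

definition valid :: "nat \<Rightarrow> ('t \<times> nat \<times> bool) list \<Rightarrow> bool" where
  "valid k xs \<longleftrightarrow> set xs \<subseteq> carrier T \<times> {..<k} \<times> UNIV"

definition unit_elem where "unit_elem u p = (if p then of_elem u else \<ominus>\<^bsub>ZT\<^esub> of_elem u)"

lemma ZT_add: "x \<oplus>\<^bsub>ZT\<^esub> y = (\<lambda>u. x u + y u)"
  by (simp add: group_ring_def)

lemma ZT_zero: "\<zero>\<^bsub>ZT\<^esub> = (\<lambda>_. 0)"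
  by (simp add: group_ring_def)

lemma ZT_minus:
  assumes "x \<in> carrier ZT"
  shows "\<ominus>\<^bsub>ZT\<^esub> x = (\<lambda>u. - x u)"
proof (rule A.R.minus_equality[OF _ assms])
  show "(\<lambda>u. - x u) \<oplus>\<^bsub>ZT\<^esub> x = \<zero>\<^bsub>ZT\<^esub>"
    by (simp add: ZT_add ZT_zero)
  show "(\<lambda>u. - x u) \<in> carrier ZT"
    using assms by (simp add: group_ring_def supp_def)
qed

lemma unit_elem_closed [simp]: "u \<in> carrier T \<Longrightarrow> unit_elem u p \<in> carrier ZT"
  by (simp add: unit_elem_def of_elem_closed)

lemma unit_elem_apply:
  "u \<in> carrier T \<Longrightarrow> unit_elem u p v = (if u = v then if p then 1 else -1 else 0)"
  by (auto simp: unit_elem_def ZT_minus of_elem_closed) (auto simp: of_elem_def)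

lemma of_elem_mult:
  assumes "u \<in> carrier T" "v \<in> carrier T"
  shows "of_elem u \<otimes>\<^bsub>ZT\<^esub> of_elem v = of_elem (u \<otimes>\<^bsub>T\<^esub> v)"
proof
  fix w
  have "{(x, y) \<in> {u} \<times> {v}. x \<otimes>\<^bsub>T\<^esub> y = w} = (if u \<otimes>\<^bsub>T\<^esub> v = w then {(u, v)} else {})"
    by auto
  moreover have "(of_elem u \<otimes>\<^bsub>ZT\<^esub> of_elem v) w =
      (\<Sum>(x, y)\<in>{(x, y) \<in> {u} \<times> {v}. x \<otimes>\<^bsub>T\<^esub> y = w}. of_elem u x * of_elem v y)"
    by (simp only: group_ring_def monoid.simps supp_of_elem)
  ultimately show "(of_elem u \<otimes>\<^bsub>ZT\<^esub> of_elem v) w = of_elem (u \<otimes>\<^bsub>T\<^esub> v) w"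
    by (simp add: of_elem_def)
qed

lemma of_elem_unit_elem:
  "u \<in> carrier T \<Longrightarrow> v \<in> carrier T \<Longrightarrow> of_elem u \<otimes>\<^bsub>ZT\<^esub> unit_elem v p = unit_elem (u \<otimes>\<^bsub>T\<^esub> v) p"
  by (simp add: unit_elem_def of_elem_mult of_elem_closed A.R.r_minus)

text \<open>Turns the integer-valued recursion into ring operations, so that linearity of
  \<open>lincomb\<close> applies.\<close>

lemma signed_count_Cons:
  "u \<in> carrier T \<Longrightarrow> signed_count ((u, i, p) # xs) j =
    (if j = i then unit_elem u p else \<zero>\<^bsub>ZT\<^esub>) \<oplus>\<^bsub>ZT\<^esub> signed_count xs j"
  by (auto simp: ZT_add ZT_zero unit_elem_apply fun_eq_iff)

lemma signed_count_closed: "valid k xs \<Longrightarrow> signed_count xs i \<in> carrier ZT"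
proof (induction xs)
  case Nil
  show ?case using A.R.zero_closed by (simp add: ZT_zero)
next
  case (Cons x xs)
  obtain u j p where x: "x = (u, j, p)" by (cases x)
  then have "u \<in> carrier T" "valid k xs" using Cons by (auto simp: valid_def)
  then show ?case
    unfolding x using Cons by (auto simp: signed_count_Cons simp del: signed_count.simps)
qed

lemma lincomb_signed_count_Cons:
  assumes "valid k ((u, i, p) # xs)" "v \<in> {..<k} \<rightarrow> carrier A"
  shows "lincomb A k (signed_count ((u, i, p) # xs)) v =
    (unit_elem u p \<odot>\<^bsub>A\<^esub> v i) \<oplus>\<^bsub>A\<^esub> lincomb A k (signed_count xs) v"
proof -
  have u: "u \<in> carrier T" "i < k" "valid k xs" using assms by (auto simp: valid_def)
  then have "signed_count ((u, i, p) # xs) =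
      (\<lambda>j. (if j = i then unit_elem u p else \<zero>\<^bsub>ZT\<^esub>) \<oplus>\<^bsub>ZT\<^esub> signed_count xs j)"
    using signed_count_Cons by blast
  then have "lincomb A k (signed_count ((u, i, p) # xs)) v =
      lincomb A k (\<lambda>j. if j = i then unit_elem u p else \<zero>\<^bsub>ZT\<^esub>) v \<oplus>\<^bsub>A\<^esub> lincomb A k (signed_count xs) v"
    using u assms(2) signed_count_closed by (simp only:) (intro A.lincomb_add, auto)
  then show ?thesis
    using u assms(2) by (simp only: A.lincomb_delta unit_elem_closed)
qed

lemma lincomb_signed_count_Nil:
  assumes "v \<in> {..<k} \<rightarrow> carrier A"
  shows "lincomb A k (signed_count []) v = \<zero>\<^bsub>A\<^esub>"
proof -
  have "lincomb A k (signed_count []) v = (\<Oplus>\<^bsub>A\<^esub>j\<in>{..<k}. \<zero>\<^bsub>A\<^esub>)"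
    unfolding lincomb_def using assms
    by (intro A.M.finsum_cong') (auto simp: Pi_iff ZT_zero[symmetric])
  then show ?thesis by simp
qed

lemma comm_monoid_free_module: "comm_monoid (add_monoid (free_module ZT k))"
proof (rule comm_monoidI)
  fix x assume "x \<in> carrier (add_monoid (free_module ZT k))"
  then show "\<one>\<^bsub>add_monoid (free_module ZT k)\<^esub> \<otimes>\<^bsub>add_monoid (free_module ZT k)\<^esub> x = x"
    by (intro extensionalityI[of _ "{..<k}"]) (auto simp: free_module_def PiE_iff)
qed (auto simp: free_module_def PiE_iff A.R.add.m_ac intro!: restrict_ext)

text \<open>Sums in the free module are coordinatewise. The induction peels off one relation at a
  time and uses the additive monoid.\<close>

lemma lincomb_free_module_apply:
  assumes "f \<in> {..<l} \<rightarrow> carrier ZT" "v \<in> {..<l} \<rightarrow> carrier (free_module ZT k)" "i < k"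
  shows "lincomb (free_module ZT k) l f v i = (\<Oplus>\<^bsub>ZT\<^esub>j\<in>{..<l}. f j \<otimes>\<^bsub>ZT\<^esub> v j i)"
  using assms
proof (induction l)
  case 0
  interpret V: comm_monoid "add_monoid (free_module ZT k)" by (rule comm_monoid_free_module)
  have "lincomb (free_module ZT k) 0 f v = \<zero>\<^bsub>free_module ZT k\<^esub>"
    using V.finprod_empty by (simp add: lincomb_def finsum_def)
  then show ?case
    using assms(3) by (simp add: free_module_def)
next
  case (Suc l)
  interpret V: comm_monoid "add_monoid (free_module ZT k)" by (rule comm_monoid_free_module)
  have vi: "v j i \<in> carrier ZT" if "j < Suc l" for j
  proof -
    have "v j \<in> {..<k} \<rightarrow>\<^sub>E carrier ZT"
      using Suc.prems(2) that by (auto simp: free_module_def)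
    then show ?thesis using assms(3) by auto
  qed
  have mem: "f j \<odot>\<^bsub>free_module ZT k\<^esub> v j \<in> carrier (free_module ZT k)" if "j < Suc l" for j
  proof -
    have "v j \<in> {..<k} \<rightarrow>\<^sub>E carrier ZT" "f j \<in> carrier ZT"
      using Suc.prems that by (auto simp: free_module_def)
    then show ?thesis by (auto simp: free_module_def)
  qed
  have "lincomb (free_module ZT k) (Suc l) f v =
      (f l \<odot>\<^bsub>free_module ZT k\<^esub> v l) \<oplus>\<^bsub>free_module ZT k\<^esub> lincomb (free_module ZT k) l f v"
    unfolding lincomb_def finsum_def lessThan_Suc
    using V.finprod_insert[of "{..<l}" l "\<lambda>j. f j \<odot>\<^bsub>free_module ZT k\<^esub> v j"] mem by simp
  moreover have "lincomb (free_module ZT k) l f v i = (\<Oplus>\<^bsub>ZT\<^esub>j\<in>{..<l}. f j \<otimes>\<^bsub>ZT\<^esub> v j i)"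
    using Suc by (intro Suc.IH) auto
  moreover have "(\<Oplus>\<^bsub>ZT\<^esub>j\<in>{..<Suc l}. f j \<otimes>\<^bsub>ZT\<^esub> v j i) =
      f l \<otimes>\<^bsub>ZT\<^esub> v l i \<oplus>\<^bsub>ZT\<^esub> (\<Oplus>\<^bsub>ZT\<^esub>j\<in>{..<l}. f j \<otimes>\<^bsub>ZT\<^esub> v j i)"
    unfolding lessThan_Suc using Suc.prems(1) vi
    by (intro A.R.finsum_insert) (auto simp: Pi_iff)
  ultimately show ?case
    using assms(3) by (simp add: free_module_def)
qed

end

section \<open>Expanding relators\<close>

text \<open>Pigeonhole: there are \<open>length xs + 1\<close> consecutive intervals of width
  \<open>r\<close> above \<open>b\<close>, and at most \<open>length xs\<close> values of
  \<open>h\<close> to meet them.\<close>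

lemma gap_exists:
  fixes h :: "'a \<Rightarrow> nat" and b r :: nat
  obtains k where "k \<le> length xs" "\<And>x. x \<in> set xs \<Longrightarrow> h x \<le> b + r * k \<or> b + r * Suc k < h x"
proof -
  have "\<exists>k\<le>length xs. \<forall>x\<in>set xs. h x \<le> b + r * k \<or> b + r * Suc k < h x"
  proof (rule ccontr)
    assume "\<not> ?thesis"
    then have "\<forall>k\<in>{..length xs}. \<exists>x\<in>set xs. b + r * k < h x \<and> h x \<le> b + r * Suc k"
      by (metis atMost_iff linorder_not_le)
    then obtain f where f: "\<And>k. k \<le> length xs \<Longrightarrow> f k \<in> set xs \<and> b + r * k < h (f k) \<and> h (f k) \<le> b + r * Suc k"
      by (metis atMost_iff)
    have lt: "h (f j) < h (f k)" if "j < k" "k \<le> length xs" for j k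
    proof -
      have "h (f j) \<le> b + r * Suc j" using f[of j] that by auto
      also have "\<dots> \<le> b + r * k" using that by (intro add_left_mono mult_le_mono2) simp
      also have "\<dots> < h (f k)" using f[of k] that by auto
      finally show ?thesis .
    qed
    have "inj_on f {..length xs}"
    proof (rule inj_onI)
      fix j k assume "j \<in> {..length xs}" "k \<in> {..length xs}" "f j = f k"
      then show "j = k" using lt[of j k] lt[of k j] by (cases j k rule: linorder_cases) auto
    qed
    \<comment> \<open>Witnesses from different intervals are distinct, and there is one witness more
      than the list has entries.\<close>
    then have "card {..length xs} \<le> card (set xs)"
      using f by (intro card_inj_on_le[of f]) auto
    then show False
      using card_length[of xs] by simp
  qed
  then show ?thesis using that by blast
qed

context group_ring_module
begin

definition shift :: "'t \<Rightarrow> ('t \<times> nat \<times> bool) list \<Rightarrow> ('t \<times> nat \<times> bool) list" where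
  "shift u xs = map (\<lambda>(v, i, p). (v \<otimes>\<^bsub>T\<^esub> u, i, p)) xs"

text \<open>A formal sum of translated relations becomes a formal sum of translated generators, with
  no cancellation performed. Negative terms use \<open>negate\<close>, so that \<open>lword\<close>
  inverts the relator word.\<close>

primrec expand :: "(nat \<Rightarrow> ('t \<times> nat \<times> bool) list) \<Rightarrow> ('t \<times> nat \<times> bool) list \<Rightarrow> ('t \<times> nat \<times> bool) list" where
  "expand F [] = []"
| "expand F (x # xs) = (if snd (snd x) then shift (fst x) (F (fst (snd x)))
     else negate (shift (fst x) (F (fst (snd x))))) @ expand F xs"

lemma valid_shift: "valid k xs \<Longrightarrow> u \<in> carrier T \<Longrightarrow> valid k (shift u xs)"
  by (auto simp: valid_def shift_def)

lemma valid_negate: "valid k xs \<Longrightarrow> valid k (negate xs)"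
  by (auto simp: valid_def negate_def)

lemma valid_append [simp]: "valid k (xs @ ys) \<longleftrightarrow> valid k xs \<and> valid k ys"
  by (auto simp: valid_def)

lemma valid_Cons [simp]: "valid k ((u, i, p) # xs) \<longleftrightarrow> u \<in> carrier T \<and> i < k \<and> valid k xs"
  by (auto simp: valid_def)

lemma valid_Nil [simp]: "valid k []"
  by (simp add: valid_def)

lemma valid_expand:
  "(\<And>j. j < l \<Longrightarrow> valid k (F j)) \<Longrightarrow> valid l rs \<Longrightarrow> valid k (expand F rs)"
  by (induction rs) (auto simp: valid_shift valid_negate split_paired_all)

lemma signed_count_shift:
  assumes "u \<in> carrier T" "valid k xs"
  shows "signed_count (shift u xs) i = of_elem u \<otimes>\<^bsub>ZT\<^esub> signed_count xs i"
  using assms(2)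
proof (induction xs)
  case Nil
  show ?case using assms(1) by (simp add: shift_def ZT_zero[symmetric] of_elem_closed)
next
  case (Cons x xs)
  obtain v j p where x: "x = (v, j, p)" by (rule prod_cases3)
  then have v: "v \<in> carrier T" "valid k xs" using Cons by auto
  have "signed_count (shift u (x # xs)) i =
      (if i = j then unit_elem (v \<otimes>\<^bsub>T\<^esub> u) p else \<zero>\<^bsub>ZT\<^esub>) \<oplus>\<^bsub>ZT\<^esub> signed_count (shift u xs) i"
    using signed_count_Cons[of "v \<otimes>\<^bsub>T\<^esub> u" j p "shift u xs" i] assms(1) v by (simp add: x shift_def)
  also have "\<dots> = of_elem u \<otimes>\<^bsub>ZT\<^esub> (if i = j then unit_elem v p else \<zero>\<^bsub>ZT\<^esub>) \<oplus>\<^bsub>ZT\<^esub> of_elem u \<otimes>\<^bsub>ZT\<^esub> signed_count xs i"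
    using Cons v assms(1) of_elem_unit_elem[of u v p] T.m_comm[of u v] by (simp add: of_elem_closed)
  also have "\<dots> = of_elem u \<otimes>\<^bsub>ZT\<^esub> signed_count (x # xs) i"
    using v assms(1) signed_count_closed[OF v(2), of i]
    by (simp add: x signed_count_Cons of_elem_closed A.R.r_distr del: signed_count.simps)
  finally show ?case .
qed

lemma signed_count_negate_ring: "valid k xs \<Longrightarrow> signed_count (negate xs) i = \<ominus>\<^bsub>ZT\<^esub> signed_count xs i"
  using signed_count_closed[of k xs i] by (simp add: ZT_minus signed_count_negate fun_eq_iff)

lemma signed_count_append_ring:
  "signed_count (xs @ ys) i = signed_count xs i \<oplus>\<^bsub>ZT\<^esub> signed_count ys i"
  by (simp add: signed_count_append ZT_add)

text \<open>Expansion multiplies the coefficient vector of \<open>rs\<close> by the matrix of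
  coefficients of the relations.\<close>

lemma signed_count_expand:
  assumes "\<And>j. j < l \<Longrightarrow> valid k (F j)" "valid l rs"
  shows "signed_count (expand F rs) i = (\<Oplus>\<^bsub>ZT\<^esub>j\<in>{..<l}. signed_count rs j \<otimes>\<^bsub>ZT\<^esub> signed_count (F j) i)"
  using assms(2)
proof (induction rs)
  case Nil
  have "(\<Oplus>\<^bsub>ZT\<^esub>j\<in>{..<l}. \<zero>\<^bsub>ZT\<^esub> \<otimes>\<^bsub>ZT\<^esub> signed_count (F j) i) = (\<Oplus>\<^bsub>ZT\<^esub>j\<in>{..<l}. \<zero>\<^bsub>ZT\<^esub>)"
    using signed_count_closed[OF assms(1)] by (intro A.R.finsum_cong') auto
  also have "\<dots> = \<zero>\<^bsub>ZT\<^esub>"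
    by simp
  finally show ?case by (simp add: ZT_zero)
next
  case (Cons x rs)
  obtain u j p where x: "x = (u, j, p)" by (rule prod_cases3)
  then have u: "u \<in> carrier T" "j < l" "valid l rs" using Cons by auto
  have F: "signed_count (F j) i \<in> carrier ZT" if "j < l" for j
    using signed_count_closed assms(1) that by blast
  have rs: "signed_count rs j \<in> carrier ZT" for j
    using signed_count_closed u by blast
  have "signed_count (if p then shift u (F j) else negate (shift u (F j))) i =
      unit_elem u p \<otimes>\<^bsub>ZT\<^esub> signed_count (F j) i"
    using u assms(1) F
    by (simp add: signed_count_negate_ring[of k] signed_count_shift[of _ k] valid_shift unit_elem_def
        A.R.l_minus of_elem_closed)
  \<comment> \<open>The contribution of a single term is spread over all relations by a delta, so
    that it can be added to the sum for \<open>rs\<close>.\<close>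
  also have "\<dots> = (\<Oplus>\<^bsub>ZT\<^esub>j'\<in>{..<l}. if j' = j then unit_elem u p \<otimes>\<^bsub>ZT\<^esub> signed_count (F j) i else \<zero>\<^bsub>ZT\<^esub>)"
    using A.R.add.finprod_delta[of "{..<l}" j "unit_elem u p \<otimes>\<^bsub>ZT\<^esub> signed_count (F j) i"] u F
    by (simp add: finsum_def)
  also have "\<dots> = (\<Oplus>\<^bsub>ZT\<^esub>j'\<in>{..<l}. (if j' = j then unit_elem u p else \<zero>\<^bsub>ZT\<^esub>) \<otimes>\<^bsub>ZT\<^esub> signed_count (F j') i)"
    using u F by (intro A.R.finsum_cong') auto
  finally have head: "signed_count (if p then shift u (F j) else negate (shift u (F j))) i =
      (\<Oplus>\<^bsub>ZT\<^esub>j'\<in>{..<l}. (if j' = j then unit_elem u p else \<zero>\<^bsub>ZT\<^esub>) \<otimes>\<^bsub>ZT\<^esub> signed_count (F j') i)" .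
  have "signed_count (expand F (x # rs)) i =
      (\<Oplus>\<^bsub>ZT\<^esub>j'\<in>{..<l}. (if j' = j then unit_elem u p else \<zero>\<^bsub>ZT\<^esub>) \<otimes>\<^bsub>ZT\<^esub> signed_count (F j') i) \<oplus>\<^bsub>ZT\<^esub>
      (\<Oplus>\<^bsub>ZT\<^esub>j\<in>{..<l}. signed_count rs j \<otimes>\<^bsub>ZT\<^esub> signed_count (F j) i)"
    by (simp only: x expand.simps fst_conv snd_conv signed_count_append_ring head Cons.IH[OF u(3)])
  also have "\<dots> = (\<Oplus>\<^bsub>ZT\<^esub>j'\<in>{..<l}. (if j' = j then unit_elem u p else \<zero>\<^bsub>ZT\<^esub>) \<otimes>\<^bsub>ZT\<^esub> signed_count (F j') i \<oplus>\<^bsub>ZT\<^esub>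
      signed_count rs j' \<otimes>\<^bsub>ZT\<^esub> signed_count (F j') i)"
    using u F rs by (intro A.R.finsum_addf[symmetric]) auto
  also have "\<dots> = (\<Oplus>\<^bsub>ZT\<^esub>j'\<in>{..<l}. signed_count (x # rs) j' \<otimes>\<^bsub>ZT\<^esub> signed_count (F j') i)"
  proof (rule A.R.finsum_cong')
    fix j' assume j': "j' \<in> {..<l}"
    have "signed_count (x # rs) j' = (if j' = j then unit_elem u p else \<zero>\<^bsub>ZT\<^esub>) \<oplus>\<^bsub>ZT\<^esub> signed_count rs j'"
      unfolding x by (rule signed_count_Cons[OF u(1)])
    then show "(if j' = j then unit_elem u p else \<zero>\<^bsub>ZT\<^esub>) \<otimes>\<^bsub>ZT\<^esub> signed_count (F j') i \<oplus>\<^bsub>ZT\<^esub>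
        signed_count rs j' \<otimes>\<^bsub>ZT\<^esub> signed_count (F j') i = signed_count (x # rs) j' \<otimes>\<^bsub>ZT\<^esub> signed_count (F j') i"
      using j' u F rs by (simp add: A.R.l_distr del: signed_count.simps)
  next
    have "valid l (x # rs)" using u x by simp
    then show "(\<lambda>j'. signed_count (x # rs) j' \<otimes>\<^bsub>ZT\<^esub> signed_count (F j') i) \<in> {..<l} \<rightarrow> carrier ZT"
      using F signed_count_closed by blast
  qed simp
  finally show ?case .
qed

lemma set_expand:
  "(v, i, p) \<in> set (expand F rs) \<Longrightarrow>
    \<exists>u j q w p'. (u, j, q) \<in> set rs \<and> (w, i, p') \<in> set (F j) \<and> v = w \<otimes>\<^bsub>T\<^esub> u"
proof (induction rs)
  case (Cons x rs)
  obtain u j q where x: "x = (u, j, q)" by (rule prod_cases3)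
  show ?case
  proof (cases "(v, i, p) \<in> set (expand F rs)")
    case True
    then show ?thesis using Cons.IH by (meson list.set_intros(2))
  next
    case False
    then obtain w p' where "(w, i, p') \<in> set (F j)" "v = w \<otimes>\<^bsub>T\<^esub> u"
      using Cons.prems by (auto simp: x shift_def negate_def split: if_splits)
    then show ?thesis
      by (intro exI[of _ u] exI[of _ j] exI[of _ q] exI[of _ w] exI[of _ p']) (simp add: x)
  qed
qed simp

lemma length_expand:
  "(\<And>j. j < l \<Longrightarrow> length (F j) \<le> b) \<Longrightarrow> valid l rs \<Longrightarrow> length (expand F rs) \<le> b * length rs"
proof (induction rs)
  case (Cons x rs)
  obtain u j q where x: "x = (u, j, q)" by (rule prod_cases3)
  then have "length (F j) \<le> b" "length (expand F rs) \<le> b * length rs"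
    using Cons by auto
  then show ?case by (simp add: x shift_def)
qed simp

lemma signed_count_expand_filter:
  "signed_count (expand F rs) i u =
    signed_count (expand F (filter P rs)) i u + signed_count (expand F (filter (\<lambda>x. \<not> P x) rs)) i u"
  by (induction rs) (auto simp: signed_count_append)

lemma lincomb_expand:
  assumes "\<And>j. j < l \<Longrightarrow> valid k (F j)" "valid l rs"
    and "v \<in> {..<l} \<rightarrow> carrier (free_module ZT k)"
    and "\<And>j i. j < l \<Longrightarrow> i < k \<Longrightarrow> signed_count (F j) i = v j i" "i < k"
  shows "lincomb (free_module ZT k) l (signed_count rs) v i = signed_count (expand F rs) i"
proof -
  have F: "signed_count (F j) i \<in> carrier ZT" if "j < l" for j
    using signed_count_closed assms(1) that by blast
  have rs: "signed_count rs j \<in> carrier ZT" for j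
    using signed_count_closed assms(2) by blast
  have "lincomb (free_module ZT k) l (signed_count rs) v i = (\<Oplus>\<^bsub>ZT\<^esub>j\<in>{..<l}. signed_count rs j \<otimes>\<^bsub>ZT\<^esub> v j i)"
    using assms rs by (intro lincomb_free_module_apply) auto
  also have "\<dots> = (\<Oplus>\<^bsub>ZT\<^esub>j\<in>{..<l}. signed_count rs j \<otimes>\<^bsub>ZT\<^esub> signed_count (F j) i)"
    using assms rs F by (intro A.R.finsum_cong') auto
  also have "\<dots> = signed_count (expand F rs) i"
    using assms by (intro signed_count_expand[symmetric]) auto
  finally show ?thesis .
qed

end

section \<open>Formal sums evaluated in the metabelian group\<close>

context metabelian_lift
begin

lemma a_closed: "a \<in> {..<m} \<rightarrow> carrier A"
  using \<alpha>_closed \<beta> by (metis Pi_I lessThan_iff)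

lemma \<alpha>_letter: "i < m \<Longrightarrow> \<alpha> (letter i p) = (if p then a i else \<ominus>\<^bsub>A\<^esub> a i)"
  by (simp add: letter_def \<beta> \<alpha>_inv)

text \<open>A conjugator acts on the module only through its image under
  \<open>\<rho>\<close>.\<close>

lemma \<alpha>_tword:
  assumes "set ys \<subseteq> carrier M \<times> {..<m} \<times> UNIV"
  shows "\<alpha> (tword ys) = lincomb A m (signed_count (map (\<lambda>(y, i, p). (\<rho> y, i, p)) ys)) a"
  using assms
proof (induction ys)
  case Nil
  then show ?case using lincomb_signed_count_Nil[OF a_closed] \<alpha>_one by simp
next
  case (Cons x ys)
  obtain y i p where x: "x = (y, i, p)" by (rule prod_cases3)
  then have y: "y \<in> carrier M" "i < m" "set ys \<subseteq> carrier M \<times> {..<m} \<times> UNIV"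
    using Cons by auto
  have "valid m (map (\<lambda>(y, i, p). (\<rho> y, i, p)) (x # ys))"
    using y x by (auto simp: valid_def)
  then have "lincomb A m (signed_count (map (\<lambda>(y, i, p). (\<rho> y, i, p)) (x # ys))) a =
      (unit_elem (\<rho> y) p \<odot>\<^bsub>A\<^esub> a i) \<oplus>\<^bsub>A\<^esub> \<alpha> (tword ys)"
    using lincomb_signed_count_Cons[OF _ a_closed] Cons.IH[OF y(3)] x
    by (simp del: signed_count.simps)
  moreover have "a i \<in> carrier A"
    using a_closed y by auto
  then have "unit_elem (\<rho> y) p \<odot>\<^bsub>A\<^esub> a i = of_elem (\<rho> y) \<odot>\<^bsub>A\<^esub> \<alpha> (letter i p)"
    using y by (simp add: unit_elem_def \<alpha>_letter A.smult_l_minus A.smult_r_minus of_elem_closed)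
  moreover have "\<alpha> (tword (x # ys)) = \<alpha> (cj y (letter i p)) \<oplus>\<^bsub>A\<^esub> \<alpha> (tword ys)"
    using y tword_closed[OF y(3)] \<rho>_tword[OF y(3)] x by (simp add: \<alpha>_mult_one)
  ultimately show ?case
    using y by (simp add: \<alpha>_cj)
qed

lemma terms_valid: "set xs \<subseteq> terms N \<Longrightarrow> valid m xs"
  by (auto simp: terms_def valid_def)

lemma lword_closed_valid: "valid m xs \<Longrightarrow> lword xs \<in> carrier M"
  by (induction xs) (auto simp: split_paired_all)

lemma \<rho>_\<alpha>_lword:
  assumes "set xs \<subseteq> terms N"
  shows "\<rho> (lword xs) = \<one>\<^bsub>T\<^esub>" "\<alpha> (lword xs) = lincomb A m (signed_count xs) a"
proof -
  let ?ys = "map (\<lambda>(u, i, p). (lift u, i, p)) xs"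
  have ys: "set ?ys \<subseteq> carrier M \<times> {..<m} \<times> UNIV"
    using assms by (auto simp: terms_def)
  have "map (\<lambda>(y, i, p). (\<rho> y, i, p)) ?ys = xs"
    using assms by (intro nth_equalityI) (auto simp: terms_def \<rho>_lift case_prod_unfold dest!: nth_mem)
  then show "\<rho> (lword xs) = \<one>\<^bsub>T\<^esub>" "\<alpha> (lword xs) = lincomb A m (signed_count xs) a"
    using \<rho>_tword[OF ys] \<alpha>_tword[OF ys] by (simp_all add: lword_def)
qed

text \<open>Exchanging one conjugator costs \<open>2 * k\<close> by \<open>near_cj_left\<close>, and
  the costs add over the factors.\<close>

lemma near_tword:
  assumes "\<And>y i p. (y, i, p) \<in> set ys \<Longrightarrow> i < m \<and> f y \<in> carrier M \<and> g y \<in> carrier M \<and> near k (f y) (g y)"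
  shows "near (2 * k * length ys) (tword (map (\<lambda>(y, i, p). (f y, i, p)) ys))
    (tword (map (\<lambda>(y, i, p). (g y, i, p)) ys))"
  using assms
proof (induction ys)
  case (Cons x ys)
  obtain y i p where x: "x = (y, i, p)" by (rule prod_cases3)
  then have y: "i < m" "f y \<in> carrier M" "g y \<in> carrier M" "near k (f y) (g y)"
    using Cons.prems by auto
  have cl: "tword (map (\<lambda>(y, i, p). (f y, i, p)) ys) \<in> carrier M"
    "tword (map (\<lambda>(y, i, p). (g y, i, p)) ys) \<in> carrier M"
    using Cons.prems by (fastforce intro!: tword_closed)+
  have IH: "near (2 * k * length ys) (tword (map (\<lambda>(y, i, p). (f y, i, p)) ys))
      (tword (map (\<lambda>(y, i, p). (g y, i, p)) ys))"
    by (rule Cons.IH, rule Cons.prems, rule list.set_intros(2))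
  have "near (2 * k + 2 * k * length ys)
      (cj (f y) (letter i p) \<otimes> tword (map (\<lambda>(y, i, p). (f y, i, p)) ys))
      (cj (g y) (letter i p) \<otimes> tword (map (\<lambda>(y, i, p). (g y, i, p)) ys))"
    using y cl by (intro near_mult[OF near_cj_left[OF y(4)] IH]) auto
  then show ?case by (simp add: x)
qed (simp add: near_refl)

text \<open>Height is subadditive up to a constant, because a product of lifts is collected to the
  lift of the product.\<close>

lemma height_bounds:
  obtains c where "\<And>u v. u \<in> carrier T \<Longrightarrow> v \<in> carrier T \<Longrightarrow> height (v \<otimes>\<^bsub>T\<^esub> u) \<le> height v + height u + c"
    "\<And>u v. u \<in> carrier T \<Longrightarrow> v \<in> carrier T \<Longrightarrow> height u \<le> height (v \<otimes>\<^bsub>T\<^esub> u) + height v + c"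
proof -
  obtain c where "\<And>n x. tball n x \<Longrightarrow> near (c * Suc n * Suc n) x (lift (\<rho> x))"
    and c: "\<And>n x. tball n x \<Longrightarrow> height (\<rho> x) \<le> n + c"
    by (rule tball_near_lift) (rule that)
  show ?thesis
  proof (rule that[of c])
    fix u v assume uv: "u \<in> carrier T" "v \<in> carrier T"
    show "height (v \<otimes>\<^bsub>T\<^esub> u) \<le> height v + height u + c"
      using c[OF word_ball_mult[OF tball_lift tball_lift tset_subset], of v u] uv by (simp add: \<rho>_lift)
    show "height u \<le> height (v \<otimes>\<^bsub>T\<^esub> u) + height v + c"
      \<comment> \<open>Recover \<open>u\<close> as the inverse of \<open>v\<close> times the
        product of \<open>v\<close> and \<open>u\<close>.\<close>
      using c[OF word_ball_mult[OF word_ball_inv[OF tball_lift tset_subset] tball_lift tset_subset],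
          of v "v \<otimes>\<^bsub>T\<^esub> u"] uv
      by (simp add: \<rho>_lift)
  qed
qed

text \<open>\<open>lift\<close> need not be multiplicative. Replacing each
  \<open>lift (v \<otimes> u)\<close> by \<open>lift v \<otimes> lift u\<close> has quadratic cost,
  and the result is a conjugate of the fixed word \<open>lword (F j)\<close>, which costs
  \<open>k\<close>.\<close>

lemma near_lword_shift:
  fixes l :: nat
  assumes F: "\<And>j. j < l \<Longrightarrow> set (F j) \<subseteq> terms H" "\<And>j. j < l \<Longrightarrow> near k (lword (F j)) \<one>"
  obtains c where "\<And>N u j. u \<in> carrier T \<Longrightarrow> height u \<le> N \<Longrightarrow> j < l \<Longrightarrow>
    near (c * (Suc N)\<^sup>2) (lword (shift u (F j))) \<one>"
proof -
  obtain c0 where c0: "\<And>n x. tball n x \<Longrightarrow> near (c0 * Suc n * Suc n) x (lift (\<rho> x))"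
    and "\<And>n x. tball n x \<Longrightarrow> height (\<rho> x) \<le> n + c0"
    by (rule tball_near_lift) (rule that)
  define b where "b = (\<Sum>j<l. length (F j))"
  define c where "c = 2 * (c0 * (Suc H * Suc H)) * b + k"
  show ?thesis
  proof (rule that[of c])
    fix N u j assume u: "u \<in> carrier T" "height u \<le> N" "j < l"
    have Fj: "i < m" "v \<in> carrier T" "height v \<le> H" if "(v, i, p) \<in> set (F j)" for v i p
      using F(1)[OF u(3)] that by (auto simp: terms_def)
    define d where "d = c0 * Suc (H + N) * Suc (H + N)"
    have near: "near d (lift v \<otimes> lift u) (lift (v \<otimes>\<^bsub>T\<^esub> u))" if "(v, i, p) \<in> set (F j)" for v i p
    proof -
      have "tball (height v + height u) (lift v \<otimes> lift u)"
        by (intro word_ball_mult tball_lift tset_subset)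
      then have "tball (H + N) (lift v \<otimes> lift u)"
        using Fj[OF that] u by (elim word_ball_mono) simp
      from c0[OF this] show ?thesis
        using Fj[OF that] u by (simp add: d_def \<rho>_lift)
    qed
    have close: "i < m \<and> lift (v \<otimes>\<^bsub>T\<^esub> u) \<in> carrier M \<and> lift v \<otimes> lift u \<in> carrier M \<and>
        near d (lift (v \<otimes>\<^bsub>T\<^esub> u)) (lift v \<otimes> lift u)" if "(v, i, p) \<in> set (F j)" for v i p
      using Fj(1)[OF that] near_sym[OF near[OF that]] by simp
    have 1: "near (2 * d * length (F j)) (tword (map (\<lambda>(v, i, p). (lift (v \<otimes>\<^bsub>T\<^esub> u), i, p)) (F j)))
        (tword (map (\<lambda>(v, i, p). (lift v \<otimes> lift u, i, p)) (F j)))"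
      by (rule near_tword, rule close)
    have 2: "tword (map (\<lambda>(v, i, p). (lift (v \<otimes>\<^bsub>T\<^esub> u), i, p)) (F j)) = lword (shift u (F j))"
      by (simp add: lword_def shift_def case_prod_unfold o_def)
    have "tword (map (\<lambda>(v, i, p). (lift v \<otimes> lift u, i, p)) xs) = cj (lift u) (lword xs)"
      if "valid m xs" for xs
      using that
    proof (induction xs)
      case (Cons x xs)
      obtain v i p where x: "x = (v, i, p)" by (rule prod_cases3)
      then have "i < m" "valid m xs" using Cons.prems by auto
      then show ?case
        using Cons.IH lword_closed_valid[of xs] by (simp add: x cj_mult cj_cj)
    qed simp
    note 3 = this[OF terms_valid[OF F(1)[OF u(3)]]]
    have Fc: "lword (F j) \<in> carrier M" "lword (shift u (F j)) \<in> carrier M"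
      using terms_valid[OF F(1)[OF u(3)]] u(1) lword_closed_valid valid_shift by blast+
    have 4: "near k (cj (lift u) (lword (F j))) \<one>"
      using near_cj[OF F(2)[OF u(3)] Fc(1), of "lift u"] by simp
    have "near (2 * d * length (F j) + k) (lword (shift u (F j))) \<one>"
      using near_trans[OF 1[unfolded 2 3] 4] Fc by simp
    moreover have "2 * d * length (F j) + k \<le> c * (Suc N)\<^sup>2"
    proof -
      \<comment> \<open>The product form separates the constant \<open>H\<close> from the variable
        \<open>N\<close>.\<close>
      have "Suc (H + N) \<le> Suc H * Suc N" by simp
      then have "d \<le> c0 * (Suc H * Suc N) * (Suc H * Suc N)"
        unfolding d_def by (intro mult_le_mono) auto
      moreover have "length (F j) \<le> b"
        unfolding b_def using u(3) by (intro member_le_sum) auto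
      ultimately have "2 * d * length (F j) \<le> 2 * (c0 * (Suc H * Suc N) * (Suc H * Suc N)) * b"
        by (intro mult_le_mono) auto
      moreover have "k * 1 \<le> k * (Suc N)\<^sup>2"
        by (intro mult_le_mono2) simp
      ultimately have "2 * d * length (F j) + k \<le> 2 * (c0 * (Suc H * Suc N) * (Suc H * Suc N)) * b + k * (Suc N)\<^sup>2"
        by linarith
      also have "\<dots> = c * (Suc N)\<^sup>2"
        by (simp only: c_def power2_eq_square add_mult_distrib add_mult_distrib2 mult_ac)
      finally show ?thesis .
    qed
    ultimately show "near (c * (Suc N)\<^sup>2) (lword (shift u (F j))) \<one>"
      by (rule near_mono)
  qed
qed

end

text \<open>The infimum is strictly below \<open>D + 1\<close>, so some expression has norm at most
  \<open>D\<close>.\<close>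

lemma module_area_le:
  assumes "module_area T m l fs f \<le> enat D"
  obtains \<mu> where "\<mu> \<in> {..<l} \<rightarrow> carrier (group_ring T)"
    "f = lincomb (free_module (group_ring T) m) l \<mu> fs" "(\<Sum>j<l. gr_norm (\<mu> j)) \<le> D"
proof -
  have "module_area T m l fs f < enat (Suc D)"
    using assms by (rule le_less_trans) simp
  then show ?thesis
    unfolding module_area_def by (auto simp: Inf_less_iff intro: that)
qed

context group_ring_module
begin

text \<open>The last property requires each \<open>fs j\<close> to be a relation itself, whereas
  \<open>generates\<close> speaks about combinations of them.\<close>

lemma relator_lists:
  assumes gens: "generates ZT (free_module ZT m) (rel_module ZT A m a) l fs"
    and a: "a \<in> {..<m} \<rightarrow> carrier A"
  obtains F where "\<And>j. j < l \<Longrightarrow> valid m (F j)"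
    "\<And>j i. j < l \<Longrightarrow> i < m \<Longrightarrow> signed_count (F j) i = fs j i"
    "\<And>j. j < l \<Longrightarrow> lincomb A m (signed_count (F j)) a = \<zero>\<^bsub>A\<^esub>"
proof -
  have fs: "fs \<in> {..<l} \<rightarrow> carrier (free_module ZT m)"
    using gens by (simp add: generates_def)
  have fsi: "fs j i \<in> carrier ZT" if "j < l" "i < m" for i j
    using fs that by (fastforce simp: free_module_def)
  have "\<exists>xs. valid m xs \<and> (\<forall>i<m. signed_count xs i = fs j i)" if j: "j < l" for j
  proof -
    have supp: "finite (supp (fs j i))" "supp (fs j i) \<subseteq> carrier T" if "i < m" for i
      using fsi[OF j that] by (auto simp: group_ring_def)
    obtain xs where "\<And>u i p. (u, i, p) \<in> set xs \<Longrightarrow> i < m \<and> u \<in> supp (fs j i)"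
      "\<And>i. i < m \<Longrightarrow> signed_count xs i = fs j i"
      using signed_count_exists[of m "fs j", OF supp(1)] by metis
    moreover from this(1) have "valid m xs"
      using supp(2) by (force simp: valid_def)
    ultimately show ?thesis by blast
  qed
  then obtain F where F: "\<And>j. j < l \<Longrightarrow> valid m (F j) \<and> (\<forall>i<m. signed_count (F j) i = fs j i)"
    by metis
  have "lincomb A m (signed_count (F j)) a = \<zero>\<^bsub>A\<^esub>" if j: "j < l" for j
  proof -
    \<comment> \<open>The unit coefficient vector recovers \<open>fs j\<close> as one of the
      combinations.\<close>
    define \<delta> where "\<delta> k = (if k = j then \<one>\<^bsub>ZT\<^esub> else \<zero>\<^bsub>ZT\<^esub>)" for k
    define g where "g = lincomb (free_module ZT m) l \<delta> fs"
    have \<delta>: "\<delta> \<in> {..<l} \<rightarrow> carrier ZT"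
      by (simp add: \<delta>_def)
    then have "g \<in> rel_module ZT A m a"
      using gens unfolding generates_def g_def by blast
    then have g: "lincomb A m g a = \<zero>\<^bsub>A\<^esub>"
      by (simp add: rel_module_def)
    have "g i = fs j i" if i: "i < m" for i
    proof -
      have "g i = (\<Oplus>\<^bsub>ZT\<^esub>k\<in>{..<l}. \<delta> k \<otimes>\<^bsub>ZT\<^esub> fs k i)"
        unfolding g_def using \<delta> fs i by (rule lincomb_free_module_apply)
      also have "\<dots> = (\<Oplus>\<^bsub>ZT\<^esub>k\<in>{..<l}. if k = j then fs j i else \<zero>\<^bsub>ZT\<^esub>)"
        using fsi i j by (intro A.R.finsum_cong') (auto simp: \<delta>_def)
      also have "\<dots> = fs j i"
        using A.R.add.finprod_delta[of "{..<l}" j "fs j i"] fsi i j by (simp add: finsum_def)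
      finally show ?thesis .
    qed
    then have "lincomb A m (signed_count (F j)) a = lincomb A m g a"
      unfolding lincomb_def using F[OF j] fsi[OF j] a
      by (intro A.M.finsum_cong') (auto simp: Pi_iff)
    then show ?thesis using g by simp
  qed
  then show ?thesis using that F by blast
qed

end

context metabelian_lift
begin

lemma valid_terms:
  assumes "valid m xs"
  obtains N where "set xs \<subseteq> terms N"
proof
  show "set xs \<subseteq> terms (\<Sum>x\<in>set xs. height (fst x))"
  proof
    fix x assume x: "x \<in> set xs"
    then have "height (fst x) \<le> (\<Sum>x\<in>set xs. height (fst x))"
      by (intro member_le_sum) auto
    then show "x \<in> terms (\<Sum>x\<in>set xs. height (fst x))"
      using assms x by (cases x) (auto simp: valid_def terms_def)
  qed
qed

lemma lword_append_valid:
  assumes "valid m xs" "valid m ys"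
  shows "lword (xs @ ys) = lword xs \<otimes> lword ys"
proof -
  obtain N where "set (xs @ ys) \<subseteq> terms N"
    using valid_terms[of "xs @ ys"] assms by auto
  then show ?thesis by (auto intro: lword_append)
qed

lemma lword_negate_valid: "valid m xs \<Longrightarrow> lword (negate xs) = inv (lword xs)"
  by (elim valid_terms) (rule lword_negate)

lemma near_lword_expand:
  fixes l :: nat
  assumes F: "\<And>j. j < l \<Longrightarrow> set (F j) \<subseteq> terms H" "\<And>j. j < l \<Longrightarrow> near k (lword (F j)) \<one>"
  obtains c where "\<And>N rs. valid l rs \<Longrightarrow> (\<And>x. x \<in> set rs \<Longrightarrow> height (fst x) \<le> N) \<Longrightarrow>
    near (c * (Suc N)\<^sup>2 * length rs) (lword (expand F rs)) \<one>"
proof -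
  obtain c where c: "\<And>N u j. u \<in> carrier T \<Longrightarrow> height u \<le> N \<Longrightarrow> j < l \<Longrightarrow>
    near (c * (Suc N)\<^sup>2) (lword (shift u (F j))) \<one>"
    by (rule near_lword_shift[of l F H k, OF F]) (assumption | rule that)+
  have "near (c * (Suc N)\<^sup>2 * length rs) (lword (expand F rs)) \<one>"
    if "valid l rs" "\<And>x. x \<in> set rs \<Longrightarrow> height (fst x) \<le> N" for N rs
    using that
  proof (induction rs)
    case (Cons x rs)
    obtain u j p where x: "x = (u, j, p)" by (rule prod_cases3)
    then have u: "u \<in> carrier T" "j < l" "valid l rs" "height u \<le> N"
      using Cons.prems(1) Cons.prems(2)[of x] by auto
    have F_valid: "valid m (F j)" if "j < l" for j
      by (rule terms_valid[OF F(1)[OF that]])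
    have v: "valid m (shift u (F j))" "valid m (expand F rs)"
      by (rule valid_shift[OF F_valid[OF u(2)] u(1)]) (rule valid_expand[OF F_valid u(3)])
    let ?y = "if p then shift u (F j) else negate (shift u (F j))"
    have vy: "valid m ?y"
      using v valid_negate by auto
    have cl: "lword (shift u (F j)) \<in> carrier M" "lword (expand F rs) \<in> carrier M" "lword ?y \<in> carrier M"
      by (rule lword_closed_valid[OF v(1)], rule lword_closed_valid[OF v(2)], rule lword_closed_valid[OF vy])
    have 0: "near (c * (Suc N)\<^sup>2) (lword (shift u (F j))) \<one>"
      using u(1,4,2) by (rule c)
    have 1: "near (c * (Suc N)\<^sup>2) (lword ?y) \<one>"
      using 0 near_inv[OF 0] cl v by (simp add: lword_negate_valid)
    have 2: "near (c * (Suc N)\<^sup>2 * length rs) (lword (expand F rs)) \<one>"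
      using u Cons by simp
    have "near (c * (Suc N)\<^sup>2 + c * (Suc N)\<^sup>2 * length rs) (lword ?y \<otimes> lword (expand F rs)) \<one>"
      using near_mult[OF 1 2] cl by simp
    moreover have "lword (expand F (x # rs)) = lword ?y \<otimes> lword (expand F rs)"
      using lword_append_valid[OF vy v(2)] by (simp only: x expand.simps fst_conv snd_conv)
    ultimately show ?case by simp
  qed (simp add: near_refl)
  then show ?thesis using that by blast
qed

text \<open>The terms of \<open>rs\<close> far away from the support of \<open>ts\<close> can be dropped: by pigeonhole the heights
  in \<open>rs\<close> avoid some wide interval, and the terms above it cannot interact with those below.\<close>

lemma expand_truncate:
  fixes l :: nat
  assumes F: "\<And>j. j < l \<Longrightarrow> set (F j) \<subseteq> terms H"
  obtains r where "\<And>b ts rs. set ts \<subseteq> terms b \<Longrightarrow> valid l rs \<Longrightarrow>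
    signed_count (expand F rs) = signed_count ts \<Longrightarrow>
    \<exists>rs'. valid l rs' \<and> length rs' \<le> length rs \<and>
      (\<forall>x\<in>set rs'. height (fst x) \<le> b + r * length rs) \<and>
      set (expand F rs') \<subseteq> terms (b + r * length rs + r) \<and>
      signed_count (expand F rs') = signed_count ts"
proof -
  obtain c where c: "\<And>u v. u \<in> carrier T \<Longrightarrow> v \<in> carrier T \<Longrightarrow> height (v \<otimes>\<^bsub>T\<^esub> u) \<le> height v + height u + c"
    "\<And>u v. u \<in> carrier T \<Longrightarrow> v \<in> carrier T \<Longrightarrow> height u \<le> height (v \<otimes>\<^bsub>T\<^esub> u) + height v + c"
    by (rule height_bounds) (rule that)
  \<comment> \<open>Translating by a term of some \<open>F j\<close> changes the height by at most
    \<open>q\<close> in either direction.\<close>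
  define q where "q = H + c"
  show ?thesis
  \<comment> \<open>A gap of width \<open>2 * q\<close> leaves the height \<open>N + q\<close> as a
    dividing line even after both sides have moved by \<open>q\<close>.\<close>
  proof (rule that[of "2 * q"])
    fix b ts rs
    assume ts: "set ts \<subseteq> terms b" and rs: "valid l rs"
      and eq: "signed_count (expand F rs) = signed_count ts"
    obtain k where k: "k \<le> length rs"
      "\<And>x. x \<in> set rs \<Longrightarrow> height (fst x) \<le> b + 2 * q * k \<or> b + 2 * q * Suc k < height (fst x)"
      using gap_exists[of rs "height \<circ> fst" b "2 * q"] by auto
    define N where "N = b + 2 * q * k"
    define lo where "lo = filter (\<lambda>x. height (fst x) \<le> N) rs"
    define hi where "hi = filter (\<lambda>x. \<not> height (fst x) \<le> N) rs"
    have valid: "valid l lo" "valid l hi"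
      using rs by (auto simp: valid_def lo_def hi_def)
    have F': "w \<in> carrier T" "height w \<le> H" "i < m" if "(w, i, p) \<in> set (F j)" "j < l" for w i p j
      using F[OF that(2)] that(1) by (auto simp: terms_def)
    have low: "height v \<le> N + q \<and> v \<in> carrier T \<and> i < m" if v: "(v, i, p) \<in> set (expand F lo)" for v i p
    proof -
      obtain u j p1 w p2 where *: "(u, j, p1) \<in> set lo" "(w, i, p2) \<in> set (F j)" "v = w \<otimes>\<^bsub>T\<^esub> u"
        using set_expand[OF v] by blast
      then have "u \<in> carrier T" "j < l" "height u \<le> N"
        using valid(1) by (auto simp: valid_def lo_def)
      then show ?thesis
        using c(1)[of u w] F'[OF *(2)] * by (simp add: q_def)
    qed
    have high: "N + q < height v" if v: "(v, i, p) \<in> set (expand F hi)" for v i p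
    proof -
      obtain u j p1 w p2 where *: "(u, j, p1) \<in> set hi" "(w, i, p2) \<in> set (F j)" "v = w \<otimes>\<^bsub>T\<^esub> u"
        using set_expand[OF v] by blast
      then have "u \<in> carrier T" "j < l"
        using valid(2) by (auto simp: valid_def)
      moreover have "N + 2 * q < height u"
        using * k(2)[of "(u, j, p1)"] by (auto simp: hi_def N_def algebra_simps)
      ultimately show ?thesis
        using c(2)[of u w] F'[OF *(2)] * by (simp add: q_def)
    qed
    \<comment> \<open>Up to height \<open>N + q\<close> the expansion of \<open>hi\<close> vanishes.
      Above it, the expansion of \<open>lo\<close> and the list \<open>ts\<close> both
      vanish.\<close>
    have "signed_count (expand F lo) i v = signed_count ts i v" for i v
    proof -
      have split: "signed_count ts i v = signed_count (expand F lo) i v + signed_count (expand F hi) i v"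
        unfolding eq[symmetric] lo_def hi_def by (rule signed_count_expand_filter)
      show ?thesis
      proof (cases "height v \<le> N + q")
        case True
        then have "signed_count (expand F hi) i v = 0"
          using signed_count_support[of "expand F hi" i v] high by fastforce
        then show ?thesis using split by simp
      next
        case False
        then have "signed_count (expand F lo) i v = 0"
          using signed_count_support[of "expand F lo" i v] low by fastforce
        moreover have "signed_count ts i v = 0"
          using signed_count_support[of ts i v] ts False by (fastforce simp: terms_def N_def)
        ultimately show ?thesis by simp
      qed
    qed
    then have sc: "signed_count (expand F lo) = signed_count ts"
      by blast
    have Nle: "N \<le> b + 2 * q * length rs"
      unfolding N_def using k(1) by (intro add_left_mono mult_le_mono2)
    have "set (expand F lo) \<subseteq> terms (b + 2 * q * length rs + 2 * q)"
      using low Nle by (fastforce simp: terms_def)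
    moreover have "\<forall>x\<in>set lo. height (fst x) \<le> b + 2 * q * length rs"
      using Nle by (auto simp: lo_def)
    moreover have "length lo \<le> length rs"
      by (simp add: lo_def)
    ultimately show "\<exists>rs'. valid l rs' \<and> length rs' \<le> length rs \<and>
      (\<forall>x\<in>set rs'. height (fst x) \<le> b + 2 * q * length rs) \<and>
      set (expand F rs') \<subseteq> terms (b + 2 * q * length rs + 2 * q) \<and>
      signed_count (expand F rs') = signed_count ts"
      using valid(1) sc by blast
  qed
qed

section \<open>Separating the two kinds of letters\<close>

lemma gens_subset: "tset \<union> \<beta> ` {..<m} \<subseteq> carrier M"
  using tset_subset \<beta> by auto

text \<open>A module letter passes the prefix \<open>z\<close> by the identity
  \<open>letter i p \<otimes> z = z \<otimes> cj z (letter i p)\<close>, which is exact in the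
  group, so no relator is spent.\<close>

lemma collect_letters:
  assumes "word_ball M (tset \<union> \<beta> ` {..<m}) L x"
  shows "\<exists>z ys. tball L z \<and> x = z \<otimes> tword ys \<and> length ys \<le> L \<and>
    (\<forall>(y, i, p)\<in>set ys. i < m \<and> tball L y)"
  using assms
proof (induction rule: word_ball.induct)
  case (one n)
  then show ?case by (intro exI[of _ \<one>] exI[of _ "[]"]) (auto simp: word_ball.one)
next
  have step: "\<exists>z' ys'. tball (Suc n) z' \<and> h \<otimes> (z \<otimes> tword ys) = z' \<otimes> tword ys' \<and> length ys' \<le> Suc n \<and>
      (\<forall>(y, i, p)\<in>set ys'. i < m \<and> tball (Suc n) y)"
    if *: "tball n z" "length ys \<le> n" "\<forall>(y, i, p)\<in>set ys. i < m \<and> tball n y"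
      and h: "tball 1 h \<or> (\<exists>i<m. \<exists>p. h = letter i p)" for n h z ys
  proof -
    have z: "z \<in> carrier M" using * tball_closed by blast
    have "set ys \<subseteq> carrier M \<times> {..<m} \<times> UNIV"
      using *(3) tball_closed by fast
    then have W: "tword ys \<in> carrier M" by (rule tword_closed)
    have mono: "tball (Suc n) y" if "tball n y" for y
      using that by (rule word_ball_mono) simp
    from h show ?thesis
    proof (elim disjE exE conjE)
      assume h: "tball 1 h"
      then have "tball (Suc n) (h \<otimes> z)"
        using word_ball_mult[OF h *(1) tset_subset] by simp
      then show ?thesis
        using * mono z W tball_closed[OF h]
        by (intro exI[of _ "h \<otimes> z"] exI[of _ ys]) (auto simp: m_assoc)
    next
      fix i p assume h: "i < m" "h = letter i p"
      then show ?thesis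
        using * mono z W
        by (intro exI[of _ z] exI[of _ "(z, i, p) # ys"]) (auto simp: cj_def m_assoc)
    qed
  qed
  {
    case (mult n x g)
    then obtain z ys where *: "tball n z" "x = z \<otimes> tword ys" "length ys \<le> n"
      "\<forall>(y, i, p)\<in>set ys. i < m \<and> tball n y" by blast
    have "tball 1 g \<or> (\<exists>i<m. \<exists>p. g = letter i p)"
      using mult.hyps(2)
    proof
      assume "g \<in> \<beta> ` {..<m}"
      then obtain i where "i < m" "g = letter i True" by (auto simp: letter_def)
      then show ?thesis by blast
    qed (simp only: word_ball_gen[OF _ tset_subset] simp_thms)
    then show ?case unfolding *(2) by (rule step[OF *(1,3,4)])
  next
    case (mult_inv n x g)
    then obtain z ys where *: "tball n z" "x = z \<otimes> tword ys" "length ys \<le> n"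
      "\<forall>(y, i, p)\<in>set ys. i < m \<and> tball n y" by blast
    have "tball 1 (inv g) \<or> (\<exists>i<m. \<exists>p. inv g = letter i p)"
      using mult_inv.hyps(2)
    proof
      assume "g \<in> \<beta> ` {..<m}"
      then obtain i where "i < m" "inv g = letter i False" by (auto simp: letter_def)
      then show ?thesis by blast
    qed (simp only: word_ball_gen_inv[OF _ tset_subset] simp_thms)
    then show ?case unfolding *(2) by (rule step[OF *(1,3,4)])
  }
qed

end

section \<open>The cubic bound\<close>

text \<open>On the scale \<open>Q = L + D + 1\<close> the quantities \<open>n\<close>,
  \<open>L\<close>, \<open>D\<close> and \<open>N\<close> are at most linear, so every summand is at
  most cubic.\<close>

lemma cubic_arith:
  fixes c0 k1 c1 c2 b r L D N n :: nat
  assumes "N \<le> L + c0 + r * D + r" "n \<le> L"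
  shows "c0 * Suc L * Suc L + k1 + (2 * (c0 * Suc L * Suc L) * n + (c1 * Suc N * (n + b * D)\<^sup>2 + c2 * (Suc N)\<^sup>2 * D))
    \<le> (c0 + k1 + 2 * c0 + c1 * (1 + c0 + 2 * r) * (1 + b)\<^sup>2 + c2 * (1 + c0 + 2 * r)\<^sup>2) * (L + D + 1) ^ 3"
proof -
  define Q where "Q = L + D + 1"
  define e where "e = 1 + c0 + 2 * r"
  have Q: "Suc L \<le> Q" "n \<le> Q" "D \<le> Q" "1 \<le> Q"
    using assms by (auto simp: Q_def)
  have "L + 1 + (c0 * 1 + r * D + r * 1) \<le> Q + (c0 * Q + r * Q + r * Q)"
    using Q by (intro add_mono mult_le_mono) auto
  then have N: "Suc N \<le> e * Q"
    using assms(1) by (simp add: e_def algebra_simps)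
  have nb: "n + b * D \<le> (1 + b) * Q"
    using add_mono[OF Q(2) mult_le_mono2[OF Q(3), of b]] by simp
  have "c0 * Suc L * Suc L * 1 \<le> c0 * Q * Q * Q"
    using Q by (intro mult_le_mono) auto
  moreover have "k1 * (1 * 1 * 1) \<le> k1 * (Q * Q * Q)"
    using Q by (intro mult_le_mono) auto
  moreover have "2 * (c0 * Suc L * Suc L) * n \<le> 2 * (c0 * Q * Q) * Q"
    using Q by (intro mult_le_mono) auto
  moreover have "c1 * Suc N * (n + b * D)\<^sup>2 \<le> c1 * (e * Q) * ((1 + b) * Q)\<^sup>2"
    using N nb by (intro mult_le_mono power_mono) auto
  moreover have "c2 * (Suc N)\<^sup>2 * D \<le> c2 * (e * Q)\<^sup>2 * Q"
    using N Q by (intro mult_le_mono power_mono) auto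
  moreover have "c0 * Q * Q * Q + k1 * (Q * Q * Q) + (2 * (c0 * Q * Q) * Q + (c1 * (e * Q) * ((1 + b) * Q)\<^sup>2 +
      c2 * (e * Q)\<^sup>2 * Q)) = (c0 + k1 + 2 * c0 + c1 * e * (1 + b)\<^sup>2 + c2 * e\<^sup>2) * Q ^ 3"
    by (simp only: power2_eq_square power3_eq_cube add_mult_distrib add_mult_distrib2 mult_ac)
  ultimately show ?thesis
    unfolding Q_def[symmetric] e_def[symmetric] by linarith
qed

context metabelian_lift
begin

lemma lincomb_cong:
  assumes "\<And>i. i < m \<Longrightarrow> f i = g i" "\<And>i. i < m \<Longrightarrow> g i \<in> carrier ZT"
  shows "lincomb A m f a = lincomb A m g a"
  unfolding lincomb_def using assms a_closed by (intro A.M.finsum_cong') (auto simp: Pi_iff)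

lemma lincomb_free_module_signed_count:
  assumes gens: "generates ZT (free_module ZT m) (rel_module ZT A m a) l fs"
    and F: "\<And>j. j < l \<Longrightarrow> valid m (F j)"
    "\<And>j i. j < l \<Longrightarrow> i < m \<Longrightarrow> signed_count (F j) i = fs j i"
    and rs: "valid l rs" "\<And>j. j < l \<Longrightarrow> signed_count rs j = \<mu> j" and i: "i < m"
  shows "lincomb (free_module ZT m) l \<mu> fs i = signed_count (expand F rs) i"
proof -
  have fs: "fs \<in> {..<l} \<rightarrow> carrier (free_module ZT m)"
    using gens by (simp add: generates_def)
  have sc: "signed_count rs j \<in> carrier ZT" for j
    by (rule signed_count_closed[OF rs(1)])
  have fsi: "fs j i \<in> carrier ZT" if "j < l" for j
    using signed_count_closed[OF F(1)[OF that], of i] F(2)[OF that i] by simp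
  have \<mu>: "\<mu> \<in> {..<l} \<rightarrow> carrier ZT"
    using sc rs(2) by (metis Pi_I lessThan_iff)
  have "lincomb (free_module ZT m) l \<mu> fs i = (\<Oplus>\<^bsub>ZT\<^esub>j\<in>{..<l}. \<mu> j \<otimes>\<^bsub>ZT\<^esub> fs j i)"
    by (rule lincomb_free_module_apply[OF \<mu> fs i])
  also have "\<dots> = (\<Oplus>\<^bsub>ZT\<^esub>j\<in>{..<l}. signed_count rs j \<otimes>\<^bsub>ZT\<^esub> fs j i)"
    using rs(2) sc fsi by (intro A.R.finsum_cong') auto
  also have "\<dots> = lincomb (free_module ZT m) l (signed_count rs) fs i"
    using sc by (intro lincomb_free_module_apply[symmetric] fs i) auto
  also have "\<dots> = signed_count (expand F rs) i"
    using lincomb_expand[OF F(1) rs(1) fs F(2) i] by simp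
  finally show ?thesis .
qed

lemma signed_count_outside: "valid k xs \<Longrightarrow> k \<le> i \<Longrightarrow> signed_count xs i u = 0"
  using signed_count_support[of xs i u] by (fastforce simp: valid_def)

text \<open>The number of translated relations is controlled by the module Dehn function, but their
  heights are not. \<open>expand_truncate\<close> repairs this afterwards.\<close>

lemma relation_expand:
  assumes gens: "generates ZT (free_module ZT m) (rel_module ZT A m a) l fs"
    and F: "\<And>j. j < l \<Longrightarrow> valid m (F j)"
    "\<And>j i. j < l \<Longrightarrow> i < m \<Longrightarrow> signed_count (F j) i = fs j i"
    and ts: "set ts \<subseteq> terms N" "lincomb A m (signed_count ts) a = \<zero>\<^bsub>A\<^esub>"
    and D: "module_dehn T A s t m a l fs ((2 * N + 1) * length ts) \<le> enat D"
  obtains rs where "valid l rs" "length rs \<le> D" "signed_count (expand F rs) = signed_count ts"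
proof -
  have valid_ts: "valid m ts"
    by (rule terms_valid[OF ts(1)])
  \<comment> \<open>Elements of the free module are extensional, hence the restriction to indices
    below \<open>m\<close>.\<close>
  define f where "f = (\<lambda>i\<in>{..<m}. signed_count ts i)"
  have "lincomb A m f a = lincomb A m (signed_count ts) a"
    using signed_count_closed[OF valid_ts] by (intro lincomb_cong) (auto simp: f_def)
  then have f: "f \<in> rel_module ZT A m a"
    using ts(2) signed_count_closed[OF valid_ts] by (auto simp: rel_module_def free_module_def f_def)
  have "module_norm T s t m f \<le> (2 * N + 1) * length ts"
    using ts(1) by (intro module_norm_signed_count) (auto simp: terms_def f_def)
  then have "module_area T m l fs f \<le> module_dehn T A s t m a l fs ((2 * N + 1) * length ts)"
    unfolding module_dehn_def using f by (intro SUP_upper) auto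
  then have "module_area T m l fs f \<le> enat D"
    using D by (rule order_trans)
  then obtain \<mu> where \<mu>: "\<mu> \<in> {..<l} \<rightarrow> carrier ZT" "f = lincomb (free_module ZT m) l \<mu> fs"
    "(\<Sum>j<l. gr_norm (\<mu> j)) \<le> D"
    by (rule module_area_le)
  have supp: "finite (supp (\<mu> j))" "supp (\<mu> j) \<subseteq> carrier T" if "j < l" for j
    using \<mu>(1) that by (auto simp: group_ring_def)
  obtain rs where rs: "length rs = (\<Sum>j<l. gr_norm (\<mu> j))"
    "\<And>u j p. (u, j, p) \<in> set rs \<Longrightarrow> j < l \<and> u \<in> supp (\<mu> j)"
    "\<And>j. j < l \<Longrightarrow> signed_count rs j = \<mu> j"
    using signed_count_exists[of l \<mu>, OF supp(1)] by metis
  have valid_rs: "valid l rs"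
    using rs(2) supp(2) by (force simp: valid_def)
  have "signed_count (expand F rs) i u = signed_count ts i u" for i u
  proof (cases "i < m")
    case True
    then show ?thesis
      using lincomb_free_module_signed_count[OF gens F valid_rs rs(3) True]
      unfolding \<mu>(2)[symmetric] by (simp add: f_def)
  next
    \<comment> \<open>Beyond the last generator both counts vanish, which upgrades equality of
      coordinates to equality of functions.\<close>
    case False
    then have "m \<le> i" by simp
    moreover have "valid m (expand F rs)"
      by (rule valid_expand[OF F(1) valid_rs])
    ultimately show ?thesis
      using valid_ts by (simp add: signed_count_outside)
  qed
  then show ?thesis
    using that[OF valid_rs] rs(1) \<mu>(3) by auto
qed

lemma near_one_cball: "x \<in> carrier M \<Longrightarrow> near k x \<one> \<Longrightarrow> cball k x"
  using near_sym[of k x \<one>] by (simp add: near_def)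

text \<open>The product of conjugates passes through \<open>tword ys\<close>,
  \<open>lword ts\<close> and \<open>lword (expand F rs')\<close> to the unit: normal-form
  conjugators, rearrangement, killing of relators. \<open>D\<close> stays separate from
  \<open>L\<close>, since the growth of the module Dehn function is not known.\<close>

lemma cubic_bound:
  assumes gens: "generates ZT (free_module ZT m) (rel_module ZT A m a) l fs"
  obtains C where "\<And>L D x. word_ball M (tset \<union> \<beta> ` {..<m}) L x \<Longrightarrow> x \<in> normal_closure M R \<Longrightarrow>
    module_dehn T A s t m a l fs (C * (Suc L)\<^sup>2) \<le> enat D \<Longrightarrow> near (C * (L + D + 1) ^ 3) x \<one>"
proof -
  obtain F where F: "\<And>j. j < l \<Longrightarrow> valid m (F j)"
    "\<And>j i. j < l \<Longrightarrow> i < m \<Longrightarrow> signed_count (F j) i = fs j i"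
    "\<And>j. j < l \<Longrightarrow> lincomb A m (signed_count (F j)) a = \<zero>\<^bsub>A\<^esub>"
    using relator_lists[OF gens a_closed] by metis
  have "\<exists>H. set (F j) \<subseteq> terms H" if "j \<in> {..<l}" for j
    using valid_terms[OF F(1)] that by (metis lessThan_iff)
  then obtain H where H: "\<And>j. j \<in> {..<l} \<Longrightarrow> set (F j) \<subseteq> terms H"
    using uniform_bound[of "{..<l}" "\<lambda>N j. set (F j) \<subseteq> terms N"] terms_mono
    by (metis finite_lessThan order_trans)
  have "\<exists>k. near k (lword (F j)) \<one>" if "j \<in> {..<l}" for j
    using \<rho>_\<alpha>_lword[OF H[OF that]] F(3)[of j] that lword_closed[OF H[OF that]] \<alpha>_one
    by (intro near_ex) auto
  then obtain k where k: "\<And>j. j \<in> {..<l} \<Longrightarrow> near k (lword (F j)) \<one>"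
    using uniform_bound[of "{..<l}" "\<lambda>k j. near k (lword (F j)) \<one>"] near_mono
    by (metis finite_lessThan)
  have H': "set (F j) \<subseteq> terms H" and k': "near k (lword (F j)) \<one>" if "j < l" for j
    using H k that by auto
  obtain b where b: "\<And>j. j \<in> {..<l} \<Longrightarrow> length (F j) \<le> b"
    using uniform_bound[of "{..<l}" "\<lambda>b j. length (F j) \<le> b"] by (metis finite_lessThan order_trans order_refl)
  obtain c0 where c0: "\<And>n x. tball n x \<Longrightarrow> near (c0 * Suc n * Suc n) x (lift (\<rho> x))"
    and height: "\<And>n x. tball n x \<Longrightarrow> height (\<rho> x) \<le> n + c0"
    by (rule tball_near_lift) (rule that)
  \<comment> \<open>Pays for the step from the lift of the unit to the unit, once the part in
    \<open>T\<close> has been collected.\<close>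
  have "\<exists>k1. near k1 (lift \<one>\<^bsub>T\<^esub>) \<one>"
    using \<alpha>_tball[OF tball_lift] by (intro near_ex) (auto simp: \<rho>_lift \<alpha>_one)
  then obtain k1 where k1: "near k1 (lift \<one>\<^bsub>T\<^esub>) \<one>" by blast
  obtain c1 where c1: "\<And>N xs ys. set xs \<subseteq> terms N \<Longrightarrow> set ys \<subseteq> terms N \<Longrightarrow>
    signed_count xs = signed_count ys \<Longrightarrow>
    near (c1 * Suc N * (length xs + length ys)\<^sup>2) (lword xs) (lword ys)"
    by (rule lword_signed_count_eq) (rule that)
  obtain c2 where c2: "\<And>N rs. valid l rs \<Longrightarrow> (\<And>x. x \<in> set rs \<Longrightarrow> height (fst x) \<le> N) \<Longrightarrow>
    near (c2 * (Suc N)\<^sup>2 * length rs) (lword (expand F rs)) \<one>"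
    by (rule near_lword_expand[of l F H k, OF H' k']) (assumption | erule that)+
  obtain r where r: "\<And>b ts rs. set ts \<subseteq> terms b \<Longrightarrow> valid l rs \<Longrightarrow>
    signed_count (expand F rs) = signed_count ts \<Longrightarrow>
    \<exists>rs'. valid l rs' \<and> length rs' \<le> length rs \<and>
      (\<forall>x\<in>set rs'. height (fst x) \<le> b + r * length rs) \<and>
      set (expand F rs') \<subseteq> terms (b + r * length rs + r) \<and>
      signed_count (expand F rs') = signed_count ts"
    by (rule expand_truncate[of l F H, OF H']) (assumption | erule that)+
  define E where "E = c0 + k1 + 2 * c0 + c1 * (1 + c0 + 2 * r) * (1 + b)\<^sup>2 + c2 * (1 + c0 + 2 * r)\<^sup>2"
  \<comment> \<open>\<open>E\<close> is the coefficient from \<open>cubic_arith\<close>. The extra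
    \<open>2 * c0 + 2\<close> makes the argument of \<open>module_dehn\<close> large enough for the
    norm of the relation read off from \<open>x\<close>.\<close>
  define C where "C = E + 2 * c0 + 2"
  have "near (C * (L + D + 1) ^ 3) x \<one>"
    if x: "word_ball M (tset \<union> \<beta> ` {..<m}) L x" and xN: "x \<in> normal_closure M R"
      and D: "module_dehn T A s t m a l fs (C * (Suc L)\<^sup>2) \<le> enat D" for L D x
  proof -
    have xM: "x \<in> carrier M"
      using word_ball_closed[OF x gens_subset] .
    obtain z ys where z: "tball L z" "x = z \<otimes> tword ys" "length ys \<le> L"
      and ys: "\<forall>(y, i, p)\<in>set ys. i < m \<and> tball L y"
      using collect_letters[OF x] by blast
    have zM: "z \<in> carrier M"
      using z tball_closed by blast
    have ysM: "set ys \<subseteq> carrier M \<times> {..<m} \<times> UNIV"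
      using ys tball_closed by fast
    have WM: "tword ys \<in> carrier M"
      using tword_closed[OF ysM] .
    define ts where "ts = map (\<lambda>(y, i, p). (\<rho> y, i, p)) ys"
    have ts: "set ts \<subseteq> terms (L + c0)"
      using ys height tball_closed by (fastforce simp: ts_def terms_def)
    have "\<rho> z \<otimes>\<^bsub>T\<^esub> \<one>\<^bsub>T\<^esub> = \<one>\<^bsub>T\<^esub>"
      using kernel[OF xM] xN zM WM \<rho>_tword[OF ysM] unfolding z(2) by simp
    \<comment> \<open>Both \<open>x\<close> and the product of conjugates lie over the unit, so the
      remaining word \<open>z\<close> does too and can be killed at quadratic cost.\<close>
    then have \<rho>z: "\<rho> z = \<one>\<^bsub>T\<^esub>"
      using zM by simp
    have "\<alpha> x = \<alpha> z \<oplus>\<^bsub>A\<^esub> \<alpha> (tword ys)"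
      unfolding z(2) using zM WM \<rho>_tword[OF ysM] by (intro \<alpha>_mult_one)
    then have lin: "lincomb A m (signed_count ts) a = \<zero>\<^bsub>A\<^esub>"
      using \<alpha>_tball[OF z(1)] kernel[OF xM] xN \<alpha>_tword[OF ysM] \<alpha>_closed[OF WM] by (simp add: ts_def)
    have len: "length ts \<le> L"
      using z(3) by (simp add: ts_def)
    \<comment> \<open>At most \<open>L\<close> terms of height at most \<open>L + c0\<close>: the
      left-hand side bounds the norm of the relation.\<close>
    have "(2 * (L + c0) + 1) * length ts \<le> ((2 * c0 + 2) * Suc L) * Suc L"
      using len by (intro mult_le_mono) (auto simp: algebra_simps)
    also have "\<dots> \<le> C * (Suc L)\<^sup>2"
      unfolding C_def power2_eq_square by (simp only: mult.assoc mult_le_mono1 le_add2 add.assoc)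
    finally have "module_dehn T A s t m a l fs ((2 * (L + c0) + 1) * length ts) \<le>
        module_dehn T A s t m a l fs (C * (Suc L)\<^sup>2)"
      unfolding module_dehn_def by (intro SUP_subset_mono) auto
    then have "module_dehn T A s t m a l fs ((2 * (L + c0) + 1) * length ts) \<le> enat D"
      using D by (rule order_trans)
    then obtain rs where rs: "valid l rs" "length rs \<le> D" "signed_count (expand F rs) = signed_count ts"
      using relation_expand[OF gens F(1,2) ts lin] by metis
    obtain rs' where rs': "valid l rs'" "length rs' \<le> length rs"
      "\<forall>x\<in>set rs'. height (fst x) \<le> L + c0 + r * length rs"
      "set (expand F rs') \<subseteq> terms (L + c0 + r * length rs + r)"
      "signed_count (expand F rs') = signed_count ts"
      \<comment> \<open>Truncation bounds the heights in terms of \<open>L\<close> and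
        \<open>D\<close> while keeping the signed count.\<close>
      using r[OF ts rs(1,3)] by blast
    define N where "N = L + c0 + r * length rs + r"
    have N: "N \<le> L + c0 + r * D + r"
      using rs(2) by (simp add: N_def)
    have VM: "lword ts \<in> carrier M" "lword (expand F rs') \<in> carrier M"
      using lword_closed[OF ts] lword_closed[OF rs'(4)] .
    have 1: "near (c0 * Suc L * Suc L + k1) z \<one>"
      using near_trans[OF c0[OF z(1)] k1[folded \<rho>z]] zM by simp
    \<comment> \<open>Collecting at most \<open>L\<close> conjugators at quadratic cost each gives
      one of the cubic contributions.\<close>
    have 2: "near (2 * (c0 * Suc L * Suc L) * length ts) (tword ys) (lword ts)"
    proof -
      have "near (2 * (c0 * Suc L * Suc L) * length ys) (tword (map (\<lambda>(y, i, p). (y, i, p)) ys))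
          (tword (map (\<lambda>(y, i, p). (lift (\<rho> y), i, p)) ys))"
      proof (rule near_tword)
        fix y i p assume "(y, i, p) \<in> set ys"
        then have "i < m" "tball L y" using ys by auto
        then show "i < m \<and> y \<in> carrier M \<and> lift (\<rho> y) \<in> carrier M \<and> near (c0 * Suc L * Suc L) y (lift (\<rho> y))"
          using c0[of L y] tball_closed by simp
      qed
      then show ?thesis
        by (simp add: ts_def lword_def case_prod_unfold o_def)
    qed
    have "set ts \<subseteq> terms N" "set (expand F rs') \<subseteq> terms N"
      using ts terms_mono[of "L + c0" N] rs'(4) by (auto simp: N_def)
    then have "near (c1 * Suc N * (length ts + length (expand F rs'))\<^sup>2) (lword ts) (lword (expand F rs'))"
      using rs'(5) by (intro c1) auto
    moreover have "length (expand F rs') \<le> b * D"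
    proof -
      have "length (expand F rs') \<le> b * length rs'"
        using b rs'(1) by (intro length_expand[of l]) auto
      also have "\<dots> \<le> b * D"
        using rs(2) rs'(2) by (intro mult_le_mono2) simp
      finally show ?thesis .
    qed
    then have "c1 * Suc N * (length ts + length (expand F rs'))\<^sup>2 \<le> c1 * Suc N * (length ts + b * D)\<^sup>2"
      by (intro mult_le_mono2 power_mono) auto
    ultimately have 3: "near (c1 * Suc N * (length ts + b * D)\<^sup>2) (lword ts) (lword (expand F rs'))"
      by (rule near_mono)
    have "near (c2 * (Suc N)\<^sup>2 * length rs') (lword (expand F rs')) \<one>"
      using rs'(1,3) by (intro c2) (auto simp: N_def intro: trans_le_add1)
    moreover have "c2 * (Suc N)\<^sup>2 * length rs' \<le> c2 * (Suc N)\<^sup>2 * D"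
      using rs(2) rs'(2) by (intro mult_le_mono2) simp
    ultimately have 4: "near (c2 * (Suc N)\<^sup>2 * D) (lword (expand F rs')) \<one>"
      by (rule near_mono)
    have "near (c0 * Suc L * Suc L + k1 + (2 * (c0 * Suc L * Suc L) * length ts +
        (c1 * Suc N * (length ts + b * D)\<^sup>2 + c2 * (Suc N)\<^sup>2 * D))) x \<one>"
      unfolding z(2)
      using near_mult[OF 1 near_trans[OF 2 near_trans[OF 3 4]]] VM WM zM by simp
    then have "near (E * (L + D + 1) ^ 3) x \<one>"
      using cubic_arith[OF N len] unfolding E_def by (rule near_mono)
    moreover have "E * (L + D + 1) ^ 3 \<le> C * (L + D + 1) ^ 3"
      unfolding C_def by (intro mult_le_mono1) simp
    ultimately show ?thesis
      by (rule near_mono)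
  qed
  then show ?thesis using that by blast
qed

section \<open>Change of generators\<close>

lemma lword_word_ball:
  assumes "valid m xs"
  shows "\<exists>n. word_ball M (tset \<union> \<beta> ` {..<m}) n (lword xs)"
  using assms
proof (induction xs)
  case Nil
  show ?case by (auto intro: word_ball.one)
next
  case (Cons x xs)
  obtain u i p where x: "x = (u, i, p)" by (rule prod_cases3)
  then have i: "i < m" "valid m xs" using Cons.prems by auto
  then obtain n where n: "word_ball M (tset \<union> \<beta> ` {..<m}) n (lword xs)"
    using Cons.IH by blast
  have u: "word_ball M (tset \<union> \<beta> ` {..<m}) (height u) (lift u)"
    using word_ball_subset[OF tball_lift] by simp
  have \<beta>i: "\<beta> i \<in> tset \<union> \<beta> ` {..<m}" using i by simp
  have "word_ball M (tset \<union> \<beta> ` {..<m}) 1 (letter i p)"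
    using word_ball_gen[OF \<beta>i gens_subset] word_ball_gen_inv[OF \<beta>i gens_subset]
    by (simp add: letter_def)
  then have "word_ball M (tset \<union> \<beta> ` {..<m}) (height u + 1 + height u + n) (lword (x # xs))"
    unfolding x lword_Cons cj_def
    by (intro word_ball_mult word_ball_inv u n gens_subset)
  then show ?case by blast
qed

text \<open>The lifts generate \<open>M\<close> modulo the normal closure:
  \<open>lift (\<rho> x)\<close> matches the coordinate in \<open>T\<close>, and a suitable
  \<open>lword\<close> matches the coordinate in \<open>A\<close>.\<close>

lemma near_word_ball:
  assumes gen: "generates ZT A (carrier A) m a" and x: "x \<in> carrier M"
  shows "\<exists>n z. word_ball M (tset \<union> \<beta> ` {..<m}) n z \<and> near n x z"
proof -
  have "\<alpha> x \<in> {lincomb A m f a | f. f \<in> {..<m} \<rightarrow> carrier ZT}"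
    using gen \<alpha>_closed[OF x] by (simp add: generates_def)
  then obtain f where f: "f \<in> {..<m} \<rightarrow> carrier ZT" "\<alpha> x = lincomb A m f a"
    by blast
  have supp: "finite (supp (f j))" "supp (f j) \<subseteq> carrier T" if "j < m" for j
    using f(1) that by (auto simp: group_ring_def)
  obtain xs where xs: "\<And>u i p. (u, i, p) \<in> set xs \<Longrightarrow> i < m \<and> u \<in> supp (f i)"
    "\<And>i. i < m \<Longrightarrow> signed_count xs i = f i"
    using signed_count_exists[of m f, OF supp(1)] by metis
  have valid: "valid m xs"
    using xs(1) supp(2) by (force simp: valid_def)
  then obtain N where N: "set xs \<subseteq> terms N"
    by (rule valid_terms)
  have u: "\<rho> x \<in> carrier T" using x by simp
  have cl: "lword xs \<in> carrier M"
    using lword_closed[OF N] .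
  define z where "z = lift (\<rho> x) \<otimes> lword xs"
  have "\<alpha> z = \<alpha> (lift (\<rho> x)) \<oplus>\<^bsub>A\<^esub> \<alpha> (lword xs)"
    unfolding z_def using cl \<rho>_\<alpha>_lword[OF N] by (intro \<alpha>_mult_one) auto
  also have "\<dots> = \<alpha> (lword xs)"
    using \<alpha>_tball[OF tball_lift] \<alpha>_closed[OF cl] by simp
  also have "\<dots> = lincomb A m (signed_count xs) a"
    by (rule \<rho>_\<alpha>_lword(2)[OF N])
  also have "\<dots> = \<alpha> x"
    unfolding f(2) using f(1) xs(2) by (intro lincomb_cong) auto
  finally have \<alpha>z: "\<alpha> z = \<alpha> x" .
  have \<rho>z: "\<rho> z = \<rho> x"
    unfolding z_def using cl u \<rho>_\<alpha>_lword(1)[OF N] by (simp add: \<rho>_lift)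
  have "z \<in> carrier M"
    unfolding z_def using cl by simp
  from near_ex[OF x this \<rho>z[symmetric] \<alpha>z[symmetric]] obtain k where k: "near k x z"
    by blast
  obtain n where "word_ball M (tset \<union> \<beta> ` {..<m}) n (lword xs)"
    using lword_word_ball[OF valid] by blast
  then have "word_ball M (tset \<union> \<beta> ` {..<m}) (height (\<rho> x) + n) z"
    unfolding z_def using word_ball_subset[OF tball_lift]
    by (intro word_ball_mult gens_subset) auto
  \<comment> \<open>The sum lets one number bound both the length of \<open>z\<close> and its
    distance from \<open>x\<close>.\<close>
  then have "word_ball M (tset \<union> \<beta> ` {..<m}) (k + (height (\<rho> x) + n)) z"
    by (rule word_ball_mono) simp
  moreover from k have "near (k + (height (\<rho> x) + n)) x z"
    by (rule near_mono) simp
  ultimately show ?thesis by blast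
qed

text \<open>Letters are replaced one by one. By bi-invariance the errors add, so a word of length
  \<open>n\<close> is translated at linear cost.\<close>

lemma change_generators:
  assumes gen: "generates ZT A (carrier A) m a" and S: "finite S" "S \<subseteq> carrier M"
  obtains c where "\<And>n x. word_ball M S n x \<Longrightarrow>
    \<exists>z. word_ball M (tset \<union> \<beta> ` {..<m}) (c * n) z \<and> near (c * n) x z"
proof -
  let ?G = "tset \<union> \<beta> ` {..<m}"
  have "\<exists>n z. word_ball M ?G n z \<and> near n x z" if "x \<in> S" for x
    using near_word_ball[OF gen] that S by blast
  then obtain c where c: "\<And>x. x \<in> S \<Longrightarrow> \<exists>z. word_ball M ?G c z \<and> near c x z"
    using uniform_bound[of S "\<lambda>n x. \<exists>z. word_ball M ?G n z \<and> near n x z"] S(1) word_ball_mono near_mono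
    by (smt (verit))
  have "\<exists>z. word_ball M ?G (c * n) z \<and> near (c * n) x z" if "word_ball M S n x" for n x
    using that
  proof (induction rule: word_ball.induct)
    case (one n)
    then show ?case using word_ball.one near_refl by blast
  next
    case (mult n x g)
    then obtain z where z: "word_ball M ?G (c * n) z" "near (c * n) x z" by blast
    obtain h where h: "word_ball M ?G c h" "near c g h" using c mult.hyps(2) by blast
    have cl: "x \<in> carrier M" "g \<in> carrier M" "z \<in> carrier M" "h \<in> carrier M"
      using word_ball_closed[OF mult.hyps(1) S(2)] mult.hyps(2) S(2) word_ball_closed[OF z(1) gens_subset]
        word_ball_closed[OF h(1) gens_subset] by auto
    show ?case
      using word_ball_mult[OF h(1) z(1) gens_subset] near_mult[OF h(2) z(2)] cl by auto
  next
    case (mult_inv n x g)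
    then obtain z where z: "word_ball M ?G (c * n) z" "near (c * n) x z" by blast
    obtain h where h: "word_ball M ?G c h" "near c g h" using c mult_inv.hyps(2) by blast
    have cl: "x \<in> carrier M" "g \<in> carrier M" "z \<in> carrier M" "h \<in> carrier M"
      using word_ball_closed[OF mult_inv.hyps(1) S(2)] mult_inv.hyps(2) S(2) word_ball_closed[OF z(1) gens_subset]
        word_ball_closed[OF h(1) gens_subset] by auto
    show ?case
      using word_ball_mult[OF word_ball_inv[OF h(1) gens_subset] z(1) gens_subset]
        near_mult[OF near_inv[OF h(2)] z(2)] cl by auto
  qed
  then show ?thesis using that by blast
qed

end

section \<open>From presentations to lifts\<close>

text \<open>The projection to the quotient followed by the inverse of the isomorphism.
  \<open>K\<close> is assumed only to be closed and to have an idempotent \<open>one\<close>, which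
  spares proving that the semidirect product is a group.\<close>

lemma (in normal) iso_factor_group_map:
  fixes K (structure)
  assumes "K \<cong> G Mod H"
    and closed: "\<And>x y. x \<in> carrier K \<Longrightarrow> y \<in> carrier K \<Longrightarrow> x \<otimes>\<^bsub>K\<^esub> y \<in> carrier K"
    and one: "\<one>\<^bsub>K\<^esub> \<in> carrier K" "\<one>\<^bsub>K\<^esub> \<otimes>\<^bsub>K\<^esub> \<one>\<^bsub>K\<^esub> = \<one>\<^bsub>K\<^esub>"
  obtains \<pi> where "\<And>x. x \<in> carrier G \<Longrightarrow> \<pi> x \<in> carrier K"
    "\<And>x y. x \<in> carrier G \<Longrightarrow> y \<in> carrier G \<Longrightarrow> \<pi> (x \<otimes>\<^bsub>G\<^esub> y) = \<pi> x \<otimes>\<^bsub>K\<^esub> \<pi> y"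
    "\<And>g. g \<in> carrier K \<Longrightarrow> \<exists>x\<in>carrier G. \<pi> x = g"
    "\<And>x. x \<in> carrier G \<Longrightarrow> x \<in> H \<longleftrightarrow> \<pi> x = \<one>\<^bsub>K\<^esub>"
proof -
  obtain \<phi> where \<phi>: "\<phi> \<in> hom K (G Mod H)" "bij_betw \<phi> (carrier K) (carrier (G Mod H))"
    using assms(1) by (auto simp: is_iso_def iso_def)
  have inj: "inj_on \<phi> (carrier K)" and img: "\<phi> ` carrier K = carrier (G Mod H)"
    using \<phi>(2) by (auto simp: bij_betw_def)
  interpret Q: group "G Mod H" by (rule factorgroup_is_group)
  define \<pi> where "\<pi> x = inv_into (carrier K) \<phi> (H #>\<^bsub>G\<^esub> x)" for x
  have coset: "H #>\<^bsub>G\<^esub> x \<in> \<phi> ` carrier K" if "x \<in> carrier G" for x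
    unfolding img using that by (auto simp: FactGroup_def RCOSETS_def)
  have \<pi>: "\<pi> x \<in> carrier K" "\<phi> (\<pi> x) = H #>\<^bsub>G\<^esub> x" if "x \<in> carrier G" for x
    unfolding \<pi>_def using coset[OF that] by (rule inv_into_into, rule f_inv_into_f)
  have \<phi>_one: "\<phi> \<one>\<^bsub>K\<^esub> = \<one>\<^bsub>G Mod H\<^esub>"
  proof -
    have "\<phi> \<one>\<^bsub>K\<^esub> \<in> carrier (G Mod H)"
      using img one(1) by blast
    \<comment> \<open>The image of \<open>one\<close> is idempotent, and a group has no idempotent
      besides its unit.\<close>
    moreover have "\<phi> \<one>\<^bsub>K\<^esub> \<otimes>\<^bsub>G Mod H\<^esub> \<phi> \<one>\<^bsub>K\<^esub> = \<phi> \<one>\<^bsub>K\<^esub>"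
      using hom_mult[OF \<phi>(1) one(1) one(1)] one(2) by simp
    ultimately show ?thesis
      using Q.l_cancel_one by blast
  qed
  show ?thesis
  proof (rule that[of \<pi>])
    fix x y assume xy: "x \<in> carrier G" "y \<in> carrier G"
    have "\<phi> (\<pi> x \<otimes>\<^bsub>K\<^esub> \<pi> y) = (H #>\<^bsub>G\<^esub> x) <#>\<^bsub>G\<^esub> (H #>\<^bsub>G\<^esub> y)"
      using hom_mult[OF \<phi>(1) \<pi>(1)[OF xy(1)] \<pi>(1)[OF xy(2)]] \<pi>(2) xy by (simp add: FactGroup_def)
    also have "\<dots> = \<phi> (\<pi> (x \<otimes>\<^bsub>G\<^esub> y))"
      using xy by (simp add: rcos_sum \<pi>(2))
    finally show "\<pi> (x \<otimes>\<^bsub>G\<^esub> y) = \<pi> x \<otimes>\<^bsub>K\<^esub> \<pi> y"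
      using inj_onD[OF inj] \<pi>(1) xy closed by (metis m_closed)
  next
    fix g assume g: "g \<in> carrier K"
    then have "\<phi> g \<in> carrier (G Mod H)"
      using img by blast
    then obtain x where x: "x \<in> carrier G" "\<phi> g = H #>\<^bsub>G\<^esub> x"
      by (auto simp: FactGroup_def RCOSETS_def)
    then have "\<pi> x = g"
      unfolding \<pi>_def using inv_into_f_f[OF inj g] by simp
    then show "\<exists>x\<in>carrier G. \<pi> x = g"
      using x(1) by blast
  next
    fix x assume x: "x \<in> carrier G"
    have "x \<in> H \<longleftrightarrow> H #>\<^bsub>G\<^esub> x = H"
      using coset_join1[OF _ x is_subgroup] coset_join2[OF x is_subgroup] by blast
    also have "\<dots> \<longleftrightarrow> \<phi> (\<pi> x) = \<phi> \<one>\<^bsub>K\<^esub>"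
      using \<pi>(2)[OF x] \<phi>_one by (simp add: FactGroup_def)
    also have "\<dots> \<longleftrightarrow> \<pi> x = \<one>\<^bsub>K\<^esub>"
      using inj_on_eq_iff[OF inj \<pi>(1)[OF x] one(1)] .
    finally show "x \<in> H \<longleftrightarrow> \<pi> x = \<one>\<^bsub>K\<^esub>" .
  qed (rule \<pi>(1))
qed

lemma (in conj_metric) normal_normal_closure: "normal_closure M R \<lhd> M"
  unfolding normal_closure_eq
proof (rule normal_generateI[OF conjs_subset])
  fix h g assume "h \<in> conjs" "g \<in> carrier M"
  then show "g \<otimes> h \<otimes> inv g \<in> conjs"
    using cj_conjs[of h "inv g"] by (simp add: cj_def)
qed

text \<open>The two coordinates of the surjection onto the semidirect product. The crossed rule for
  \<open>\<alpha>\<close> is its multiplication law read in the first coordinate.\<close>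

lemma semidirect_map_exists:
  assumes "conj_metric M R" "comm_group T" "module (group_ring T) A"
    and iso: "semidirect T A \<cong> M Mod normal_closure M R"
  obtains \<rho> \<alpha> where "semidirect_map M R T A \<rho> \<alpha>"
    "\<And>x u. x \<in> carrier A \<Longrightarrow> u \<in> carrier T \<Longrightarrow> \<exists>g\<in>carrier M. \<alpha> g = x \<and> \<rho> g = u"
proof -
  interpret conj_metric M R by fact
  interpret group_ring_module T A
    by (intro group_ring_module.intro assms)
  interpret N: normal "normal_closure M R" M by (rule normal_normal_closure)
  obtain \<pi> where \<pi>: "\<And>x. x \<in> carrier M \<Longrightarrow> \<pi> x \<in> carrier (semidirect T A)"
    "\<And>x y. x \<in> carrier M \<Longrightarrow> y \<in> carrier M \<Longrightarrow> \<pi> (x \<otimes>\<^bsub>M\<^esub> y) = \<pi> x \<otimes>\<^bsub>semidirect T A\<^esub> \<pi> y"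
    "\<And>g. g \<in> carrier (semidirect T A) \<Longrightarrow> \<exists>x\<in>carrier M. \<pi> x = g"
    "\<And>x. x \<in> carrier M \<Longrightarrow> x \<in> normal_closure M R \<longleftrightarrow> \<pi> x = \<one>\<^bsub>semidirect T A\<^esub>"
  proof (rule N.iso_factor_group_map[OF iso])
    fix x y assume "x \<in> carrier (semidirect T A)" "y \<in> carrier (semidirect T A)"
    then show "x \<otimes>\<^bsub>semidirect T A\<^esub> y \<in> carrier (semidirect T A)"
      using act_closed by (auto simp: semidirect_def)
  next
    show "\<one>\<^bsub>semidirect T A\<^esub> \<in> carrier (semidirect T A)"
      "\<one>\<^bsub>semidirect T A\<^esub> \<otimes>\<^bsub>semidirect T A\<^esub> \<one>\<^bsub>semidirect T A\<^esub> = \<one>\<^bsub>semidirect T A\<^esub>"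
      by (simp_all add: semidirect_def of_elem_closed)
  qed (rule that)
  have mult: "\<pi> (x \<otimes>\<^bsub>M\<^esub> y) =
      ((of_elem (snd (\<pi> y)) \<odot>\<^bsub>A\<^esub> fst (\<pi> x)) \<oplus>\<^bsub>A\<^esub> fst (\<pi> y), snd (\<pi> x) \<otimes>\<^bsub>T\<^esub> snd (\<pi> y))"
    if "x \<in> carrier M" "y \<in> carrier M" for x y
    using \<pi>(2)[OF that] by (simp add: semidirect_def case_prod_unfold)
  have closed: "fst (\<pi> x) \<in> carrier A" "snd (\<pi> x) \<in> carrier T" if "x \<in> carrier M" for x
    using \<pi>(1)[OF that] by (auto simp: semidirect_def)
  show ?thesis
  proof (rule that[of "snd \<circ> \<pi>" "fst \<circ> \<pi>"])
    show "semidirect_map M R T A (snd \<circ> \<pi>) (fst \<circ> \<pi>)"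
    proof unfold_locales
      show "snd \<circ> \<pi> \<in> hom M T"
        using closed mult by (intro homI) auto
    next
      fix x assume "x \<in> carrier M"
      then show "x \<in> normal_closure M R \<longleftrightarrow>
          (snd \<circ> \<pi>) x = \<one>\<^bsub>T\<^esub> \<and> (fst \<circ> \<pi>) x = \<zero>\<^bsub>A\<^esub>"
        using \<pi>(4)[of x] by (auto simp: semidirect_def prod_eq_iff)
    qed (use closed mult in auto)
    fix x u assume "x \<in> carrier A" "u \<in> carrier T"
    then have "(x, u) \<in> carrier (semidirect T A)"
      by (simp add: semidirect_def)
    then show "\<exists>g\<in>carrier M. (fst \<circ> \<pi>) g = x \<and> (snd \<circ> \<pi>) g = u"
      using \<pi>(3) by (metis comp_apply fst_conv snd_conv)
  qed
qed

lemma metabelian_lift_exists: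
  assumes M: "conj_metric M R" "metabelian M"
    and T: "comm_group T" "cyclic_basis T s t"
    and A: "module (group_ring T) A" "a \<in> {..<m} \<rightarrow> carrier A"
    and iso: "semidirect T A \<cong> M Mod normal_closure M R"
  obtains \<rho> \<alpha> \<tau> \<beta> where "metabelian_lift M R T A \<rho> \<alpha> s t \<tau> m a \<beta>"
proof -
  obtain \<rho> \<alpha> where \<rho>: "semidirect_map M R T A \<rho> \<alpha>"
    and surj: "\<And>x u. x \<in> carrier A \<Longrightarrow> u \<in> carrier T \<Longrightarrow> \<exists>g\<in>carrier M. \<alpha> g = x \<and> \<rho> g = u"
    by (rule semidirect_map_exists[OF M(1) T(1) A(1) iso]) (rule that)
  interpret semidirect_map M R T A \<rho> \<alpha> by (rule \<rho>)
  have t: "t j \<in> carrier T" if "j < s" for j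
    using T(2) that by (auto simp: cyclic_basis_def)
  have "\<forall>j. \<exists>g. j < s \<longrightarrow> g \<in> carrier M \<and> \<alpha> g = \<zero>\<^bsub>A\<^esub> \<and> \<rho> g = t j"
    using surj[OF A.M.zero_closed t] by blast
  then obtain \<tau> where \<tau>: "\<And>j. j < s \<Longrightarrow> \<tau> j \<in> carrier M \<and> \<alpha> (\<tau> j) = \<zero>\<^bsub>A\<^esub> \<and> \<rho> (\<tau> j) = t j"
    by metis
  have "\<forall>i. \<exists>g. i < m \<longrightarrow> g \<in> carrier M \<and> \<alpha> g = a i \<and> \<rho> g = \<one>\<^bsub>T\<^esub>"
    using surj[OF _ T.one_closed] A(2) by (metis PiE lessThan_iff)
  then obtain \<beta> where \<beta>: "\<And>i. i < m \<Longrightarrow> \<beta> i \<in> carrier M \<and> \<alpha> (\<beta> i) = a i \<and> \<rho> (\<beta> i) = \<one>\<^bsub>T\<^esub>"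
    by metis
  have "metabelian_lift M R T A \<rho> \<alpha> s t \<tau> m a \<beta>"
    by unfold_locales (use M(2) T(2) \<tau> \<beta> in auto)
  then show ?thesis by (rule that)
qed

lemma rel_area_le:
  assumes "conj_metric (free_metabelian X) R"
    and "word_ball (free_metabelian X) (conj_metric.conjs (free_metabelian X) R) k w"
  shows "rel_area X R w \<le> enat k"
proof -
  interpret conj_metric "free_metabelian X" R by fact
  obtain ps where ps: "set ps \<subseteq> carrier (free_metabelian X) \<times> (R \<union> (\<lambda>r. inv\<^bsub>free_metabelian X\<^esub> r) ` R)"
    "w = conj_prod (free_metabelian X) ps" "length ps \<le> k"
    using cball_conj_prod[OF assms(2)] by blast
  have "rel_area X R w \<le> enat (length ps)"
    unfolding rel_area_def Let_def using ps(1,2) by (intro INF_lower) simp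
  also have "\<dots> \<le> enat k" using ps(3) by simp
  finally show ?thesis .
qed

lemma module_dehn_mono: "k \<le> n \<Longrightarrow> module_dehn T A s t m a l fs k \<le> module_dehn T A s t m a l fs n"
  unfolding module_dehn_def by (intro SUP_subset_mono) auto

lemma enat_power: "enat d ^ n = enat (d ^ n)"
  by (induction n) (auto simp: one_enat_def)

text \<open>\<open>D\<close> is any finite bound on the module Dehn function. The case of an
  infinite value is left to the final statement.\<close>

lemma rel_dehn_cubic:
  assumes T: "comm_group T" and A: "module (group_ring T) A" and basis: "cyclic_basis T s t"
    and gen: "generates (group_ring T) A (carrier A) m a"
    and rels: "generates (group_ring T) (free_module (group_ring T) m) (rel_module (group_ring T) A m a) l fs"
    and pres: "rel_presentation X R (semidirect T A)"
  obtains C where "\<And>n D. n \<ge> 1 \<Longrightarrow> module_dehn T A s t m a l fs ((C * n)\<^sup>2) \<le> enat D \<Longrightarrow>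
    rel_dehn X R n \<le> enat (C * max n D ^ 3)"
proof -
  define M where "M = free_metabelian X"
  have X: "finite X" and R: "R \<subseteq> carrier M" and iso: "semidirect T A \<cong> M Mod normal_closure M R"
    using pres by (auto simp: rel_presentation_def M_def)
  have cM: "conj_metric M R"
    using R group_free_metabelian by (simp add: conj_metric_def conj_metric_axioms_def M_def)
  have a: "a \<in> {..<m} \<rightarrow> carrier A"
    using gen unfolding generates_def by (rule conjunct1)
  have met: "metabelian M"
    unfolding M_def by (rule metabelian_free_metabelian)
  obtain \<rho> \<alpha> \<tau> \<beta> where "metabelian_lift M R T A \<rho> \<alpha> s t \<tau> m a \<beta>"
    by (rule metabelian_lift_exists[OF cM met T basis A a iso]) (rule that)
  then interpret metabelian_lift M R T A \<rho> \<alpha> s t \<tau> m a \<beta> .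
  obtain S where S: "finite S" "S \<subseteq> carrier M"
    "\<And>w. w \<in> carrier M \<Longrightarrow> word_ball M S (word_length w) w"
    by (rule free_metabelian_word_ball[OF X, folded M_def]) (rule that)
  obtain c where c: "\<And>n x. word_ball M S n x \<Longrightarrow>
    \<exists>z. word_ball M (tset \<union> \<beta> ` {..<m}) (c * n) z \<and> near (c * n) x z"
    by (rule change_generators[OF gen S(1,2)]) (rule that)
  obtain C where C: "\<And>L D x. word_ball M (tset \<union> \<beta> ` {..<m}) L x \<Longrightarrow> x \<in> normal_closure M R \<Longrightarrow>
    module_dehn T A s t m a l fs (C * (Suc L)\<^sup>2) \<le> enat D \<Longrightarrow> near (C * (L + D + 1) ^ 3) x \<one>\<^bsub>M\<^esub>"
    by (rule cubic_bound[OF rels]) (rule that)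
  \<comment> \<open>The summands pay for the change of generators, for the cubic bound with
    \<open>c * n + D + 1 \<le> (c + 2) * max n D\<close>, and for the argument of
    \<open>module_dehn\<close>.\<close>
  define K where "K = c + C * (c + 2) ^ 3 + C * (c + 1)"
  have "rel_dehn X R n \<le> enat (K * max n D ^ 3)"
    if n: "n \<ge> 1" and D: "module_dehn T A s t m a l fs ((K * n)\<^sup>2) \<le> enat D" for n D
    unfolding rel_dehn_def
  proof (rule SUP_least)
    fix w assume "w \<in> {w \<in> normal_closure (free_metabelian X) R. word_length w \<le> n}"
    then have w: "w \<in> normal_closure M R" "word_length w \<le> n"
      by (auto simp: M_def)
    have wM: "w \<in> carrier M"
      using w(1) normal_imp_subgroup[OF normal_normal_closure] subgroup.subset by blast
    have "word_ball M S n w"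
      using S(3)[OF wM] w(2) by (rule word_ball_mono)
    then obtain z where z: "word_ball M (tset \<union> \<beta> ` {..<m}) (c * n) z" "near (c * n) w z"
      using c by blast
    have zM: "z \<in> carrier M"
      using word_ball_closed[OF z(1) gens_subset] .
    \<comment> \<open>\<open>z\<close> is near \<open>w\<close>, so it has the same image and is
      itself a relation, as \<open>cubic_bound\<close> requires.\<close>
    have zN: "z \<in> normal_closure M R"
      using kernel[OF zM] kernel[OF wM] near_imp_eq[OF z(2) wM zM] w(1) by simp
    have "Suc (c * n) \<le> (c + 1) * n"
      using n by simp
    then have "C * (Suc (c * n))\<^sup>2 \<le> C * ((c + 1) * n)\<^sup>2"
      by (intro mult_le_mono2 power_mono) auto
    \<comment> \<open>\<open>C \<le> C * C\<close> moves the constant inside the square, since the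
      comparison evaluates \<open>module_dehn\<close> at \<open>(K * n)\<^sup>2\<close>.\<close>
    also have "\<dots> \<le> (C * ((c + 1) * n))\<^sup>2"
      using mult_le_mono1[OF le_square[of C], of "((c + 1) * n)\<^sup>2"]
      by (simp only: power_mult_distrib power2_eq_square[of C])
    also have "\<dots> \<le> (K * n)\<^sup>2"
      unfolding mult.assoc[symmetric] K_def by (intro power_mono mult_le_mono1) simp_all
    finally have "module_dehn T A s t m a l fs (C * (Suc (c * n))\<^sup>2) \<le> enat D"
      using D module_dehn_mono order_trans by blast
    from C[OF z(1) zN this] have "near (C * (c * n + D + 1) ^ 3) z \<one>\<^bsub>M\<^esub>" .
    then have "near (c * n + C * (c * n + D + 1) ^ 3) w \<one>\<^bsub>M\<^esub>"
      using near_trans[OF z(2)] wM zM by simp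
    moreover have "c * n + C * (c * n + D + 1) ^ 3 \<le> K * max n D ^ 3"
    proof -
      define q where "q = max n D"
      have q: "n \<le> q" "D \<le> q" "1 \<le> q"
        using n by (auto simp: q_def)
      have "c * n + D + 1 \<le> c * q + q + q"
        using q by (intro add_mono mult_le_mono) auto
      also have "\<dots> = (c + 2) * q"
        by simp
      finally have "C * (c * n + D + 1) ^ 3 \<le> C * ((c + 2) * q) ^ 3"
        by (intro mult_le_mono2 power_mono) auto
      also have "\<dots> = C * (c + 2) ^ 3 * q ^ 3"
        by (simp only: power_mult_distrib mult.assoc)
      finally have 1: "C * (c * n + D + 1) ^ 3 \<le> C * (c + 2) ^ 3 * q ^ 3" .
      have "n \<le> q ^ 3"
        using q self_le_power[of q 3] by simp
      then have "c * n \<le> c * q ^ 3"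
        by simp
      with 1 have "c * n + C * (c * n + D + 1) ^ 3 \<le> (c + C * (c + 2) ^ 3) * q ^ 3"
        by (simp only: add_mult_distrib add_mono)
      also have "\<dots> \<le> K * q ^ 3"
        unfolding K_def by (intro mult_le_mono1) simp
      finally show ?thesis
        by (simp add: q_def)
    qed
    ultimately have "cball (K * max n D ^ 3) w"
      using near_one_cball[OF wM] near_mono by blast
    then show "rel_area X R w \<le> enat (K * max n D ^ 3)"
      unfolding M_def by (rule rel_area_le[OF cM[unfolded M_def]])
  qed
  then show ?thesis using that by blast
qed

theorem proposition6p9:
  fixes T :: "('t, 'b) monoid_scheme"
    and A :: "('t \<Rightarrow> int, 'a, 'c) module_scheme"
    and t :: "nat \<Rightarrow> 't" and a :: "nat \<Rightarrow> 'a" and fs :: "nat \<Rightarrow> nat \<Rightarrow> 't \<Rightarrow> int"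
    and s m l :: nat
    and X :: "'x set" and R :: "'x letter list set set"
  assumes "comm_group T"
    and "module (group_ring T) A"
    and "cyclic_basis T s t"
    and "generates (group_ring T) A (carrier A) m a"
    and "generates (group_ring T) (free_module (group_ring T) m)
           (rel_module (group_ring T) A m a) l fs"
    and "rel_presentation X R (semidirect T A)"
  shows "rel_dehn X R \<preceq>
           (\<lambda>n. max (enat (n ^ 3)) (module_dehn T A s t m a l fs (n\<^sup>2) ^ 3))"
proof -
  let ?\<delta> = "module_dehn T A s t m a l fs"
  obtain C where C: "\<And>n D. n \<ge> 1 \<Longrightarrow> ?\<delta> ((C * n)\<^sup>2) \<le> enat D \<Longrightarrow>
    rel_dehn X R n \<le> enat (C * max n D ^ 3)"
    using rel_dehn_cubic[OF assms] by metis
  \<comment> \<open>Adding 1 makes the constant positive, as \<open>preceq\<close> demands, and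
    avoids a product of zero and infinity, which is 0 in \<open>enat\<close>.\<close>
  define K where "K = C + 1"
  have "rel_dehn X R n \<le> enat K * max (enat ((K * n) ^ 3)) (?\<delta> ((K * n)\<^sup>2) ^ 3)" if n: "n \<ge> 1" for n
  proof (cases "?\<delta> ((K * n)\<^sup>2)")
    case (enat D)
    have "(C * n)\<^sup>2 \<le> (K * n)\<^sup>2"
      by (intro power_mono) (auto simp: K_def)
    then have "?\<delta> ((C * n)\<^sup>2) \<le> enat D"
      using module_dehn_mono enat by metis
    then have "rel_dehn X R n \<le> enat (C * max n D ^ 3)"
      by (rule C[OF n])
    also have "C * max n D ^ 3 \<le> K * max ((K * n) ^ 3) (D ^ 3)"
    proof (intro mult_le_mono)
      have "n ^ 3 \<le> (K * n) ^ 3"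
        by (intro power_mono) (auto simp: K_def)
      then show "max n D ^ 3 \<le> max ((K * n) ^ 3) (D ^ 3)"
        by (cases "n \<le> D") (auto simp: max_absorb1 max_absorb2 intro: max.coboundedI1)
    qed (simp add: K_def)
    then have "enat (C * max n D ^ 3) \<le> enat K * max (enat ((K * n) ^ 3)) (enat D ^ 3)"
      by (simp add: enat_power max_def split: if_splits)
    finally show ?thesis
      unfolding enat .
  next
    \<comment> \<open>An infinite module value makes the right-hand side infinite, since
      \<open>K\<close> is positive.\<close>
    case infinity
    have "(\<infinity>::enat) ^ 3 = \<infinity>"
      by (simp add: power3_eq_cube)
    moreover have "enat K * \<infinity> = \<infinity>"
      by (simp add: K_def imult_is_infinity zero_enat_def)
    ultimately show ?thesis
      unfolding infinity by (simp add: max_def)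
  qed
  then have "\<forall>n\<ge>1. rel_dehn X R n \<le> enat K * max (enat ((K * n) ^ 3)) (?\<delta> ((K * n)\<^sup>2) ^ 3)
      + enat (K * n) + enat K"
    by (metis add_increasing2 zero_le)
  then show ?thesis
    unfolding preceq_def by (intro exI[of _ K]) (simp add: K_def)
qed

end
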